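(* Let $\mathcal G$ be an equilateral metric graph (all edges of length $1$) satisfying the growth condition for equilateral graphs stated in the context. Then the spectrum of $-\Delta_{X_{\mathrm c}}$ within $\rho(H^D)$, where $H^D=-\frac{d^2}{dx^2}$ on $[0,1]$ with Dirichlet boundary conditions, is independent of the space $X_{\mathrm c}\in\{L^p(\mathcal G)\ (1\le p<\infty),\,C_0(\mathcal G),\,BUC(\mathcal G)\}$, i.e. $$\sigma(-\Delta_{X_{\mathrm c}})\cap\rho(H^D)=\sigma(-\Delta_{L^2})\cap\rho(H^D).$$
   Context: **Metric graph.** $\mathcal G$ is the metric graph over a countable, oriented, connected graph with vertex set $\mathcal V$ and edge set $\mathcal E$, without self-loops, uniformly locally finite: writing $\mathcal E_{\mathsf v}$ for the set of edges incident to $\mathsf v$, $\sup_{\mathsf v}|\mathcal E_{\mathsf v}|<\infty$. Every edge $\mathsf e$ has an initial vertex $i(\mathsf e)$ and a terminal vertex $t(\mathsf e)$ and is identified with $(0,1)$ ($0\leftrightarrow i(\mathsf e)$, $1\leftrightarrow t(\mathsf e)$). $\mathcal G$ carries the natural path metric; $B_r(x)$ is the ball of radius $r$ around $x$. Each edge has a conductivity $c(\mathsf e)>0$. **Growth condition (equilateral graphs).** For every $\varepsilon>0$ there is $C_\varepsilon>0$ such that for all $\mathsf e\in\mathcal E$ and all $r>0$, with $x=i(\mathsf e)$, the sum of $c(\mathsf e')$ over all edges $\mathsf e'$ fully contained in $B_r(x)$ is at most $C_\varepsilon e^{\varepsilon r}c(\mathsf e)$. **Spaces and operators.** $L^p(\mathcal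 G)$ is taken with respect to the measure whose restriction to $\mathsf e$ is $c(\mathsf e)$ times Lebesgue measure; $C_0(\mathcal G)$ and $BUC(\mathcal G)$ (bounded uniformly continuous functions) carry the sup-norm. $(\Delta_{X_{\mathrm c}}u)_{\mathsf e}=u_{\mathsf e}''$ with domain $\{u\in X_{\mathrm c}:(u''_{\mathsf e})_{\mathsf e}\in X_{\mathrm c},\ u\in C(\mathcal G),\ \sum_{\mathsf e\in\mathcal E_{\mathsf v}}\frac{\partial u_{\mathsf e}}{\partial n_{\mathsf e}}(\mathsf v)=0\ \forall\mathsf v\}$, where $\frac{\partial u_{\mathsf e}}{\partial n_{\mathsf e}}(\mathsf v)=c(\mathsf e)u_{\mathsf e}'(0^+)$ if $\mathsf v=i(\mathsf e)$ and $-c(\mathsf e)u_{\mathsf e}'(1^-)$ if $\mathsf v=t(\mathsf e)$; $C(\mathcal G)$ denotes continuous functions (in particular at vertices). $\sigma(H^D)=\{k^2\pi^2:k\in\mathbb N\}$. *)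

theory Defs
  imports "HOL-Analysis.Analysis" "Graph_Theory.Digraph_Component"
begin

section \<open>Metric graphs with unit edge lengths\<close>

text \<open>
  The underlying oriented multigraph is a digraph in the sense of the entry Graph_Theory,
  \<open>tail\<close> and \<open>head\<close> being the initial and terminal vertex of an edge; \<open>Digraph_Component.connected\<close>
  refers to the graph with orientations forgotten. Parallel edges are allowed. The condition
  \<open>arcs G \<noteq> {}\<close> only excludes the graph that consists of a single vertex, on which the family of
  the edgewise second derivatives carries no information.
\<close>

definition incident_edges :: "('v, 'e) pre_digraph \<Rightarrow> 'v \<Rightarrow> 'e set" where
  "incident_edges G v = {e \<in> arcs G. tail G e = v \<or> head G e = v}"

locale metric_graph = loopfree_digraph G for G :: "('v, 'e) pre_digraph" +
  fixes c :: "'e \<Rightarrow> real"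
  assumes countable_verts: "countable (verts G)"
    and countable_arcs: "countable (arcs G)"
    and nonempty_arcs: "arcs G \<noteq> {}"
    and connected_graph: "Digraph_Component.connected G"
    and uniformly_locally_finite:
      "\<exists>N. \<forall>v \<in> verts G. finite (incident_edges G v) \<and> card (incident_edges G v) \<le> N"
    and conductivity_pos: "e \<in> arcs G \<Longrightarrow> 0 < c e"

datatype ('v, 'e) point = Vertex 'v | Inner 'e real

definition points :: "('v, 'e) pre_digraph \<Rightarrow> ('v, 'e) point set" where
  "points G = Vertex ` verts G \<union> {Inner e s | e s. e \<in> arcs G \<and> 0 < s \<and> s < 1}"

text \<open>The parametrisation of the closed edge \<open>e\<close> by \<open>[0,1]\<close>.\<close>

definition edge_point :: "('v, 'e) pre_digraph \<Rightarrow> 'e \<Rightarrow> real \<Rightarrow> ('v, 'e) point" where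
  "edge_point G e s =
    (if s = 0 then Vertex (tail G e) else if s = 1 then Vertex (head G e) else Inner e s)"

text \<open>
  \<open>edge_path G x L y\<close>: some path from \<open>x\<close> to \<open>y\<close>, composed of finitely many segments each of which
  stays in one closed edge, has length \<open>L\<close>.
\<close>

inductive edge_path ::
    "('v, 'e) pre_digraph \<Rightarrow> ('v, 'e) point \<Rightarrow> real \<Rightarrow> ('v, 'e) point \<Rightarrow> bool"
  for G :: "('v, 'e) pre_digraph" and x :: "('v, 'e) point" where
  refl: "x \<in> points G \<Longrightarrow> edge_path G x 0 x"
| step: "\<lbrakk>edge_path G x L (edge_point G e a); e \<in> arcs G; a \<in> {0..1}; b \<in> {0..1}\<rbrakk>
         \<Longrightarrow> edge_path G x (L + \<bar>b - a\<bar>) (edge_point G e b)"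

text \<open>The value outside the graph is a convention that the locale Metric_space requires.\<close>

definition path_dist :: "('v, 'e) pre_digraph \<Rightarrow> ('v, 'e) point \<Rightarrow> ('v, 'e) point \<Rightarrow> real" where
  "path_dist G x y = (if x \<in> points G \<and> y \<in> points G then Inf {L. edge_path G x L y} else 0)"

definition graph_metric :: "('v, 'e) pre_digraph \<Rightarrow> ('v, 'e) point metric" where
  "graph_metric G = metric (points G, path_dist G)"

definition growth_condition :: "('v, 'e) pre_digraph \<Rightarrow> ('e \<Rightarrow> real) \<Rightarrow> bool" where
  "growth_condition G c \<longleftrightarrow>
    (\<forall>\<epsilon>>0. \<exists>C>0. \<forall>e \<in> arcs G. \<forall>r>0.
      (\<Sum>e' | e' \<in> arcs G \<and> Inner e' ` {0<..<1} \<subseteq> mball_of (graph_metric G) (Vertex (tail G e)) r. c e')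
        \<le> C * exp (\<epsilon> * r) * c e)"


text \<open>
  The next lemmas show that \<open>path_dist\<close> satisfies the hypotheses under which \<open>graph_metric\<close> is meaningful,
  that the sums in the growth condition are finite, and that the parametrisation through which
  \<open>graph_measure\<close> is defined below is measurable.
\<close>

context metric_graph
begin

lemma edge_point_in: "e \<in> arcs G \<Longrightarrow> s \<in> {0..1} \<Longrightarrow> edge_point G e s \<in> points G"
  by (auto simp: edge_point_def points_def)

lemma edge_path_props: "edge_path G x L y \<Longrightarrow> x \<in> points G \<and> y \<in> points G \<and> 0 \<le> L"
  by (induction rule: edge_path.induct) (auto intro: edge_point_in)

lemma edge_path_trans:
  assumes "edge_path G y M z" "edge_path G x L y"
  shows "edge_path G x (L + M) z"
  using assms(1)
proof induction
  case refl then show ?case using assms(2) by simp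
next
  case (step M e a b)
  then show ?case using edge_path.step[of G x "L + M" e a b] by (simp add: add.assoc)
qed

lemma edge_path_segment:
  assumes "e \<in> arcs G" "a \<in> {0..1}" "b \<in> {0..1}"
  shows "edge_path G (edge_point G e a) \<bar>b - a\<bar> (edge_point G e b)"
  using edge_path.step[of G _ 0 e a b, OF edge_path.refl[OF edge_point_in]] assms by simp

lemma edge_path_sym: "edge_path G x L y \<Longrightarrow> edge_path G y L x"
proof (induction rule: edge_path.induct)
  case (step L e a b)
  have "edge_path G (edge_point G e b) \<bar>a - b\<bar> (edge_point G e a)"
    using edge_path_segment step.hyps by blast
  from edge_path_trans[OF step.IH this] show ?case by (simp add: abs_minus_commute add.commute)
qed (rule edge_path.refl)

lemma edge_path_verts: "u \<in> verts G \<Longrightarrow> v \<in> verts G \<Longrightarrow> \<exists>L. edge_path G (Vertex u) L (Vertex v)"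
proof -
  assume uv: "u \<in> verts G" "v \<in> verts G"
  let ?H = "with_proj (mk_symmetric G)"
  have "u \<rightarrow>\<^sup>*\<^bsub>?H\<^esub> v"
    using connected_graph uv unfolding Digraph_Component.connected_def strongly_connected_def by auto
  then have "(u, v) \<in> rtrancl_on (verts G) (arcs_ends ?H)" unfolding reachable_def by simp
  then show ?thesis
  proof (induction rule: rtrancl_on_induct)
    case base
    then show ?case using edge_path.refl[of "Vertex u" G] by (auto simp: points_def)
  next
    case (step v w)
    then obtain L where L: "edge_path G (Vertex u) L (Vertex v)" by auto
    from step obtain e where e: "e \<in> arcs G" "v = tail G e \<and> w = head G e \<or> v = head G e \<and> w = tail G e"
      by (auto simp: arcs_ends_def arc_to_ends_def parcs_mk_symmetric)
    have "edge_path G (Vertex (tail G e)) 1 (Vertex (head G e))"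
      using edge_path_segment[of e 0 1] e by (simp add: edge_point_def)
    then have "edge_path G (Vertex v) 1 (Vertex w)" using e edge_path_sym by auto
    then show ?case using edge_path_trans L by blast
  qed
qed

lemma edge_path_to_vertex: "x \<in> points G \<Longrightarrow> \<exists>v L. v \<in> verts G \<and> edge_path G x L (Vertex v)"
proof -
  assume "x \<in> points G"
  then consider v where "x = Vertex v" "v \<in> verts G" | e s where "x = Inner e s" "e \<in> arcs G" "0 < s" "s < 1"
    by (auto simp: points_def)
  then show ?thesis
  proof cases
    case 1 then show ?thesis using edge_path_verts by blast
  next
    case 2
    then have "edge_path G x s (Vertex (tail G e))"
      using edge_path_segment[of e s 0] by (simp add: edge_point_def)
    then show ?thesis using tail_in_verts[OF 2(2)] by blast
  qed
qed

lemma edge_path_exists: "x \<in> points G \<Longrightarrow> y \<in> points G \<Longrightarrow> \<exists>L. edge_path G x L y"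
  by (metis edge_path_to_vertex edge_path_verts edge_path_trans edge_path_sym)

lemma bdd_below_edge_paths: "bdd_below {L. edge_path G x L y}"
  using edge_path_props by (auto intro!: bdd_belowI[of _ 0])

lemma path_dist_le: "edge_path G x L y \<Longrightarrow> path_dist G x y \<le> L"
  using edge_path_props[of x L y]
  unfolding path_dist_def by (auto intro!: cInf_lower bdd_below_edge_paths)

lemma path_dist_ge:
  assumes "x \<in> points G" "y \<in> points G" "\<And>L. edge_path G x L y \<Longrightarrow> m \<le> L"
  shows "m \<le> path_dist G x y"
  using assms edge_path_exists[of x y] unfolding path_dist_def by (auto intro!: cInf_greatest)

lemma lipschitz_edge_path:
  fixes f :: "('v, 'e) point \<Rightarrow> real"
  assumes lip: "\<And>e a b. e \<in> arcs G \<Longrightarrow> a \<in> {0..1} \<Longrightarrow> b \<in> {0..1} \<Longrightarrow>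
      f (edge_point G e b) - f (edge_point G e a) \<le> \<bar>b - a\<bar>"
  shows "edge_path G x L y \<Longrightarrow> f y - f x \<le> L"
proof (induction rule: edge_path.induct)
  case (step L e a b)
  then show ?case using lip[of e a b] by linarith
qed simp

lemma path_dist_pos:
  assumes "x \<in> points G" "y \<in> points G" "x \<noteq> y"
  shows "0 < path_dist G x y"
proof -
  from assms(1) consider v where "x = Vertex v" "v \<in> verts G" | e s where "x = Inner e s" "e \<in> arcs G" "0 < s" "s < 1"
    by (auto simp: points_def)
  then have "\<exists>f::('v,'e) point \<Rightarrow> real. f x = 0 \<and> 0 < f y \<and> (\<forall>e\<in>arcs G. \<forall>a\<in>{0..1}. \<forall>b\<in>{0..1}.
      f (edge_point G e b) - f (edge_point G e a) \<le> \<bar>b - a\<bar>)"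
  proof cases
    case 1
    define f where "f z = (case z of Vertex w \<Rightarrow> if w = v then 0 else 1 |
      Inner e s \<Rightarrow> if tail G e = v then s else if head G e = v then 1 - s else (1::real))" for z :: "('v,'e) point"
    have "f x = 0" "0 < f y" using assms 1 by (auto simp: f_def points_def split: point.splits)
    moreover have "f (edge_point G e b) - f (edge_point G e a) \<le> \<bar>b - a\<bar>"
      if "e \<in> arcs G" "a \<in> {0..1}" "b \<in> {0..1}" for e a b
    proof -
      have *: "f (edge_point G e a) = (if tail G e = v then a else if head G e = v then 1 - a else (1::real))" for a
        using no_loops[OF that(1)] by (auto simp: f_def edge_point_def)
      show ?thesis unfolding * by auto
    qed
    ultimately show ?thesis by blast
  next
    case 2
    define m where "m = min s (1 - s)"
    define f where "f z = (case z of Vertex w \<Rightarrow> m |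
      Inner e' s' \<Rightarrow> if e' = e then min \<bar>s' - s\<bar> m else m)" for z :: "('v,'e) point"
    have m: "m > 0" using 2 by (auto simp: m_def)
    have "f x = 0" "0 < f y" using assms 2 m by (auto simp: f_def points_def split: point.splits)
    moreover have "f (edge_point G e' b) - f (edge_point G e' a) \<le> \<bar>b - a\<bar>"
      if "e' \<in> arcs G" "a \<in> {0..1}" "b \<in> {0..1}" for e' a b
    proof -
      have *: "f (edge_point G e' a) = (if e' = e then min \<bar>a - s\<bar> m else m)" for a
        using 2 by (auto simp: f_def edge_point_def m_def)
      show ?thesis unfolding * by auto
    qed
    ultimately show ?thesis by blast
  qed
  then obtain f :: "('v,'e) point \<Rightarrow> real" where f: "f x = 0" "0 < f y"
    "\<And>e a b. e \<in> arcs G \<Longrightarrow> a \<in> {0..1} \<Longrightarrow> b \<in> {0..1} \<Longrightarrow> f (edge_point G e b) - f (edge_point G e a) \<le> \<bar>b - a\<bar>"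
    by blast
  have "f y \<le> path_dist G x y"
    using lipschitz_edge_path[of f, OF f(3)] f(1) by (intro path_dist_ge assms) fastforce
  then show ?thesis using f(2) by simp
qed

lemma path_dist_commute: "path_dist G x y = path_dist G y x"
proof -
  have "{L. edge_path G x L y} = {L. edge_path G y L x}" using edge_path_sym by blast
  then show ?thesis unfolding path_dist_def by auto
qed

lemma path_dist_triangle:
  assumes "x \<in> points G" "y \<in> points G" "z \<in> points G"
  shows "path_dist G x z \<le> path_dist G x y + path_dist G y z"
proof -
  have "path_dist G x z - path_dist G x y \<le> path_dist G y z"
  proof (rule path_dist_ge)
    fix M assume M: "edge_path G y M z"
    have "path_dist G x z - M \<le> path_dist G x y"
    proof (rule path_dist_ge)
      fix L assume "edge_path G x L y"
      then show "path_dist G x z - M \<le> L" using path_dist_le[OF edge_path_trans[OF M]] by fastforce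
    qed (use assms in auto)
    then show "path_dist G x z - path_dist G x y \<le> M" by simp
  qed (use assms in auto)
  then show ?thesis by simp
qed

lemma path_dist_refl: "x \<in> points G \<Longrightarrow> path_dist G x x = 0"
  using path_dist_le[OF edge_path.refl] path_dist_ge[of x x 0] edge_path_props by fastforce

lemma Metric_space_points: "Metric_space (points G) (path_dist G)"
proof
  fix x y :: "('v, 'e) point"
  show "0 \<le> path_dist G x y"
  proof (cases "x \<in> points G \<and> y \<in> points G")
    case True
    then show ?thesis using path_dist_ge edge_path_props by blast
  qed (auto simp: path_dist_def)
qed (use path_dist_commute path_dist_triangle path_dist_refl path_dist_pos in force)+

lemma mspace_graph_metric [simp]: "mspace (graph_metric G) = points G"
  and mdist_graph_metric [simp]: "mdist (graph_metric G) = path_dist G"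
  using Metric_space.mspace_metric[OF Metric_space_points]
    Metric_space.mdist_metric[OF Metric_space_points]
  by (simp_all add: graph_metric_def)

lemma path_dist_Inner_le:
  assumes "e \<in> arcs G" "0 < s" "s < 1" "0 < t" "t < 1"
  shows "path_dist G (Inner e s) (Inner e t) \<le> \<bar>t - s\<bar>"
  using path_dist_le[OF edge_path_segment[of e s t]] assms by (simp add: edge_point_def)

lemma open_Inner_vimage:
  assumes "openin (mtopology_of (graph_metric G)) U" "e \<in> arcs G"
  shows "open {s \<in> {0<..<1}. Inner e s \<in> U}"
proof -
  have "\<exists>r>0. \<forall>t. dist t s < r \<longrightarrow> t \<in> {0<..<1} \<and> Inner e t \<in> U"
    if s: "s \<in> {0<..<1}" "Inner e s \<in> U" for s
  proof -
    obtain r where r: "r > 0" "mball_of (graph_metric G) (Inner e s) r \<subseteq> U"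
      using assms(1) s(2) unfolding mtopology_of_def mball_of_def
      by (meson Metric_space.openin_mtopology Metric_space_mspace_mdist)
    have "t \<in> {0<..<1} \<and> Inner e t \<in> U" if "dist t s < min r (min s (1 - s))" for t
    proof -
      have t: "0 < t" "t < 1" "\<bar>t - s\<bar> < r" using that by (auto simp: dist_real_def)
      then have "path_dist G (Inner e s) (Inner e t) < r"
        using path_dist_Inner_le[of e s t] assms(2) s(1) by simp
      then show ?thesis using r(2) t s(1) assms(2) by (auto simp: points_def)
    qed
    moreover have "min r (min s (1 - s)) > 0" using r(1) s(1) by simp
    ultimately show ?thesis by blast
  qed
  then show ?thesis unfolding open_dist by blast
qed

lemma finite_edges_in_ball:
  "finite {e' \<in> arcs G. Inner e' ` {0<..<1} \<subseteq> mball_of (graph_metric G) (Vertex v) r}"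
    (is "finite ?B")
proof (cases "v \<in> verts G")
  case True
  define N where "N = rec_nat {v} (\<lambda>_ A. A \<union> (\<Union>w\<in>A. \<Union>e\<in>incident_edges G w. {tail G e, head G e}))"
  have N0: "N 0 = {v}"
    and NS: "N (Suc k) = N k \<union> (\<Union>w\<in>N k. \<Union>e\<in>incident_edges G w. {tail G e, head G e})" for k
    by (simp_all add: N_def)
  have fin_inc: "finite (incident_edges G w)" if "w \<in> verts G" for w
    using uniformly_locally_finite that by blast
  have N_verts: "N k \<subseteq> verts G" for k
    by (induction k) (auto simp: N0 NS True incident_edges_def)
  have fin_N: "finite (N k)" for k
    by (induction k) (use N_verts fin_inc in \<open>auto simp: N0 NS\<close>)
  have N_mono: "N k \<subseteq> N l" if "k \<le> l" for k l
    using that by (induction rule: dec_induct) (auto simp: NS)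
  obtain n :: nat where n: "r < n" using reals_Archimedean2 by blast
  define h where "h w = card {k. k < n \<and> w \<notin> N k}" for w
  have h_step: "h w' \<le> h w + 1"
    if "e \<in> arcs G" "{w, w'} = {tail G e, head G e}" for e w w'
  proof -
    have "w' \<in> N (Suc k)" if "w \<in> N k" for k
      using that \<open>e \<in> arcs G\<close> \<open>{w, w'} = {tail G e, head G e}\<close>
      by (auto simp: NS incident_edges_def doubleton_eq_iff)
    then have "{k. k < n \<and> w' \<notin> N k} \<subseteq> insert 0 (Suc ` {k. k < n \<and> w \<notin> N k})"
      by (auto simp: image_iff) (metis Suc_lessD not0_implies_Suc)
    then have "h w' \<le> card (insert 0 (Suc ` {k. k < n \<and> w \<notin> N k}))"
      unfolding h_def by (intro card_mono) auto
    also have "\<dots> \<le> h w + 1"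
      unfolding h_def by (simp add: card_image)
    finally show ?thesis .
  qed
  define f :: "('v, 'e) point \<Rightarrow> real" where "f z = (case z of Vertex w \<Rightarrow> h w |
     Inner e s \<Rightarrow> min (real (h (tail G e)) + s) (real (h (head G e)) + 1 - s))" for z
  have f_edge: "f (edge_point G e s) = min (real (h (tail G e)) + s) (real (h (head G e)) + 1 - s)"
    if "e \<in> arcs G" for e and s :: real
  proof -
    have "h (head G e) \<le> h (tail G e) + 1" "h (tail G e) \<le> h (head G e) + 1"
      using h_step[OF that] by (auto simp: insert_commute)
    then show ?thesis by (auto simp: f_def edge_point_def min_def)
  qed
  have lip: "f (edge_point G e b) - f (edge_point G e a) \<le> \<bar>b - a\<bar>" if "e \<in> arcs G" for e a b
    unfolding f_edge[OF that] by (simp add: min_def abs_if)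
  have "?B \<subseteq> (\<Union>w\<in>N n. incident_edges G w)"
  proof
    fix e assume B: "e \<in> ?B"
    have "(Inner e (1/2) :: ('v, 'e) point) \<in> Inner e ` {0<..<1::real}" by (rule imageI) simp
    with B have e: "e \<in> arcs G" "Inner e (1/2) \<in> mball_of (graph_metric G) (Vertex v) r"
      by (auto simp only: mem_Collect_eq subset_iff)
    have "f (Inner e (1/2)) - f (Vertex v) \<le> path_dist G (Vertex v) (Inner e (1/2))"
      using lipschitz_edge_path[of f, OF lip] e by (intro path_dist_ge) auto
    moreover have "path_dist G (Vertex v) (Inner e (1/2)) < n" using e(2) n by auto
    moreover have "f (Vertex v) = 0" using N_mono[of 0] by (auto simp: f_def h_def N0)
    ultimately have "h (tail G e) < n \<or> h (head G e) < n"
      by (auto simp: f_def min_def split: if_splits)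
    moreover have "w \<in> N n" if "h w < n" for w
    proof (rule ccontr)
      assume "w \<notin> N n"
      then have "{k. k < n \<and> w \<notin> N k} = {..<n}" using N_mono by (auto dest: less_imp_le)
      then show False using that by (simp add: h_def)
    qed
    ultimately show "e \<in> (\<Union>w\<in>N n. incident_edges G w)"
      using e(1) by (auto simp: incident_edges_def)
  qed
  moreover have "finite (\<Union>w\<in>N n. incident_edges G w)" using fin_N N_verts fin_inc by blast
  ultimately show ?thesis by (rule finite_subset)
next
  case False
  then have "mball_of (graph_metric G) (Vertex v) r = {}" by (auto simp: points_def)
  moreover have "{0<..<1::real} \<noteq> {}" by simp
  ultimately show ?thesis by simp
qed

lemma measurable_Inner:
  "(\<lambda>(e, s). Inner e s) \<in> measurable
     (density (count_space (arcs G) \<Otimes>\<^sub>M restrict_space lborel {0<..<1}) (\<lambda>(e, s). ennreal (c e)))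
     (sigma (points G) {U. openin (mtopology_of (graph_metric G)) U})"
proof (rule measurable_measure_of)
  show "{U. openin (mtopology_of (graph_metric G)) U} \<subseteq> Pow (points G)"
    using openin_subset[of "mtopology_of (graph_metric G)"] by auto
  show "(\<lambda>(e, s). Inner e s) \<in> space (density (count_space (arcs G) \<Otimes>\<^sub>M restrict_space lborel {0<..<1})
      (\<lambda>(e, s). ennreal (c e))) \<rightarrow> points G"
    by (auto simp: space_pair_measure points_def space_restrict_space)
  fix U assume "U \<in> {U. openin (mtopology_of (graph_metric G)) U}"
  then have U: "openin (mtopology_of (graph_metric G)) U" by simp
  let ?M = "count_space (arcs G) \<Otimes>\<^sub>M restrict_space lborel {0<..<1::real}"
  have "(\<lambda>(e, s). Inner e s) -` U \<inter> space ?M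
      = (\<Union>e\<in>arcs G. {e} \<times> {s \<in> {0<..<1}. Inner e s \<in> U})"
    by (auto simp: space_pair_measure space_restrict_space)
  also have "\<dots> \<in> sets ?M"
  proof (rule sets.countable_UN''[OF countable_arcs])
    fix e assume e: "e \<in> arcs G"
    have "{s \<in> {0<..<1}. Inner e s \<in> U} \<in> sets (restrict_space lborel {0<..<1})"
      using borel_open[OF open_Inner_vimage[OF U e]]
      by (auto simp: sets_restrict_space_iff)
    then show "{e} \<times> {s \<in> {0<..<1}. Inner e s \<in> U} \<in> sets ?M"
      using e by auto
  qed
  finally show "(\<lambda>(e, s). Inner e s) -` U \<inter> space (density ?M (\<lambda>(e, s). ennreal (c e)))
      \<in> sets (density ?M (\<lambda>(e, s). ennreal (c e)))" by simp
qed
end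


section \<open>Unbounded operators on seminormed spaces of functions\<close>

text \<open>
  A Banach space of (classes of) functions is given by its representatives together with the norm,
  which on representatives is only a seminorm; two representatives \<open>u\<close> and \<open>v\<close> denote the same element
  iff \<open>snorm X (\<lambda>x. u x - v x) = 0\<close>. An operator is given by its graph, as a set of pairs of
  representatives.
\<close>

record 'a function_space =
  vectors :: "('a \<Rightarrow> complex) set"
  snorm :: "('a \<Rightarrow> complex) \<Rightarrow> real"

text \<open>
  \<open>z - A\<close> maps the domain of \<open>A\<close> bijectively onto \<open>X\<close>, with bounded inverse; the estimate in the last
  conjunct is the boundedness of the inverse.
\<close>

definition resolvent_set ::
    "'a function_space \<Rightarrow> (('a \<Rightarrow> complex) \<times> ('a \<Rightarrow> complex)) set \<Rightarrow> complex set" where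
  "resolvent_set X A = {z.
     (\<forall>(u, w) \<in> A. snorm X (\<lambda>x. z * u x - w x) = 0 \<longrightarrow> snorm X u = 0) \<and>
     (\<forall>f \<in> vectors X. \<exists>(u, w) \<in> A. snorm X (\<lambda>x. z * u x - w x - f x) = 0) \<and>
     (\<exists>C. \<forall>(u, w) \<in> A. snorm X u \<le> C * snorm X (\<lambda>x. z * u x - w x))}"

definition spectrum ::
    "'a function_space \<Rightarrow> (('a \<Rightarrow> complex) \<times> ('a \<Rightarrow> complex)) set \<Rightarrow> complex set" where
  "spectrum X A = - resolvent_set X A"

definition Lp :: "'a measure \<Rightarrow> real \<Rightarrow> 'a function_space" where
  "Lp M p = \<lparr>vectors = {u \<in> borel_measurable M. integrable M (\<lambda>x. norm (u x) powr p)},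
             snorm = (\<lambda>u. (\<integral>x. norm (u x) powr p \<partial>M) powr (1 / p))\<rparr>"

text \<open>
  \<open>g\<close> is the second derivative of \<open>f\<close> on \<open>(0,1)\<close> in the Sobolev sense: \<open>f\<close> is differentiable and \<open>f'\<close> is
  locally absolutely continuous with almost everywhere derivative \<open>g\<close>. If \<open>g\<close> is continuous, this is
  the classical second derivative.
\<close>

definition has_second_derivative :: "(real \<Rightarrow> complex) \<Rightarrow> (real \<Rightarrow> complex) \<Rightarrow> bool" where
  "has_second_derivative f g \<longleftrightarrow>
    (\<exists>f'. (\<forall>s \<in> {0<..<1}. (f has_vector_derivative f' s) (at s)) \<and>
          (\<forall>a b. 0 < a \<and> a \<le> b \<and> b < 1 \<longrightarrow>
             set_integrable lborel {a..b} g \<and> f' b - f' a = (LBINT s:{a..b}. g s)))"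


section \<open>The Laplacian on the spaces over the graph\<close>

text \<open>The Borel measure on the graph that is \<open>c e\<close> times Lebesgue measure on the edge \<open>e\<close>.\<close>

definition graph_measure ::
    "('v, 'e) pre_digraph \<Rightarrow> ('e \<Rightarrow> real) \<Rightarrow> ('v, 'e) point measure" where
  "graph_measure G c =
    distr (density (count_space (arcs G) \<Otimes>\<^sub>M restrict_space lborel {0<..<1})
             (\<lambda>(e, s). ennreal (c e)))
          (sigma (points G) {U. openin (mtopology_of (graph_metric G)) U})
          (\<lambda>(e, s). Inner e s)"

definition continuous_on_graph ::
    "('v, 'e) pre_digraph \<Rightarrow> (('v, 'e) point \<Rightarrow> complex) \<Rightarrow> bool" where
  "continuous_on_graph G u \<longleftrightarrow> continuous_map (mtopology_of (graph_metric G)) euclidean u"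

definition sup_norm :: "('v, 'e) pre_digraph \<Rightarrow> (('v, 'e) point \<Rightarrow> complex) \<Rightarrow> real" where
  "sup_norm G u = (SUP x \<in> points G. norm (u x))"

definition C0_space :: "('v, 'e) pre_digraph \<Rightarrow> ('v, 'e) point function_space" where
  "C0_space G = \<lparr>vectors = {u. continuous_on_graph G u \<and>
       (\<forall>\<epsilon>>0. compactin (mtopology_of (graph_metric G)) {x \<in> points G. \<epsilon> \<le> norm (u x)})},
     snorm = sup_norm G\<rparr>"

definition BUC_space :: "('v, 'e) pre_digraph \<Rightarrow> ('v, 'e) point function_space" where
  "BUC_space G = \<lparr>vectors = {u. bounded (u ` points G) \<and>
       uniformly_continuous_map (graph_metric G) euclidean_metric u},
     snorm = sup_norm G\<rparr>"

definition edge_function ::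
    "('v, 'e) pre_digraph \<Rightarrow> (('v, 'e) point \<Rightarrow> complex) \<Rightarrow> 'e \<Rightarrow> real \<Rightarrow> complex" where
  "edge_function G u e s = u (edge_point G e s)"

text \<open>
  The one-sided limits exist whenever \<open>u\<close> has an integrable second derivative on the edge, hence
  for all functions to which the definition is applied below.
\<close>

definition normal_derivative ::
    "('v, 'e) pre_digraph \<Rightarrow> ('e \<Rightarrow> real) \<Rightarrow> (('v, 'e) point \<Rightarrow> complex) \<Rightarrow> 'e \<Rightarrow> 'v \<Rightarrow> complex" where
  "normal_derivative G c u e v =
    (if v = tail G e
     then of_real (c e) * Lim (at_right 0) (\<lambda>s. vector_derivative (edge_function G u e) (at s))
     else - of_real (c e) * Lim (at_left 1) (\<lambda>s. vector_derivative (edge_function G u e) (at s)))"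

text \<open>
  In the pairs below \<open>g\<close> is the function with edgewise second derivatives of \<open>u\<close>. For \<open>C0_space\<close> and
  \<open>BUC_space\<close>, \<open>g \<in> vectors X\<close> includes that the second derivatives fit together continuously at the
  vertices; for \<open>Lp\<close> the values of \<open>g\<close> at the vertices are irrelevant.
\<close>

definition neg_laplacian ::
    "('v, 'e) pre_digraph \<Rightarrow> ('e \<Rightarrow> real) \<Rightarrow> ('v, 'e) point function_space
      \<Rightarrow> ((('v, 'e) point \<Rightarrow> complex) \<times> (('v, 'e) point \<Rightarrow> complex)) set" where
  "neg_laplacian G c X = {(u, \<lambda>x. - g x) | u g.
     u \<in> vectors X \<and> g \<in> vectors X \<and>
     (\<forall>e \<in> arcs G. has_second_derivative (edge_function G u e) (edge_function G g e)) \<and>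
     continuous_on_graph G u \<and>
     (\<forall>v \<in> verts G. (\<Sum>e \<in> incident_edges G v. normal_derivative G c u e v) = 0)}"


section \<open>The Dirichlet operator on the unit interval\<close>

definition L2_interval :: "real function_space" where
  "L2_interval = Lp (restrict_space lborel {0..1}) 2"

definition dirichlet_operator :: "((real \<Rightarrow> complex) \<times> (real \<Rightarrow> complex)) set" where
  "dirichlet_operator = {(u, \<lambda>s. - g s) | u g.
     u \<in> vectors L2_interval \<and> g \<in> vectors L2_interval \<and>
     has_second_derivative u g \<and>
     continuous_on {0..1} u \<and> u 0 = 0 \<and> u 1 = 0}"

end

theory Submission
  imports Defs
begin

text \<open>
  On an edge the equation \<open>u'' + z u = f\<close> can be solved for arbitrary values at the two ends as soon as
  \<open>z\<close> is not a Dirichlet eigenvalue, and the outer derivatives are then explicit in the end values and \<open>f\<close>.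
  Kirchhoff's condition therefore turns \<open>(z + \<Delta>) u = f\<close> into an equation \<open>(P - \<mu>) a = b\<close> for the
  vertex values \<open>a\<close> of \<open>u\<close>, where \<open>P\<close> is the transition operator of the random walk with conductances
  \<open>c\<close> and \<open>\<mu> = cos (sqrt z)\<close>.

  Let \<open>z\<close> be in the resolvent set of the Laplacian on one of the spaces. Then \<open>P - \<mu>\<close> is invertible
  there, and conjugation with exponential weights (Combes--Thomas) shows that the columns of its inverse
  decay exponentially in the distance. By the growth condition an exponentially decaying kernel acts
  boundedly on all of the spaces (Schur test), and since \<open>P\<close> is symmetric with respect to the vertex
  weights, a right inverse of this kind is also a left inverse. Hence membership in the resolvent set is
  equivalent to the existence of an exponentially decaying inverse matrix of \<open>P - \<mu>\<close>, a condition in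
  which the space does not occur.
\<close>

section \<open>The equation on an edge\<close>

text \<open>The growth condition bounds sums of conductivities over edges and permits
  \<open>c\<close> to vary subexponentially. Therefore sequences are indexed by edges, vertex
  functions enter through \<open>edge_norm\<close>, and whenever a weight is moved from one edge to
  another, half of the available exponential decay is paid for it. The spaces are treated together
  through sequence spaces that are essentially only required to be solid, to be mapped into
  themselves by exponential kernels, and to have unit vectors of subexponentially comparable norms.
  A function lies in the space once it is Lipschitz on each edge with constants in the sequence
  space. Data on different edges must also fit together at the vertices, so the sources built from
  vertex values vanish there. The resolvent provides the inverse of \<open>P - \<mu>\<close> only
  through its columns, by solving for unit vectors. Finitely supported data need not be dense among
  bounded ones, so the inverse on the other spaces is not obtained by continuity. The decay of the
  columns supplies it: solutions by summing them, uniqueness by summation by parts against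
  them.\<close>

lemma set_integrable_lborel_mult_continuous:
  fixes g w :: "real \<Rightarrow> complex"
  assumes g: "set_integrable lborel {a..b} g" and w: "continuous_on {a..b} w"
  shows "set_integrable lborel {a..b} (\<lambda>t. w t * g t)"
proof -
  have "set_borel_measurable borel {a..b} w"
    using borel_measurable_continuous_on_indicator[of "{a..b}" w] w
    by (simp add: set_borel_measurable_def)
  moreover have "(\<lambda>t. indicator {a..b} t *\<^sub>R g t) \<in> borel_measurable borel"
    using g by (auto simp: set_integrable_def dest: borel_measurable_integrable)
  ultimately have m: "(\<lambda>t. (indicator {a..b} t *\<^sub>R w t) * (indicator {a..b} t *\<^sub>R g t)) \<in> borel_measurable borel"
    unfolding set_borel_measurable_def by measurable
  obtain M where M: "\<And>t. t \<in> {a..b} \<Longrightarrow> norm (w t) \<le> M"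
    using compact_imp_bounded[OF compact_continuous_image[OF w compact_Icc]]
    unfolding bounded_iff by fastforce
  have "integrable lborel (\<lambda>t. (indicator {a..b} t *\<^sub>R w t) * (indicator {a..b} t *\<^sub>R g t))"
  proof (rule Bochner_Integration.integrable_bound)
    show "integrable lborel (\<lambda>t. of_real M * (indicator {a..b} t *\<^sub>R g t))"
      using g unfolding set_integrable_def by (intro integrable_mult_right)
    show "AE t in lborel. norm ((indicator {a..b} t *\<^sub>R w t) * (indicator {a..b} t *\<^sub>R g t))
        \<le> norm (of_real M * (indicator {a..b} t *\<^sub>R g t))"
    proof (rule AE_I2)
      fix t
      show "norm ((indicator {a..b} t *\<^sub>R w t) * (indicator {a..b} t *\<^sub>R g t))
        \<le> norm (of_real M * (indicator {a..b} t *\<^sub>R g t))"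
        using M[of t] by (auto simp: indicator_def norm_mult intro!: mult_right_mono)
    qed
  qed (use m in simp)
  then show ?thesis
    unfolding set_integrable_def by (rule back_subst[where P="integrable lborel"]) (auto simp: indicator_def)
qed

lemma set_integrable_lborel_continuous:
  fixes w :: "real \<Rightarrow> complex"
  shows "continuous_on {a..b} w \<Longrightarrow> set_integrable lborel {a..b} w"
  unfolding set_integrable_def using borel_integrable_compact[of "{a..b}" w] by simp

text \<open>Fubini on the triangle \<open>a \<le> s \<le> t \<le> b\<close>.\<close>

lemma integral_by_parts_indefinite:
  fixes g h :: "real \<Rightarrow> complex"
  assumes g: "set_integrable lborel {a..b} g" and h: "set_integrable lborel {a..b} h"
  shows "integral {a..b} (\<lambda>t. integral {a..t} g * h t) = integral {a..b} (\<lambda>s. g s * integral {s..b} h)"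
proof -
  define g' where "g' t = indicator {a..b} t *\<^sub>R g t" for t
  define h' where "h' t = indicator {a..b} t *\<^sub>R h t" for t
  have g'i: "integrable lborel g'" and h'i: "integrable lborel h'"
    using g h unfolding set_integrable_def g'_def h'_def by auto
  have [measurable]: "g' \<in> borel_measurable borel" "h' \<in> borel_measurable borel"
    using borel_measurable_integrable[OF g'i] borel_measurable_integrable[OF h'i] by simp_all
  have sub: "set_integrable lborel {a..t} g" if "t \<le> b" for t
    by (rule set_integrable_subset[OF g]) (use that in auto)
  have sub': "set_integrable lborel {s..b} h" if "a \<le> s" for s
    by (rule set_integrable_subset[OF h]) (use that in auto)
  define F where "F s t = indicator {a..t} s *\<^sub>R g' s * h' t" for s t
  \<comment> \<open>On the triangle the cut-off can be read in either variable; the two readings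
    give the two iterated integrals.\<close>
  have F_alt: "F s t = g' s * (indicator {s..b} t *\<^sub>R h' t)" for s t
    by (auto simp: F_def g'_def h'_def indicator_def)
  have meas: "(\<lambda>(s,t). F s t) \<in> borel_measurable (lborel \<Otimes>\<^sub>M lborel)"
  proof -
    have [measurable]: "(\<lambda>x. g' (fst x)) \<in> borel_measurable (lborel \<Otimes>\<^sub>M lborel)"
      "(\<lambda>x. h' (snd x)) \<in> borel_measurable (lborel \<Otimes>\<^sub>M lborel)"
      by (rule measurable_compose[where N=borel]; simp)+
    have "(\<lambda>x. if a \<le> fst x \<and> fst x \<le> snd x then g' (fst x) * h' (snd x) else 0) \<in> borel_measurable (lborel \<Otimes>\<^sub>M lborel)"
      by measurable
    then show ?thesis
      by (rule back_subst[where P="\<lambda>f. f \<in> _"]) (auto simp: F_def indicator_def)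
  qed
  have prod: "integrable (lborel \<Otimes>\<^sub>M lborel) (\<lambda>(s,t). g' s * h' t)"
  proof (rule lborel_pair.Fubini_integrable)
    show "integrable lborel (\<lambda>s. LBINT t. norm (case (s,t) of (s,t) \<Rightarrow> g' s * h' t))"
      using g'i by (simp add: norm_mult integrable_norm)
    show "AE s in lborel. integrable lborel (\<lambda>t. case (s,t) of (s,t) \<Rightarrow> g' s * h' t)"
      using h'i by simp
    have "(\<lambda>x. g' (fst x) * h' (snd x)) \<in> borel_measurable (lborel \<Otimes>\<^sub>M lborel)"
      by (intro borel_measurable_times) (rule measurable_compose[where N=borel]; simp)+
    then show "(\<lambda>(s,t). g' s * h' t) \<in> borel_measurable (lborel \<Otimes>\<^sub>M lborel)"
      by (simp add: case_prod_beta')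
  qed
  have F: "integrable (lborel \<Otimes>\<^sub>M lborel) (\<lambda>(s,t). F s t)"
    by (rule Bochner_Integration.integrable_bound[OF prod meas])
      (auto simp: F_def norm_mult indicator_def intro!: AE_I2)
  have 1: "(LBINT t. LBINT s. F s t) = integral {a..b} (\<lambda>t. integral {a..t} g * h t)"
  proof -
    have "(LBINT s. F s t) = indicator {a..b} t *\<^sub>R (integral {a..t} g * h t)" for t
    proof -
      have "(LBINT s. F s t) = (LBINT s. indicator {a..t} s *\<^sub>R g' s) * h' t"
        unfolding F_def by (subst integral_mult_left_zero[symmetric]) simp
      also have "\<dots> = indicator {a..b} t *\<^sub>R ((LBINT s:{a..t}. g s) * h t)"
        by (auto simp: set_lebesgue_integral_def h'_def g'_def indicator_def intro!: Bochner_Integration.integral_cong)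
      also have "\<dots> = indicator {a..b} t *\<^sub>R (integral {a..t} g * h t)"
        using set_borel_integral_eq_integral(2)[OF sub[of t]] by (auto simp: indicator_def)
      finally show ?thesis .
    qed
    then have e: "(\<lambda>t. LBINT s. F s t) = (\<lambda>t. indicator {a..b} t *\<^sub>R (integral {a..t} g * h t))" by auto
    have "integrable lborel (\<lambda>t. LBINT s. F s t)"
      using lborel_pair.integrable_snd[OF F] .
    then have "set_integrable lborel {a..b} (\<lambda>t. integral {a..t} g * h t)"
      unfolding set_integrable_def e .
    then show ?thesis unfolding e
      using set_borel_integral_eq_integral(2) unfolding set_lebesgue_integral_def by blast
  qed
  have 2: "(LBINT s. LBINT t. F s t) = integral {a..b} (\<lambda>s. g s * integral {s..b} h)"
  proof -
    have "(LBINT t. F s t) = indicator {a..b} s *\<^sub>R (g s * integral {s..b} h)" for s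
    proof -
      have "(LBINT t. F s t) = g' s * (LBINT t. indicator {s..b} t *\<^sub>R h' t)"
        unfolding F_alt by (subst integral_mult_right_zero[symmetric]) simp
      also have "\<dots> = indicator {a..b} s *\<^sub>R (g s * (LBINT t:{s..b}. h t))"
        by (auto simp: set_lebesgue_integral_def h'_def g'_def indicator_def intro!: Bochner_Integration.integral_cong)
      also have "\<dots> = indicator {a..b} s *\<^sub>R (g s * integral {s..b} h)"
        using set_borel_integral_eq_integral(2)[OF sub'[of s]] by (auto simp: indicator_def)
      finally show ?thesis .
    qed
    then have e: "(\<lambda>s. LBINT t. F s t) = (\<lambda>s. indicator {a..b} s *\<^sub>R (g s * integral {s..b} h))" by auto
    have "integrable lborel (\<lambda>s. LBINT t. F s t)"
      using lborel_pair.integrable_fst[OF F] .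
    then have "set_integrable lborel {a..b} (\<lambda>s. g s * integral {s..b} h)"
      unfolding set_integrable_def e .
    then show ?thesis unfolding e
      using set_borel_integral_eq_integral(2) unfolding set_lebesgue_integral_def by blast
  qed
  show ?thesis using lborel_pair.Fubini_integral[OF F] 1 2 by simp
qed

text \<open>The local notion \<open>has_second_derivative\<close> brought to the closed interval:
  \<open>u1\<close> has values at \<open>0\<close> and \<open>1\<close>, which are the one-sided
  derivatives that enter Kirchhoff's condition, and \<open>g\<close> is integrable up to the
  ends.\<close>

definition sobolev_derivatives ::
    "(real \<Rightarrow> complex) \<Rightarrow> (real \<Rightarrow> complex) \<Rightarrow> (real \<Rightarrow> complex) \<Rightarrow> bool" where
  "sobolev_derivatives u u1 g \<longleftrightarrow> continuous_on {0..1} u \<and> continuous_on {0..1} u1 \<and>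
    set_integrable lborel {0..1} g \<and>
    (\<forall>s \<in> {0<..<1}. (u has_vector_derivative u1 s) (at s)) \<and>
    (\<forall>t \<in> {0..1}. integral {0..t} g = u1 t - u1 0)"

text \<open>As \<open>g\<close> is integrable on all of \<open>[0,1]\<close>, its primitive is
  continuous there. Shifted to agree with the derivative of \<open>u\<close> at \<open>1/2\<close>,
  it agrees with it on the open interval and extends it to the ends.\<close>

lemma has_second_derivative_extend:
  assumes u: "has_second_derivative u g" and g: "set_integrable lborel {0..1} g"
    and cu: "continuous_on {0..1} u"
  obtains u1 where "sobolev_derivatives u u1 g"
proof -
  obtain f' where f'0: "\<forall>s \<in> {0<..<1}. (u has_vector_derivative f' s) (at s)"
    "\<forall>a b. 0 < a \<and> a \<le> b \<and> b < 1 \<longrightarrow>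
       set_integrable lborel {a..b} g \<and> f' b - f' a = (LBINT s:{a..b}. g s)"
    using u unfolding has_second_derivative_def by blast
  have f': "\<And>s. s \<in> {0<..<1} \<Longrightarrow> (u has_vector_derivative f' s) (at s)"
    "\<And>a b. 0 < a \<Longrightarrow> a \<le> b \<Longrightarrow> b < 1 \<Longrightarrow> f' b - f' a = (LBINT s:{a..b}. g s)"
    using f'0 by simp_all
  have gi: "g integrable_on {0..1}" using set_borel_integral_eq_integral(1)[OF g] .
  have diff: "f' b - f' a = integral {0..b} g - integral {0..a} g" if "0 < a" "a \<le> b" "b < 1" for a b
  proof -
    have "(LBINT s:{a..b}. g s) = integral {a..b} g"
      by (rule set_borel_integral_eq_integral(2), rule set_integrable_subset[OF g]) (use that in auto)
    moreover have "integral {0..a} g + integral {a..b} g = integral {0..b} g"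
      by (rule Henstock_Kurzweil_Integration.integral_combine)
        (use that in \<open>auto intro: integrable_on_subinterval[OF gi]\<close>)
    ultimately show ?thesis using f'(2)[OF that] by (simp add: algebra_simps)
  qed
  define u1 where "u1 t = f' (1/2) - integral {0..1/2} g + integral {0..t} g" for t
  have eq: "u1 t = f' t" if "t \<in> {0<..<1}" for t
  proof (cases "t \<le> 1/2")
    case True
    have "f' (1/2) - f' t = integral {0..1/2} g - integral {0..t} g"
      by (rule diff) (use True that in auto)
    then show ?thesis unfolding u1_def by (simp add: algebra_simps)
  next
    case False
    have "f' t - f' (1/2) = integral {0..t} g - integral {0..1/2} g"
      by (rule diff) (use False that in auto)
    then show ?thesis unfolding u1_def by (simp add: algebra_simps)
  qed
  have "continuous_on {0..1} u1"
    unfolding u1_def by (intro continuous_intros indefinite_integral_continuous_1 gi)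
  moreover have "(u has_vector_derivative u1 s) (at s)" if "s \<in> {0<..<1}" for s
    using f'(1)[OF that] eq[OF that] by simp
  moreover have "integral {0..t} g = u1 t - u1 0" for t
    by (simp add: u1_def)
  ultimately show ?thesis using that[of u1] g cu by (simp add: sobolev_derivatives_def)
qed

lemma green_identity:
  fixes u u1 g w w1 w2 :: "real \<Rightarrow> complex"
  assumes b: "0 \<le> b" "b \<le> 1" and sob: "sobolev_derivatives u u1 g"
    and w: "\<And>t. (w has_vector_derivative w1 t) (at t)" "\<And>t. (w1 has_vector_derivative w2 t) (at t)"
      "continuous_on UNIV w2"
  shows "integral {0..b} (\<lambda>t. g t * w t)
    = u1 b * w b - u1 0 * w 0 - u b * w1 b + u 0 * w1 0 + integral {0..b} (\<lambda>t. u t * w2 t)"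
proof -
  have sub: "{0..b} \<subseteq> {0..1}" using b by auto
  have g: "set_integrable lborel {0..1} g"
    and u: "continuous_on {0..1} u" "continuous_on {0..1} u1"
      "\<And>s. s \<in> {0<..<1} \<Longrightarrow> (u has_vector_derivative u1 s) (at s)"
    and G: "\<And>t. t \<in> {0..1} \<Longrightarrow> integral {0..t} g = u1 t - u1 0"
    using sob unfolding sobolev_derivatives_def by auto
  have gb: "set_integrable lborel {0..b} g" by (rule set_integrable_subset[OF g]) (use b in auto)
  note gib = set_borel_integral_eq_integral(1)[OF gb]
  have cw: "continuous_on A w" "continuous_on A w1" "continuous_on A w2" for A
    using continuous_on_subset[OF w(3) subset_UNIV]
    by (auto intro!: continuous_at_imp_continuous_on has_vector_derivative_continuous w)
  have cu: "continuous_on {0..b} u" "continuous_on {0..b} u1"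
    by (rule continuous_on_subset[OF u(1) sub], rule continuous_on_subset[OF u(2) sub])
  have ftc: "(w1 has_integral w t - w s) {s..t}" if "s \<le> t" for s t
    by (rule fundamental_theorem_of_calculus_interior) (simp_all add: that cw w)
  have iuw: "(\<lambda>t. u1 t * w1 t) integrable_on {0..b}" "(\<lambda>t. u t * w2 t) integrable_on {0..b}"
    by (rule integrable_continuous_real continuous_on_mult cu cw)+
  have "((\<lambda>t. u1 t * w1 t + u t * w2 t) has_integral u b * w1 b - u 0 * w1 0) {0..b}"
  proof (rule fundamental_theorem_of_calculus_interior[OF b(1)])
    show "continuous_on {0..b} (\<lambda>t. u t * w1 t)" by (rule continuous_on_mult[OF cu(1) cw(2)])
    fix t assume "t \<in> {0<..<b}"
    then show "((\<lambda>t. u t * w1 t) has_vector_derivative u1 t * w1 t + u t * w2 t) (at t)"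
      using has_vector_derivative_mult[OF u(3)[of t] w(2)[of t]] b by (simp add: add.commute)
  qed
  then have 1: "integral {0..b} (\<lambda>t. u1 t * w1 t) + integral {0..b} (\<lambda>t. u t * w2 t) = u b * w1 b - u 0 * w1 0"
    using Henstock_Kurzweil_Integration.integral_add[OF iuw] by (simp add: integral_unique)
  have igw: "(\<lambda>t. g t * w t) integrable_on {0..b}"
    using set_borel_integral_eq_integral(1)[OF set_integrable_lborel_mult_continuous[OF gb cw(1)]]
    by (simp add: mult.commute)
  have "integral {0..b} (\<lambda>t. integral {0..t} g * w1 t) = integral {0..b} (\<lambda>t. u1 t * w1 t - u1 0 * w1 t)"
    by (rule Henstock_Kurzweil_Integration.integral_cong) (use sub in \<open>auto simp: G left_diff_distrib\<close>)
  also have "\<dots> = integral {0..b} (\<lambda>t. u1 t * w1 t) - u1 0 * (w b - w 0)"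
    using integral_unique[OF ftc[of 0 b]] has_integral_integrable[OF ftc[of 0 b]] b
    by (subst Henstock_Kurzweil_Integration.integral_diff[OF iuw(1)])
      (auto intro!: integrable_on_mult_right)
  finally have 2: "integral {0..b} (\<lambda>t. integral {0..t} g * w1 t)
      = integral {0..b} (\<lambda>t. u1 t * w1 t) - u1 0 * (w b - w 0)" .
  have "integral {0..b} (\<lambda>s. g s * integral {s..b} w1) = integral {0..b} (\<lambda>s. g s * w b - g s * w s)"
    by (rule Henstock_Kurzweil_Integration.integral_cong)
      (simp add: integral_unique[OF ftc] right_diff_distrib)
  also have "\<dots> = integral {0..b} g * w b - integral {0..b} (\<lambda>s. g s * w s)"
    using gib by (subst Henstock_Kurzweil_Integration.integral_diff)
     (auto simp: igw intro!: integrable_on_mult_left)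
  finally have 3: "integral {0..b} (\<lambda>s. g s * integral {s..b} w1)
      = (u1 b - u1 0) * w b - integral {0..b} (\<lambda>s. g s * w s)"
    using G[of b] b by simp
  have "integral {0..b} (\<lambda>t. u1 t * w1 t) - u1 0 * (w b - w 0)
     = (u1 b - u1 0) * w b - integral {0..b} (\<lambda>s. g s * w s)"
    using integral_by_parts_indefinite[OF gb set_integrable_lborel_continuous[OF cw(2)]] 2 3 by simp
  with 1 show ?thesis by algebra
qed

lemma norm_integral_mult_le:
  fixes f w :: "real \<Rightarrow> complex"
  assumes f: "set_integrable lborel {0..1} f" and t: "0 \<le> t" "t \<le> 1"
    and w: "continuous_on {0..t} w" "\<And>s. s \<in> {0..t} \<Longrightarrow> norm (w s) \<le> M" "0 \<le> M"
  shows "norm (integral {0..t} (\<lambda>s. w s * f s)) \<le> M * integral {0..1} (\<lambda>s. norm (f s))"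
proof -
  have ft: "set_integrable lborel {0..t} f" by (rule set_integrable_subset[OF f]) (use t in auto)
  have nf: "(\<lambda>s. norm (f s)) integrable_on {0..1}"
    using set_borel_integral_eq_integral(1)[OF set_integrable_norm[OF f]] .
  have nft: "(\<lambda>s. norm (f s)) integrable_on {0..t}"
    by (rule integrable_on_subinterval[OF nf]) (use t in auto)
  have "norm (integral {0..t} (\<lambda>s. w s * f s)) \<le> integral {0..t} (\<lambda>s. M * norm (f s))"
  proof (rule Henstock_Kurzweil_Integration.integral_norm_bound_integral)
    show "(\<lambda>s. w s * f s) integrable_on {0..t}"
      by (rule set_borel_integral_eq_integral(1)[OF set_integrable_lborel_mult_continuous[OF ft w(1)]])
    show "(\<lambda>s. M * norm (f s)) integrable_on {0..t}" using nft by (rule integrable_on_mult_right)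
  qed (auto simp: norm_mult w intro!: mult_right_mono)
  also have "\<dots> = M * integral {0..t} (\<lambda>s. norm (f s))" by simp
  also have "\<dots> \<le> M * integral {0..1} (\<lambda>s. norm (f s))"
    by (intro mult_left_mono integral_subset_le nft nf w) (use t in auto)
  finally show ?thesis .
qed

text \<open>The functions sin (k t) / k and cos (k t) with k^2 = z. Characterising them by the
  differential system covers \<open>z = 0\<close> and either choice of the root alike.
  \<open>C 1\<close> becomes the parameter \<mu> of the vertex operator.\<close>

locale fundamental_solutions =
  fixes z :: complex and S C :: "real \<Rightarrow> complex"
  assumes S_0 [simp]: "S 0 = 0" and C_0 [simp]: "C 0 = 1"
    and S_deriv: "(S has_vector_derivative C t) (at t)"
    and C_deriv: "(C has_vector_derivative - z * S t) (at t)"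

lemma ex_fundamental_solutions: "\<exists>S C. fundamental_solutions z S C"
proof (cases "z = 0")
  case True
  have "fundamental_solutions z (\<lambda>t. of_real t) (\<lambda>_. 1)"
    unfolding fundamental_solutions_def True
    by (auto intro!: derivative_eq_intros simp: has_vector_derivative_of_real)
  then show ?thesis by blast
next
  case False
  define k where "k = csqrt z"
  have k: "k * k = z" "k \<noteq> 0" using False by (auto simp: k_def power2_eq_square[symmetric])
  have 1: "((\<lambda>t. sin (k * of_real t) / k) has_vector_derivative cos (k * of_real t)) (at t)" for t
    using k by (auto intro!: derivative_eq_intros field_differentiable_derivI
      has_vector_derivative_real_field[where f="\<lambda>x. sin (k * x) / k"])
  have 2: "((\<lambda>t. cos (k * of_real t)) has_vector_derivative - (k * k) * (sin (k * of_real t) / k)) (at t)" for t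
    using k by (auto intro!: derivative_eq_intros has_vector_derivative_real_field[where f="\<lambda>x. cos (k * x)"])
  have "fundamental_solutions z (\<lambda>t. sin (k * of_real t) / k) (\<lambda>t. cos (k * of_real t))"
    using 1 2 unfolding fundamental_solutions_def k(1) by simp
  then show ?thesis by blast
qed

section \<open>Representation and existence of solutions on an edge\<close>

context fundamental_solutions
begin

lemma continuous_S: "continuous_on A S" and continuous_C: "continuous_on A C"
  by (auto intro!: continuous_at_imp_continuous_on has_vector_derivative_continuous S_deriv C_deriv)

text \<open>The left-hand side is the Wronskian of \<open>C\<close> and \<open>S\<close>, which is
  constant and equals \<open>1\<close> at \<open>0\<close>.\<close>

lemma C_squared: "C t * C t + z * (S t * S t) = 1"
proof -
  have "((\<lambda>t. C t * C t + z * (S t * S t)) has_derivative (\<lambda>h. 0)) (at t within UNIV)" for t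
  proof -
    have "((\<lambda>t. C t * C t + z * (S t * S t)) has_vector_derivative 0) (at t)"
      by (auto intro!: derivative_eq_intros S_deriv C_deriv simp: algebra_simps)
    then show ?thesis by (simp add: has_vector_derivative_def)
  qed
  from has_derivative_zero_unique[OF convex_UNIV this, of 0 t] show ?thesis by simp
qed

text \<open>Prepares \<open>S (t - x)\<close> as a test function of \<open>x\<close>. The minus sign
  stays inside the second function so that both facts match the hypotheses on \<open>w\<close> and
  \<open>w1\<close> in \<open>green_identity\<close>.\<close>

lemma S_shift: "((\<lambda>x. S (t - x)) has_vector_derivative - C (t - x)) (at x)"
  and C_shift: "((\<lambda>x. - C (t - x)) has_vector_derivative - z * S (t - x)) (at x)"
proof -
  have "((\<lambda>x. t - x) has_vector_derivative -1) (at x)" by (auto intro!: derivative_eq_intros)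
  from vector_diff_chain_at[OF this S_deriv] vector_diff_chain_at[OF this C_deriv]
  show "((\<lambda>x. S (t - x)) has_vector_derivative - C (t - x)) (at x)"
    "((\<lambda>x. - C (t - x)) has_vector_derivative - z * S (t - x)) (at x)"
    by (auto simp: o_def dest: has_vector_derivative_minus)
qed

lemma fundamental_bound: "\<exists>M\<ge>1. \<forall>t \<in> {0..1}. norm (S t) \<le> M \<and> norm (C t) \<le> M"
proof -
  obtain A where A: "\<And>t. t \<in> {0..1} \<Longrightarrow> norm (S t) \<le> A"
    using compact_imp_bounded[OF compact_continuous_image[OF continuous_S compact_Icc]]
    unfolding bounded_iff by fastforce
  obtain B where B: "\<And>t. t \<in> {0..1} \<Longrightarrow> norm (C t) \<le> B"
    using compact_imp_bounded[OF compact_continuous_image[OF continuous_C compact_Icc]]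
    unfolding bounded_iff by fastforce
  show ?thesis by (rule exI[of _ "max 1 (max A B)"]) (use A B in fastforce)
qed

lemma integrable_source_minus:
  fixes f u :: "real \<Rightarrow> complex"
  assumes "set_integrable lborel {0..1} f" "continuous_on {0..1} u"
  shows "set_integrable lborel {0..1} (\<lambda>t. f t - z * u t)"
  by (intro set_integral_diff(1)[OF assms(1)] set_integrable_mult_right set_integrable_lborel_continuous assms(2))

text \<open>Green's identity with the test function \<open>S (t - s)\<close>: it solves the
  homogeneous equation, so the integrals containing \<open>u\<close> cancel, and
  \<open>S 0 = 0\<close>, \<open>C 0 = 1\<close> leave \<open>u t\<close> at the upper end.\<close>

lemma variation_of_constants:
  assumes sob: "sobolev_derivatives u u1 (\<lambda>s. f s - z * u s)"
    and f: "set_integrable lborel {0..1} f" and t: "0 \<le> t" "t \<le> 1"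
  shows "u t = C t * u 0 + S t * u1 0 + integral {0..t} (\<lambda>s. S (t - s) * f s)"
proof -
  have ft: "set_integrable lborel {0..t} f" by (rule set_integrable_subset[OF f]) (use t in auto)
  have cu: "continuous_on {0..t} u"
    using sob t unfolding sobolev_derivatives_def by (auto intro: continuous_on_subset)
  have cS: "continuous_on A (\<lambda>s. S (t - s))" for A
    by (auto intro!: continuous_at_imp_continuous_on has_vector_derivative_continuous S_shift)
  have i1: "(\<lambda>s. S (t - s) * f s) integrable_on {0..t}"
    by (rule set_borel_integral_eq_integral(1)[OF set_integrable_lborel_mult_continuous[OF ft cS]])
  have i2: "(\<lambda>s. u s * (- z * S (t - s))) integrable_on {0..t}"
    by (intro integrable_continuous_real continuous_on_mult cu cS continuous_on_const)
  have "integral {0..t} (\<lambda>s. (f s - z * u s) * S (t - s))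
      = integral {0..t} (\<lambda>s. S (t - s) * f s + u s * (- z * S (t - s)))"
    by (rule Henstock_Kurzweil_Integration.integral_cong) (simp add: algebra_simps)
  also have "\<dots> = integral {0..t} (\<lambda>s. S (t - s) * f s) + integral {0..t} (\<lambda>s. u s * (- z * S (t - s)))"
    by (rule Henstock_Kurzweil_Integration.integral_add[OF i1 i2])
  finally show ?thesis
    using green_identity[OF t sob S_shift[of t] C_shift[of t] continuous_on_mult[OF continuous_on_const cS]]
    unfolding diff_self diff_zero S_0 C_0 by algebra
qed

text \<open>For zero end values the derivative at \<open>0\<close> into the edge is
  \<open>- source_tail f / S 1\<close>; \<open>source_head\<close> plays the same role at
  \<open>1\<close>.\<close>

definition source_tail :: "(real \<Rightarrow> complex) \<Rightarrow> complex" where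
  "source_tail f = integral {0..1} (\<lambda>t. S (1 - t) * f t)"

definition source_head :: "(real \<Rightarrow> complex) \<Rightarrow> complex" where
  "source_head f = integral {0..1} (\<lambda>t. S t * f t)"

text \<open>Together with the next lemma this is the Dirichlet-to-Neumann map of an edge with a
  source; it is the formula of \<open>variation_of_constants\<close> at \<open>1\<close>, solved for
  the slope.\<close>

lemma derivative_at_tail:
  assumes "sobolev_derivatives u u1 (\<lambda>s. f s - z * u s)" "set_integrable lborel {0..1} f"
  shows "S 1 * u1 0 = u 1 - C 1 * u 0 - source_tail f"
  using variation_of_constants[OF assms, of 1] by (simp add: source_tail_def)

text \<open>Testing against \<open>S\<close> on the whole edge: \<open>S 0 = 0\<close> removes the
  slope at \<open>0\<close> and leaves the one at \<open>1\<close>.\<close>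

lemma derivative_at_head:
  assumes sob: "sobolev_derivatives u u1 (\<lambda>s. f s - z * u s)" and f: "set_integrable lborel {0..1} f"
  shows "- S 1 * u1 1 = u 0 - C 1 * u 1 - source_head f"
proof -
  have cu: "continuous_on {0..1} u"
    using sob unfolding sobolev_derivatives_def by auto
  have i1: "(\<lambda>s. S s * f s) integrable_on {0..1}"
    by (rule set_borel_integral_eq_integral(1)[OF set_integrable_lborel_mult_continuous[OF f continuous_S]])
  have i2: "(\<lambda>s. u s * (- z * S s)) integrable_on {0..1}"
    by (intro integrable_continuous_real continuous_on_mult cu continuous_S continuous_on_const)
  have "integral {0..1} (\<lambda>s. (f s - z * u s) * S s)
      = integral {0..1} (\<lambda>s. S s * f s + u s * (- z * S s))"
    by (rule Henstock_Kurzweil_Integration.integral_cong) (simp add: algebra_simps)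
  also have "\<dots> = integral {0..1} (\<lambda>s. S s * f s) + integral {0..1} (\<lambda>s. u s * (- z * S s))"
    by (rule Henstock_Kurzweil_Integration.integral_add[OF i1 i2])
  finally show ?thesis
    using green_identity[OF _ _ sob S_deriv C_deriv continuous_on_mult[OF continuous_on_const continuous_S], of 1]
    by (simp add: source_head_def algebra_simps)
qed

text \<open>For merely integrable \<open>f\<close> the integral in the variation of constants cannot
  be differentiated twice in the classical sense. Subtracting the double primitive \<open>F2\<close>
  of \<open>f\<close> leaves an equation for \<open>u - F2\<close> with the continuous right-hand
  side \<open>- z * F2\<close>, and to this one the classical formula applies.\<close>

lemma ex_solution:
  assumes f: "set_integrable lborel {0..1} f" and S1: "S 1 \<noteq> 0"
  shows "\<exists>u. continuous_on {0..1} u \<and> u 0 = a \<and> u 1 = b \<and> has_second_derivative u (\<lambda>s. f s - z * u s)"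
proof -
  note fi = set_borel_integral_eq_integral(1)[OF f]
  define F1 where "F1 t = integral {0..t} f" for t
  define F2 where "F2 t = integral {0..t} F1" for t
  have cF1: "continuous_on {0..1} F1" unfolding F1_def by (rule indefinite_integral_continuous_1[OF fi])
  have cF2: "continuous_on {0..1} F2" unfolding F2_def
    by (rule indefinite_integral_continuous_1[OF integrable_continuous_real[OF cF1]])
  \<comment> \<open>By the addition theorem, \<open>S (t - s) = S t * C s - C t * S s\<close>; the
    convolution with \<open>S\<close> thus splits into the primitives \<open>A\<close> and
    \<open>B\<close>.\<close>
  define A where "A t = integral {0..t} (\<lambda>s. C s * F2 s)" for t
  define B where "B t = integral {0..t} (\<lambda>s. S s * F2 s)" for t
  have deriv: "((\<lambda>t. integral {0..t} h) has_vector_derivative h t) (at t)"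
    if "continuous_on {0..1} h" "t \<in> {0<..<1}" for h :: "real \<Rightarrow> complex" and t
    using integral_has_vector_derivative[OF that(1), of t] that(2)
    by (simp add: at_within_Icc_at)
  have cCF: "continuous_on {0..1} (\<lambda>s. C s * F2 s)" "continuous_on {0..1} (\<lambda>s. S s * F2 s)"
    by (intro continuous_on_mult continuous_C continuous_S cF2)+
  have cAB: "continuous_on {0..1} A" "continuous_on {0..1} B"
    unfolding A_def B_def by (intro indefinite_integral_continuous_1 integrable_continuous_real cCF)+
  have dF2: "(F2 has_vector_derivative F1 t) (at t)" and dA: "(A has_vector_derivative C t * F2 t) (at t)"
    and dB: "(B has_vector_derivative S t * F2 t) (at t)" if "t \<in> {0<..<1}" for t
    using deriv[OF cF1 that] deriv[OF cCF(1) that] deriv[OF cCF(2) that]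
    unfolding F2_def A_def B_def by auto
  \<comment> \<open>Chosen to give \<open>u\<close> the value \<open>b\<close> at \<open>1\<close>;
    here \<open>S 1\<close> is divided by.\<close>
  define d where "d = (b - (F2 1 - z * (S 1 * A 1 - C 1 * B 1) + a * C 1)) / S 1"
  define u where "u t = F2 t - z * (S t * A t - C t * B t) + a * C t + d * S t" for t
  define v1 where "v1 t = - z * (C t * A t + z * (S t * B t)) - a * z * S t + d * C t" for t
  have cu: "continuous_on {0..1} u" unfolding u_def
    by (intro continuous_intros cF2 cAB continuous_S continuous_C)
  have cv1: "continuous_on {0..1} v1" unfolding v1_def
    by (intro continuous_intros cF2 cAB continuous_S continuous_C)
  have du: "(u has_vector_derivative F1 t + v1 t) (at t)" if "t \<in> {0<..<1}" for t
    unfolding u_def v1_def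
    by (auto intro!: derivative_eq_intros dF2[OF that] dA[OF that] dB[OF that] S_deriv C_deriv
        simp: algebra_simps)
  have dv1: "(v1 has_vector_derivative - z * u t) (at t)" if "t \<in> {0<..<1}" for t
  proof -
    have "(v1 has_vector_derivative
      - z * ((C t * (C t * F2 t) + (- z * S t) * A t) + z * (S t * (S t * F2 t) + C t * B t))
        - a * z * C t + d * (- z * S t)) (at t)"
      unfolding v1_def
      by (auto intro!: derivative_eq_intros dA[OF that] dB[OF that] S_deriv C_deriv simp: algebra_simps)
    also have "- z * ((C t * (C t * F2 t) + (- z * S t) * A t) + z * (S t * (S t * F2 t) + C t * B t))
        - a * z * C t + d * (- z * S t)
        = - z * (F2 t * (C t * C t + z * (S t * S t)) - z * (S t * A t - C t * B t) + a * C t + d * S t)"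
      by (simp add: algebra_simps)
    also have "\<dots> = - z * u t" unfolding C_squared u_def by simp
    finally show ?thesis .
  qed
  have "has_second_derivative u (\<lambda>s. f s - z * u s)"
    unfolding has_second_derivative_def
  proof (intro exI[of _ "\<lambda>t. F1 t + v1 t"] conjI ballI allI impI)
    show "(u has_vector_derivative F1 s + v1 s) (at s)" if "s \<in> {0<..<1}" for s by (rule du[OF that])
    fix x y :: real assume xy: "0 < x \<and> x \<le> y \<and> y < 1"
    show si: "set_integrable lborel {x..y} (\<lambda>s. f s - z * u s)"
      by (rule set_integrable_subset[OF integrable_source_minus[OF f cu]]) (use xy in auto)
    have fxy: "f integrable_on {x..y}" by (rule integrable_on_subinterval[OF fi]) (use xy in auto)
    have Ff: "integral {x..y} f = F1 y - F1 x"
      unfolding F1_def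
      using Henstock_Kurzweil_Integration.integral_combine[of 0 x y f] xy
        integrable_on_subinterval[OF fi, of 0 y]
      by (simp add: algebra_simps)
    have dv: "((\<lambda>s. - z * u s) has_integral v1 y - v1 x) {x..y}"
      by (rule fundamental_theorem_of_calculus_interior)
        (use xy in \<open>auto intro!: dv1[simplified] continuous_on_subset[OF cv1]\<close>)
    have "((\<lambda>s. f s + - z * u s) has_integral (F1 y + v1 y) - (F1 x + v1 x)) {x..y}"
      using has_integral_add[OF integrable_integral[OF fxy] dv]
      by (rule has_integral_eq_rhs) (simp add: Ff)
    then have "integral {x..y} (\<lambda>s. f s - z * u s) = (F1 y + v1 y) - (F1 x + v1 x)"
      by (simp add: integral_unique)
    then show "F1 y + v1 y - (F1 x + v1 x) = (LBINT s:{x..y}. f s - z * u s)"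
      using set_borel_integral_eq_integral(2)[OF si] by simp
  qed
  moreover have "u 0 = a" by (simp add: u_def F2_def B_def)
  moreover have "u 1 = b" using S1 by (simp add: u_def d_def)
  ultimately show ?thesis using cu by blast
qed

end

section \<open>A priori bounds for solutions on an edge\<close>

lemma lipschitz_from_derivative:
  fixes u u1 :: "real \<Rightarrow> complex"
  assumes "continuous_on {0..1} u" "\<And>s. s \<in> {0<..<1} \<Longrightarrow> (u has_vector_derivative u1 s) (at s)"
    and "\<And>s. s \<in> {0<..<1} \<Longrightarrow> norm (u1 s) \<le> B" and ab: "a \<in> {0..1}" "b \<in> {0..1}"
  shows "norm (u b - u a) \<le> B * \<bar>b - a\<bar>"
proof -
  have *: "norm (u b - u a) \<le> B * (b - a)" if "a < b" "a \<in> {0..1}" "b \<in> {0..1}" for a b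
  proof -
    have "norm (u b - u a) \<le> B * b - B * a"
    proof (rule differentiable_bound_general[OF that(1), where f'=u1 and \<phi>'="\<lambda>_. B"])
      show "continuous_on {a..b} u" using that by (auto intro: continuous_on_subset[OF assms(1)])
      show "((*) B has_vector_derivative B) (at x)" for x
        by (auto intro!: derivative_eq_intros)
    qed (use that assms in \<open>auto intro!: continuous_intros\<close>)
    then show ?thesis by (simp add: algebra_simps)
  qed
  show ?thesis
    using *[of a b] *[of b a] ab by (cases a b rule: linorder_cases) (auto simp: norm_minus_commute)
qed

lemma sobolev_derivatives_smooth:
  assumes w: "\<And>t. (w has_vector_derivative w1 t) (at t)" "\<And>t. (w1 has_vector_derivative w2 t) (at t)"
    "continuous_on UNIV w2"
  shows "sobolev_derivatives w w1 w2"
proof -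
  have cw: "continuous_on A w" "continuous_on A w1" "continuous_on A w2" for A
    using continuous_on_subset[OF w(3) subset_UNIV]
    by (auto intro!: continuous_at_imp_continuous_on has_vector_derivative_continuous w)
  have "(w2 has_integral w1 t - w1 0) {0..t}" if "0 \<le> t" for t
    by (rule fundamental_theorem_of_calculus_interior) (simp_all add: that cw w)
  then have "integral {0..t} w2 = w1 t - w1 0" if "0 \<le> t" for t
    using that integral_unique by blast
  then show ?thesis
    unfolding sobolev_derivatives_def by (simp add: cw w set_integrable_lborel_continuous)
qed

context fundamental_solutions
begin

text \<open>The formulas for the derivatives at the ends read backwards: both integrals of
  \<open>w2 + z * w\<close> depend only on the values and slopes of \<open>w\<close> at the ends.
  Sources with prescribed integrals are obtained by prescribing these data.\<close>

lemma source_smooth: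
  assumes w: "\<And>t. (w has_vector_derivative w1 t) (at t)" "\<And>t. (w1 has_vector_derivative w2 t) (at t)"
    "continuous_on UNIV w2"
  shows "source_tail (\<lambda>t. w2 t + z * w t) = w 1 - C 1 * w 0 - S 1 * w1 0"
    and "source_head (\<lambda>t. w2 t + z * w t) = w 0 - C 1 * w 1 + S 1 * w1 1"
proof -
  have "continuous_on A w" for A
    by (auto intro!: continuous_at_imp_continuous_on has_vector_derivative_continuous w)
  then have f: "set_integrable lborel {0..1} (\<lambda>t. w2 t + z * w t)"
    by (intro set_integrable_lborel_continuous continuous_intros continuous_on_subset[OF w(3)]) auto
  have sob: "sobolev_derivatives w w1 (\<lambda>s. (w2 s + z * w s) - z * w s)"
    using sobolev_derivatives_smooth[OF w] by simp
  have swap: "x = a - n \<Longrightarrow> n = a - x" for x a n :: complex by simp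
  show "source_tail (\<lambda>t. w2 t + z * w t) = w 1 - C 1 * w 0 - S 1 * w1 0"
    using swap[OF derivative_at_tail[OF sob f]] by simp
  show "source_head (\<lambda>t. w2 t + z * w t) = w 0 - C 1 * w 1 + S 1 * w1 1"
    using swap[OF derivative_at_head[OF sob f]] by simp
qed

lemma norm_source_le:
  "\<exists>M>0. \<forall>f. set_integrable lborel {0..1} f \<longrightarrow>
    norm (source_tail f) \<le> M * integral {0..1} (\<lambda>t. norm (f t)) \<and>
    norm (source_head f) \<le> M * integral {0..1} (\<lambda>t. norm (f t))"
proof -
  obtain M where M: "1 \<le> M" "\<And>t. t \<in> {0..1} \<Longrightarrow> norm (S t) \<le> M" using fundamental_bound by auto
  have cS: "continuous_on {0..1} (\<lambda>s. S (1 - s))"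
    by (auto intro!: continuous_at_imp_continuous_on has_vector_derivative_continuous S_shift)
  show ?thesis
  proof (intro exI[of _ M] conjI allI impI)
    show "0 < M" using M by simp
    fix f :: "real \<Rightarrow> complex" assume f: "set_integrable lborel {0..1} f"
    show "norm (source_tail f) \<le> M * integral {0..1} (\<lambda>t. norm (f t))"
      unfolding source_tail_def by (rule norm_integral_mult_le[OF f _ _ cS]) (use M in auto)
    show "norm (source_head f) \<le> M * integral {0..1} (\<lambda>t. norm (f t))"
      unfolding source_head_def by (rule norm_integral_mult_le[OF f _ _ continuous_S]) (use M in auto)
  qed
qed

text \<open>The slope at \<open>0\<close> is controlled by \<open>derivative_at_tail\<close>, then
  \<open>u\<close> by the variation of constants and \<open>u1\<close> by integrating the equation.
  The bound on \<open>u1\<close> makes solutions Lipschitz, which is how they are later shown to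
  belong to the spaces.\<close>

lemma solution_bounds:
  assumes S1: "S 1 \<noteq> 0"
  shows "\<exists>K>0. \<forall>f u u1. sobolev_derivatives u u1 (\<lambda>s. f s - z * u s) \<longrightarrow> set_integrable lborel {0..1} f \<longrightarrow>
    (\<forall>t \<in> {0..1}.
      norm (u t) \<le> K * (norm (u 0) + norm (u 1) + integral {0..1} (\<lambda>t. norm (f t))) \<and>
      norm (u1 t) \<le> K * (norm (u 0) + norm (u 1) + integral {0..1} (\<lambda>t. norm (f t))))"
proof -
  obtain M where M: "1 \<le> M" "\<And>t. t \<in> {0..1} \<Longrightarrow> norm (S t) \<le> M" "\<And>t. t \<in> {0..1} \<Longrightarrow> norm (C t) \<le> M"
    using fundamental_bound by auto
  obtain N where N: "0 < N" "\<And>f. set_integrable lborel {0..1} f \<Longrightarrow>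
    norm (source_tail f) \<le> N * integral {0..1} (\<lambda>t. norm (f t))"
    using norm_source_le by auto
  \<comment> \<open>Bounds the slope at \<open>0\<close>: the three summands stand for the end value
    at \<open>1\<close>, the end value at \<open>0\<close> and the source.\<close>
  define R where "R = (1 + M + N) / norm (S 1)"
  have R: "0 < R" using M N S1 by (auto simp: R_def intro!: divide_pos_pos add_pos_pos)
  define K1 where "K1 = M + M * R + M"
  have K1: "0 < K1" using M R by (auto simp: K1_def intro!: add_pos_pos)
  \<comment> \<open>\<open>K1\<close> bounds \<open>u\<close>; the bracket bounds \<open>u1\<close>,
    namely its value at \<open>0\<close>, the integral of \<open>f\<close> and the integral of
    \<open>z * u\<close>.\<close>
  define K where "K = K1 + (R + 1 + norm z * K1)"
  show ?thesis
  proof (intro exI[of _ K] conjI[of "0 < K"] allI impI ballI)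
    show "0 < K" using K1 R by (auto simp: K_def intro!: add_pos_pos add_pos_nonneg)
    fix f u u1 t
    assume sob: "sobolev_derivatives u u1 (\<lambda>s. f s - z * u s)" and f: "set_integrable lborel {0..1} f"
      and t: "t \<in> {0..1::real}"
    define J where "J = integral {0..1} (\<lambda>t. norm (f t))"
    have J: "0 \<le> J" unfolding J_def by (rule integral_nonneg) (use set_borel_integral_eq_integral(1)[OF set_integrable_norm[OF f]] in auto)
    define X where "X = norm (u 0) + norm (u 1) + J"
    have X: "norm (u 0) \<le> X" "norm (u 1) \<le> X" "J \<le> X" "0 \<le> X" using J by (auto simp: X_def)
    have "norm (S 1) * norm (u1 0) = norm (u 1 - C 1 * u 0 - source_tail f)"
      using derivative_at_tail[OF sob f] by (simp flip: norm_mult)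
    also have "\<dots> \<le> norm (u 1) + norm (C 1) * norm (u 0) + norm (source_tail f)"
      using norm_triangle_ineq4[of "u 1 - C 1 * u 0" "source_tail f"]
        norm_triangle_ineq4[of "u 1" "C 1 * u 0"] by (simp add: norm_mult)
    also have "\<dots> \<le> X + M * X + N * X"
    proof (intro add_mono X)
      show "norm (C 1) * norm (u 0) \<le> M * X" by (intro mult_mono M X) (use M in auto)
      have "N * J \<le> N * X" by (intro mult_left_mono X) (use N in auto)
      then show "norm (source_tail f) \<le> N * X" using N(2)[OF f] unfolding J_def by linarith
    qed
    finally have u10: "norm (u1 0) \<le> R * X" using S1 by (simp add: R_def field_simps)
    have ub: "norm (u t) \<le> K1 * X" if t: "t \<in> {0..1}" for t
    proof -
      have "u t = C t * u 0 + S t * u1 0 + integral {0..t} (\<lambda>s. S (t - s) * f s)"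
        using variation_of_constants[OF sob f, of t] t by auto
      also have "norm \<dots> \<le> norm (C t) * norm (u 0) + norm (S t) * norm (u1 0)
          + norm (integral {0..t} (\<lambda>s. S (t - s) * f s))"
        using norm_triangle_ineq[of "C t * u 0 + S t * u1 0" "integral {0..t} (\<lambda>s. S (t - s) * f s)"]
          norm_triangle_ineq[of "C t * u 0" "S t * u1 0"] by (simp add: norm_mult)
      also have "\<dots> \<le> M * X + M * (R * X) + M * X"
      proof (intro add_mono)
        show "norm (C t) * norm (u 0) \<le> M * X" by (intro mult_mono M X t) (use M in auto)
        show "norm (S t) * norm (u1 0) \<le> M * (R * X)" by (intro mult_mono M u10 t) (use M in auto)
        have "norm (integral {0..t} (\<lambda>s. S (t - s) * f s)) \<le> M * J"
          unfolding J_def using t M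
          by (intro norm_integral_mult_le f)
            (auto intro!: continuous_at_imp_continuous_on has_vector_derivative_continuous S_shift)
        also have "\<dots> \<le> M * X" by (intro mult_left_mono X) (use M in auto)
        finally show "norm (integral {0..t} (\<lambda>s. S (t - s) * f s)) \<le> M * X" .
      qed
      finally show ?thesis by (simp add: K1_def algebra_simps)
    qed
    have cu: "continuous_on {0..1} u" using sob by (simp add: sobolev_derivatives_def)
    have sub: "{0..t} \<subseteq> {0..1}" using t by auto
    note fi = integrable_on_subinterval[OF set_borel_integral_eq_integral(1)[OF f] sub]
    have ui: "u integrable_on {0..t}"
      by (intro integrable_continuous_real continuous_on_subset[OF cu sub])
    have "u1 t = u1 0 + integral {0..t} (\<lambda>s. f s - z * u s)"
      using sob t by (simp add: sobolev_derivatives_def)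
    also have "integral {0..t} (\<lambda>s. f s - z * u s) = integral {0..t} (\<lambda>s. 1 * f s) - z * integral {0..t} u"
      by (subst Henstock_Kurzweil_Integration.integral_diff) (use fi ui in \<open>auto intro: integrable_on_mult_right\<close>)
    also have "norm (u1 0 + (integral {0..t} (\<lambda>s. 1 * f s) - z * integral {0..t} u))
      \<le> norm (u1 0) + (norm (integral {0..t} (\<lambda>s. 1 * f s)) + norm z * norm (integral {0..t} u))"
      using norm_triangle_ineq[of "u1 0" "integral {0..t} (\<lambda>s. 1 * f s) - z * integral {0..t} u"]
        norm_triangle_ineq4[of "integral {0..t} (\<lambda>s. 1 * f s)" "z * integral {0..t} u"]
      by (simp add: norm_mult)
    also have "\<dots> \<le> R * X + (1 * X + norm z * (K1 * X))"
    proof (intro add_mono u10 mult_left_mono)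
      have "norm (integral {0..t} (\<lambda>s. 1 * f s)) \<le> 1 * J"
        unfolding J_def using t by (intro norm_integral_mult_le f) auto
      then show "norm (integral {0..t} (\<lambda>s. 1 * f s)) \<le> 1 * X" using X by simp
      have "norm (integral {0..t} u) \<le> integral {0..t} (\<lambda>_. K1 * X)"
        by (rule Henstock_Kurzweil_Integration.integral_norm_bound_integral[OF ui]) (use ub t in auto)
      also have "\<dots> = t * (K1 * X)" using t by simp
      also have "\<dots> \<le> 1 * (K1 * X)" by (rule mult_right_mono) (use t K1 X in auto)
      finally show "norm (integral {0..t} u) \<le> K1 * X" by simp
    qed auto
    finally have u1b: "norm (u1 t) \<le> (R + 1 + norm z * K1) * X" by (simp add: algebra_simps)
    have "norm (u t) \<le> K * X"
      by (rule order_trans[OF ub[OF t] mult_right_mono]) (use R K1 X in \<open>auto simp: K_def\<close>)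
    moreover have "norm (u1 t) \<le> K * X"
      by (rule order_trans[OF u1b mult_right_mono]) (use R K1 X in \<open>auto simp: K_def\<close>)
    ultimately show "norm (u t) \<le> K * (norm (u 0) + norm (u 1) + integral {0..1} (\<lambda>t. norm (f t))) \<and>
      norm (u1 t) \<le> K * (norm (u 0) + norm (u 1) + integral {0..1} (\<lambda>t. norm (f t)))"
      unfolding X_def J_def by blast
  qed
qed
end

text \<open>Values and slopes of \<open>bump\<close> vanish at the ends of \<open>[0,1]\<close> except for the slope \<open>1\<close> at \<open>0\<close>, and
  its second derivative vanishes at both ends.\<close>

definition bump :: "real \<Rightarrow> complex" where
  "bump t = of_real (t - 6 * t^3 + 8 * t^4 - 3 * t^5)"

definition bump' :: "real \<Rightarrow> complex" where
  "bump' t = of_real (1 - 18 * t^2 + 32 * t^3 - 15 * t^4)"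

definition bump'' :: "real \<Rightarrow> complex" where
  "bump'' t = of_real (- 36 * t + 96 * t^2 - 60 * t^3)"

lemma bump_deriv: "(bump has_vector_derivative bump' t) (at t)"
  unfolding bump_def bump'_def
  by (rule has_vector_derivative_of_real)
    (auto intro!: derivative_eq_intros)

lemma bump'_deriv: "(bump' has_vector_derivative bump'' t) (at t)"
  unfolding bump'_def bump''_def
  by (rule has_vector_derivative_of_real)
    (auto intro!: derivative_eq_intros)

lemma continuous_bump: "continuous_on A bump" and continuous_bump'': "continuous_on A bump''"
  unfolding bump_def bump''_def by (intro continuous_intros)+

lemma bump_reflect_deriv: "((\<lambda>x. bump (1 - x)) has_vector_derivative - bump' (1 - t)) (at t)"
  and bump'_reflect_deriv: "((\<lambda>x. - bump' (1 - x)) has_vector_derivative bump'' (1 - t)) (at t)"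
proof -
  have "((\<lambda>x. 1 - x) has_vector_derivative -1) (at t)" by (auto intro!: derivative_eq_intros)
  from vector_diff_chain_at[OF this bump_deriv] vector_diff_chain_at[OF this bump'_deriv]
  show "((\<lambda>x. bump (1 - x)) has_vector_derivative - bump' (1 - t)) (at t)"
    "((\<lambda>x. - bump' (1 - x)) has_vector_derivative bump'' (1 - t)) (at t)"
    by (auto simp: o_def dest: has_vector_derivative_minus)
qed

lemma bump_values [simp]: "bump 0 = 0" "bump 1 = 0" "bump' 0 = 1" "bump' 1 = 0" "bump'' 0 = 0" "bump'' 1 = 0"
  by (simp_all add: bump_def bump'_def bump''_def)

section \<open>Test functions for end values and sources\<close>

context fundamental_solutions
begin

lemma green_test:
  assumes sob: "sobolev_derivatives u u1 (\<lambda>s. f s - z * u s)" and f: "set_integrable lborel {0..1} f"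
    and w: "\<And>t. (w has_vector_derivative w1 t) (at t)" "\<And>t. (w1 has_vector_derivative w2 t) (at t)"
      "continuous_on UNIV w2"
  shows "u1 1 * w 1 - u1 0 * w 0 - u 1 * w1 1 + u 0 * w1 0
    = integral {0..1} (\<lambda>t. w t * f t) - integral {0..1} (\<lambda>t. (w2 t + z * w t) * u t)"
proof -
  have cu: "continuous_on {0..1} u"
    using sob unfolding sobolev_derivatives_def by auto
  have cw: "continuous_on A w" "continuous_on A w2" for A
    using continuous_on_subset[OF w(3) subset_UNIV]
    by (auto intro!: continuous_at_imp_continuous_on has_vector_derivative_continuous w)
  have i1: "(\<lambda>s. w s * f s) integrable_on {0..1}"
    by (rule set_borel_integral_eq_integral(1)[OF set_integrable_lborel_mult_continuous[OF f cw(1)]])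
  have i2: "(\<lambda>s. (w2 s + z * w s) * u s) integrable_on {0..1}"
    and i3: "(\<lambda>s. u s * w2 s) integrable_on {0..1}"
    by (intro integrable_continuous_real continuous_intros cu cw)+
  have "integral {0..1} (\<lambda>s. (f s - z * u s) * w s)
      = integral {0..1} (\<lambda>s. w s * f s - (w2 s + z * w s) * u s + u s * w2 s)"
    by (rule Henstock_Kurzweil_Integration.integral_cong) (simp add: algebra_simps)
  also have "\<dots> = integral {0..1} (\<lambda>s. w s * f s - (w2 s + z * w s) * u s) + integral {0..1} (\<lambda>s. u s * w2 s)"
    by (rule Henstock_Kurzweil_Integration.integral_add[OF integrable_diff[OF i1 i2] i3])
  also have "integral {0..1} (\<lambda>s. w s * f s - (w2 s + z * w s) * u s)
      = integral {0..1} (\<lambda>s. w s * f s) - integral {0..1} (\<lambda>s. (w2 s + z * w s) * u s)"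
    by (rule Henstock_Kurzweil_Integration.integral_diff[OF i1 i2])
  finally show ?thesis
    using green_identity[OF _ _ sob w, of 1] by simp
qed

text \<open>Testing with \<open>bump\<close>, whose end values and slope at \<open>1\<close> vanish,
  leaves only \<open>u 0\<close> among the boundary terms; the reflected bump leaves
  \<open>u 1\<close>. The right-hand side contains only integrals of absolute values, which the
  norms of all the spaces control.\<close>

lemma trace_bound:
  "\<exists>K>0. \<forall>f u u1. sobolev_derivatives u u1 (\<lambda>s. f s - z * u s) \<longrightarrow> set_integrable lborel {0..1} f \<longrightarrow>
     norm (u 0) + norm (u 1)
       \<le> K * (integral {0..1} (\<lambda>t. norm (u t)) + integral {0..1} (\<lambda>t. norm (f t)))"
proof -
  define h where "h t = bump'' t + z * bump t" for t
  have cr: "continuous_on A (\<lambda>t. 1 - t)" for A :: "real set" by (intro continuous_intros)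
  have crb: "continuous_on A (\<lambda>t. bump (1 - t))" "continuous_on A (\<lambda>t. bump'' (1 - t))" for A
    using continuous_on_compose[OF cr continuous_bump] continuous_on_compose[OF cr continuous_bump'']
    by (auto simp: o_def)
  have ch: "continuous_on A h" for A
    unfolding h_def by (intro continuous_intros continuous_bump continuous_bump'')
  have chr: "continuous_on A (\<lambda>t. h (1 - t))" for A
    unfolding h_def by (intro continuous_intros crb)
  obtain A where A: "\<And>t. t \<in> {0..1} \<Longrightarrow> norm (bump t) \<le> A"
    using compact_imp_bounded[OF compact_continuous_image[OF continuous_bump compact_Icc]]
    unfolding bounded_iff by fastforce
  obtain B where B: "\<And>t. t \<in> {0..1} \<Longrightarrow> norm (h t) \<le> B"
    using compact_imp_bounded[OF compact_continuous_image[OF ch compact_Icc]]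
    unfolding bounded_iff by fastforce
  define K where "K = 2 * (1 + max A B)"
  have "0 \<le> A" using A[of 0] norm_ge_zero[of "bump 0"] by simp
  then have AB: "A \<le> K / 2" "B \<le> K / 2" "0 \<le> K / 2" "0 < K"
    by (auto simp: K_def)
  show ?thesis
  proof (intro exI[of _ K] conjI[of "0 < K"] allI impI AB(4))
    fix f u u1
    assume sob: "sobolev_derivatives u u1 (\<lambda>s. f s - z * u s)" and f: "set_integrable lborel {0..1} f"
    have u: "set_integrable lborel {0..1} u"
      using sob unfolding sobolev_derivatives_def by (intro set_integrable_lborel_continuous) auto
    let ?f = "integral {0..1} (\<lambda>t. norm (f t))" and ?u = "integral {0..1} (\<lambda>t. norm (u t))"
    have bound: "norm (integral {0..1} (\<lambda>t. w t * g t)) \<le> K / 2 * integral {0..1} (\<lambda>t. norm (g t))"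
      if "set_integrable lborel {0..1} g" "continuous_on {0..1} w" "\<And>t. t \<in> {0..1} \<Longrightarrow> norm (w t) \<le> K / 2"
      for g w :: "real \<Rightarrow> complex"
      by (rule norm_integral_mult_le[OF that(1) _ _ that(2,3) AB(3)]) auto
    have wb: "norm (bump t) \<le> K / 2" "norm (h t) \<le> K / 2" if "t \<in> {0..1}" for t
      using A[OF that] B[OF that] AB by linarith+
    have "u 0 = integral {0..1} (\<lambda>t. bump t * f t) - integral {0..1} (\<lambda>t. h t * u t)"
      using green_test[OF sob f bump_deriv bump'_deriv continuous_bump''] by (simp add: h_def)
    also have "norm \<dots> \<le> K / 2 * ?f + K / 2 * ?u"
      by (rule order_trans[OF norm_triangle_ineq4 add_mono])
        (rule bound; intro f u continuous_bump ch wb; simp)+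
    finally have 0: "norm (u 0) \<le> K / 2 * ?f + K / 2 * ?u" .
    \<comment> \<open>The slope of the reflected bump at \<open>1\<close> is \<open>- 1\<close>,
      which compensates the sign of \<open>u 1\<close> in the boundary terms.\<close>
    have "u 1 = integral {0..1} (\<lambda>t. bump (1 - t) * f t) - integral {0..1} (\<lambda>t. h (1 - t) * u t)"
      using green_test[OF sob f bump_reflect_deriv bump'_reflect_deriv crb(2)] by (simp add: h_def)
    also have "norm \<dots> \<le> K / 2 * ?f + K / 2 * ?u"
      by (rule order_trans[OF norm_triangle_ineq4 add_mono])
        (rule bound; intro f u crb chr wb; simp)+
    finally have 1: "norm (u 1) \<le> K / 2 * ?f + K / 2 * ?u" .
    show "norm (u 0) + norm (u 1) \<le> K * (?u + ?f)" using 0 1 by (simp add: algebra_simps)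
  qed
qed

text \<open>The sources are taken of the form w'' + z w. By \<open>source_smooth\<close> only the
  boundary data of w matter, and for w a multiple of \<open>bump\<close> only the slope at
  \<open>0\<close> is left. Since \<open>bump''\<close> vanishes at the ends as well, so do \<phi>0
  and \<phi>1, and multiples of them on different edges join continuously with the value
  \<open>0\<close> at the vertices. These six end conditions explain the degree five of
  \<open>bump\<close>.\<close>

lemma ex_dual_sources:
  assumes S1: "S 1 \<noteq> 0"
  shows "\<exists>\<phi>0 \<phi>1 L. \<phi>0 0 = 0 \<and> \<phi>0 1 = 0 \<and> \<phi>1 0 = 0 \<and> \<phi>1 1 = 0 \<and>
    source_tail \<phi>0 = 1 \<and> source_head \<phi>0 = 0 \<and> source_tail \<phi>1 = 0 \<and> source_head \<phi>1 = 1 \<and>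
    0 < L \<and> continuous_on {0..1} \<phi>0 \<and> continuous_on {0..1} \<phi>1 \<and>
    (\<forall>s \<in> {0..1}. norm (\<phi>0 s) \<le> L \<and> norm (\<phi>1 s) \<le> L) \<and>
    (\<forall>s \<in> {0..1}. \<forall>t \<in> {0..1}. norm (\<phi>0 t - \<phi>0 s) \<le> L * \<bar>t - s\<bar> \<and> norm (\<phi>1 t - \<phi>1 s) \<le> L * \<bar>t - s\<bar>)"
proof -
  \<comment> \<open>\<open>source_smooth\<close> yields
    \<open>source_tail \<phi> = - S 1 * k\<close>.\<close>
  define k where "k = - 1 / S 1"
  define \<phi> where "\<phi> t = k * bump'' t + z * (k * bump t)" for t
  define \<phi>' where "\<phi>' t = k * of_real (- 36 + 192 * t - 180 * t^2) + z * (k * bump' t)" for t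
  have d0: "((\<lambda>t. k * bump t) has_vector_derivative k * bump' t) (at t)"
    "((\<lambda>t. k * bump' t) has_vector_derivative k * bump'' t) (at t)"
    "((\<lambda>t. k * bump (1 - t)) has_vector_derivative k * - bump' (1 - t)) (at t)"
    "((\<lambda>t. k * - bump' (1 - t)) has_vector_derivative k * bump'' (1 - t)) (at t)" for t
    by (rule has_vector_derivative_mult_right bump_deriv bump'_deriv bump_reflect_deriv bump'_reflect_deriv)+
  have cr: "continuous_on A (\<lambda>t. 1 - t)" for A :: "real set" by (intro continuous_intros)
  have cd: "continuous_on UNIV (\<lambda>t. k * bump'' t)" "continuous_on UNIV (\<lambda>t. k * bump'' (1 - t))"
    using continuous_on_compose[OF cr continuous_bump'']
    by (auto simp: o_def intro!: continuous_intros continuous_bump'')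
  have s: "source_tail \<phi> = 1" "source_head \<phi> = 0"
    "source_tail (\<lambda>t. \<phi> (1 - t)) = 0" "source_head (\<lambda>t. \<phi> (1 - t)) = 1"
    using source_smooth[OF d0(1,2) cd(1)] source_smooth[OF d0(3,4) cd(2)] S1
    unfolding \<phi>_def by (simp_all add: k_def)
  have d\<phi>: "(\<phi> has_vector_derivative \<phi>' t) (at t)" for t
  proof -
    have "(bump'' has_vector_derivative of_real (- 36 + 192 * t - 180 * t^2)) (at t)"
      unfolding bump''_def
      by (rule has_vector_derivative_of_real)
        (auto intro!: derivative_eq_intros)
    then show ?thesis unfolding \<phi>_def \<phi>'_def
      by (intro has_vector_derivative_add has_vector_derivative_mult_right bump_deriv)
  qed
  have c\<phi>: "continuous_on A \<phi>" for A
    by (auto intro!: continuous_at_imp_continuous_on has_vector_derivative_continuous d\<phi>)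
  have c\<phi>': "continuous_on {0..1} \<phi>'"
    unfolding \<phi>'_def bump'_def by (intro continuous_intros)
  obtain A where A: "\<And>t. t \<in> {0..1} \<Longrightarrow> norm (\<phi>' t) \<le> A"
    using compact_imp_bounded[OF compact_continuous_image[OF c\<phi>' compact_Icc]]
    unfolding bounded_iff by fastforce
  obtain B where B: "\<And>t. t \<in> {0..1} \<Longrightarrow> norm (\<phi> t) \<le> B"
    using compact_imp_bounded[OF compact_continuous_image[OF c\<phi> compact_Icc]]
    unfolding bounded_iff by fastforce
  define L where "L = 1 + max A B"
  have "0 \<le> A" using A[of 0] norm_ge_zero[of "\<phi>' 0"] by (simp del: norm_ge_zero)
  then have L: "A \<le> L" "B \<le> L" "0 < L" by (auto simp: L_def)
  have lip: "norm (\<phi> t - \<phi> s) \<le> L * \<bar>t - s\<bar>" if "s \<in> {0..1}" "t \<in> {0..1}" for s t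
  proof (rule lipschitz_from_derivative[where ?u1.0=\<phi>'])
    show "norm (\<phi>' r) \<le> L" if "r \<in> {0<..<1}" for r using A[of r] L that by auto
  qed (use c\<phi> d\<phi> that in auto)
  have lipr: "norm (\<phi> (1 - t) - \<phi> (1 - s)) \<le> L * \<bar>t - s\<bar>" if "s \<in> {0..1}" "t \<in> {0..1}" for s t
    using lip[of "1 - s" "1 - t"] that by (auto simp: abs_minus_commute)
  have bd: "norm (\<phi> s) \<le> L" if "s \<in> {0..1}" for s
    using B[OF that] L by linarith
  have "continuous_on {0..1} (\<lambda>t. \<phi> (1 - t))"
    using continuous_on_compose[OF cr c\<phi>] by (simp add: o_def)
  then show ?thesis
    by (intro exI[of _ \<phi>] exI[of _ "\<lambda>t. \<phi> (1 - t)"] exI[of _ L])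
      (use s c\<phi> bd lip lipr L in \<open>simp add: \<phi>_def[of 0] \<phi>_def[of 1]\<close>)
qed

end

section \<open>Consequences of membership in the resolvent set\<close>

lemma resolvent_set_injD:
  assumes "z \<in> resolvent_set X A" "(u, w) \<in> A" "snorm X (\<lambda>x. z * u x - w x) = 0"
  shows "snorm X u = 0"
proof -
  have "\<forall>(u, w) \<in> A. snorm X (\<lambda>x. z * u x - w x) = 0 \<longrightarrow> snorm X u = 0"
    using assms(1) unfolding resolvent_set_def by simp
  from bspec[OF this assms(2)] assms(3) show ?thesis by simp
qed

lemma resolvent_set_surjD:
  assumes "z \<in> resolvent_set X A" "f \<in> vectors X"
  obtains u w where "(u, w) \<in> A" "snorm X (\<lambda>x. z * u x - w x - f x) = 0"
proof -
  have "\<forall>f \<in> vectors X. \<exists>(u, w) \<in> A. snorm X (\<lambda>x. z * u x - w x - f x) = 0"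
    using assms(1) unfolding resolvent_set_def by simp
  then have "\<exists>(u, w) \<in> A. snorm X (\<lambda>x. z * u x - w x - f x) = 0" using assms(2) by (rule bspec)
  then show ?thesis using that by auto
qed

lemma resolvent_set_boundedD:
  assumes "z \<in> resolvent_set X A"
  obtains C where "\<And>u w. (u, w) \<in> A \<Longrightarrow> snorm X u \<le> C * snorm X (\<lambda>x. z * u x - w x)"
proof -
  have "\<exists>C. \<forall>(u, w) \<in> A. snorm X u \<le> C * snorm X (\<lambda>x. z * u x - w x)"
    using assms unfolding resolvent_set_def by simp
  then show ?thesis using that by auto
qed

context fundamental_solutions
begin

text \<open>If \<open>S 1 = 0\<close>, then \<open>S\<close> is a Dirichlet eigenfunction.\<close>

lemma dirichlet_resolvent_imp:
  assumes "z \<in> resolvent_set L2_interval dirichlet_operator"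
  shows "S 1 \<noteq> 0"
proof
  assume S1: "S 1 = 0"
  let ?M = "restrict_space lborel {0..1::real}"
  have int: "integrable ?M (\<lambda>x. norm (k * S x) powr 2)" for k
  proof -
    have "continuous_on {0..1} (\<lambda>x. norm (k * S x) ^ 2)" by (intro continuous_intros continuous_S)
    then have "set_integrable lborel {0..1} (\<lambda>x. norm (k * S x) ^ 2)"
      unfolding set_integrable_def by (intro borel_integrable_compact) auto
    then show ?thesis by (simp add: integrable_restrict_space set_integrable_def powr_numeral)
  qed
  have meas: "(\<lambda>x. k * S x) \<in> borel_measurable ?M" for k
    using borel_measurable_continuous_onI[OF continuous_S[of UNIV]]
    by (intro measurable_restrict_space1) auto
  have vec: "(\<lambda>x. k * S x) \<in> vectors L2_interval" for k
    unfolding L2_interval_def Lp_def using int[of k] meas[of k] by simp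
  have hs: "has_second_derivative S (\<lambda>s. - z * S s)"
    unfolding has_second_derivative_def
  proof (intro exI[of _ C] conjI ballI allI impI S_deriv)
    fix a b :: real assume ab: "0 < a \<and> a \<le> b \<and> b < 1"
    show si: "set_integrable lborel {a..b} (\<lambda>s. - z * S s)"
      by (intro set_integrable_lborel_continuous continuous_intros continuous_S)
    have "((\<lambda>s. - z * S s) has_integral C b - C a) {a..b}"
      by (rule fundamental_theorem_of_calculus_interior) (use ab in \<open>auto simp: continuous_C C_deriv[simplified]\<close>)
    then show "C b - C a = (LBINT s:{a..b}. - z * S s)"
      using set_borel_integral_eq_integral(2)[OF si] by (simp only: integral_unique)
  qed
  have "(S, \<lambda>s. - (- z * S s)) \<in> dirichlet_operator"
    unfolding dirichlet_operator_def mem_Collect_eq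
    by (rule exI[of _ S], rule exI[of _ "\<lambda>s. - z * S s"])
      (use vec[of 1] vec[of "-z"] hs continuous_S S1 in simp)
  from resolvent_set_injD[OF assms this] have "snorm L2_interval S = 0"
    by (simp add: L2_interval_def Lp_def)
  then have "(\<integral>x. norm (S x) powr 2 \<partial>?M) = 0" by (simp add: L2_interval_def Lp_def)
  then have ae: "AE x in ?M. norm (S x) powr 2 = 0"
    using integral_nonneg_eq_0_iff_AE[of ?M "\<lambda>x. norm (S x) powr 2"] int[of 1] by simp
  then have "AE x in lborel. x \<in> {0..1} \<longrightarrow> S x = 0"
    by (subst (asm) AE_restrict_space_iff) auto
  then have ae0: "AE x in lborel. indicator {0..t} x *\<^sub>R S x = 0" if "t \<le> 1" for t
    by eventually_elim (use that in \<open>auto simp: indicator_def\<close>)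
  \<comment> \<open>So far \<open>S\<close> is known to vanish only almost everywhere on
    \<open>[0,1]\<close>. Its integrals vanish, hence \<open>C = 1\<close> there, and integrating
    once more gives \<open>S 1 = 1\<close>, a contradiction.\<close>
  have S_int: "integral {0..t} S = 0" if "0 \<le> t" "t \<le> 1" for t
  proof -
    have "(LBINT x:{0..t}. S x) = 0"
      unfolding set_lebesgue_integral_def by (rule integral_eq_zero_AE[OF ae0[OF that(2)]])
    then show ?thesis
      using set_borel_integral_eq_integral(2)[OF set_integrable_lborel_continuous[OF continuous_S, of 0 t]] by simp
  qed
  have C1: "C t = 1" if "0 \<le> t" "t \<le> 1" for t
  proof -
    have "((\<lambda>s. - z * S s) has_integral C t - C 0) {0..t}"
      by (rule fundamental_theorem_of_calculus_interior[OF that(1) continuous_C C_deriv])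
    then have "C t - C 0 = integral {0..t} (\<lambda>s. - z * S s)" by (simp only: integral_unique)
    also have "\<dots> = - z * integral {0..t} S" by (rule integral_mult_right)
    finally show ?thesis using S_int[OF that] by simp
  qed
  have "(C has_integral S 1 - S 0) {0..1}"
    by (rule fundamental_theorem_of_calculus_interior[OF _ continuous_S S_deriv]) simp
  then have "S 1 - S 0 = integral {0..1} C" by (simp only: integral_unique)
  also have "\<dots> = integral {0..1::real} (\<lambda>_. 1)"
    by (rule Henstock_Kurzweil_Integration.integral_cong) (use C1 in auto)
  finally show False using S1 by simp
qed

end

section \<open>Distances and growth\<close>

context metric_graph
begin

lemma finite_incident [simp]: "v \<in> verts G \<Longrightarrow> finite (incident_edges G v)"
  using uniformly_locally_finite by blast

text \<open>No path leaves a vertex without incident edges, whereas connectedness provides one to an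
  end of some edge. This keeps \<open>weight\<close> positive.\<close>

lemma incident_edges_nonempty:
  assumes v: "v \<in> verts G"
  shows "incident_edges G v \<noteq> {}"
proof
  assume none: "incident_edges G v = {}"
  obtain e where e: "e \<in> arcs G" using nonempty_arcs by auto
  have stay: "y = x" if "edge_path G x L y" "x = Vertex v" for x L y
    using that
  proof (induction rule: edge_path.induct)
    case (step L e a b)
    then have "edge_point G e a = Vertex v" by simp
    then have "e \<in> incident_edges G v"
      using step.hyps by (auto simp: edge_point_def incident_edges_def split: if_splits)
    then show ?case using none by simp
  qed simp
  obtain L where "edge_path G (Vertex v) L (Vertex (tail G e))"
    using edge_path_verts[OF v tail_in_verts[OF e]] by blast
  from stay[OF this] have "tail G e = v" by simp
  then show False using none e by (auto simp: incident_edges_def)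
qed

lemma path_dist_nonneg: "0 \<le> path_dist G x y"
  using Metric_space.nonneg[OF Metric_space_points] .

lemma path_dist_edge_points:
  assumes "e \<in> arcs G" "a \<in> {0..1}" "b \<in> {0..1}"
  shows "path_dist G (edge_point G e a) (edge_point G e b) \<le> \<bar>b - a\<bar>"
  using path_dist_le[OF edge_path_segment[OF assms]] .

lemma point_edge_cases:
  assumes "x \<in> points G"
  obtains e a where "e \<in> arcs G" "a \<in> {0..1}" "x = edge_point G e a"
proof -
  from assms consider v where "x = Vertex v" "v \<in> verts G" | e s where "x = Inner e s" "e \<in> arcs G" "0 < s" "s < 1"
    by (auto simp: points_def)
  then show ?thesis
  proof cases
    case 1
    then obtain e where e: "e \<in> arcs G" "tail G e = v \<or> head G e = v"
      using incident_edges_nonempty by (auto simp: incident_edges_def)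
    then show ?thesis
      using that[of e 0] that[of e 1] 1 by (auto simp: edge_point_def)
  next
    case 2
    then show ?thesis using that[of e s] by (auto simp: edge_point_def)
  qed
qed

text \<open>Functions that are 1-Lipschitz along every edge bound the path metric from below. The
  functions \<open>f\<close> in the proof are the distance from \<open>x\<close>, cut off at a
  radius within which only edges through \<open>x\<close> are met. In this way continuity is reduced
  to single edges.\<close>

lemma common_edge:
  assumes x: "x \<in> points G"
  shows "\<exists>r>0. \<forall>y \<in> points G. path_dist G x y < r \<longrightarrow>
    (\<exists>e \<in> arcs G. \<exists>a \<in> {0..1}. \<exists>b \<in> {0..1}.
      x = edge_point G e a \<and> y = edge_point G e b \<and> \<bar>b - a\<bar> \<le> path_dist G x y)"
proof -
  from x consider v where "x = Vertex v" "v \<in> verts G" | e s where "x = Inner e s" "e \<in> arcs G" "0 < s" "s < 1"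
    by (auto simp: points_def)
  then show ?thesis
  proof cases
    case 1
    define f where "f z = (case z of Vertex w \<Rightarrow> if w = v then 0 else 1 |
      Inner e s \<Rightarrow> if tail G e = v then s else if head G e = v then 1 - s else (1::real))" for z :: "('v,'e) point"
    have lip: "f (edge_point G e b) - f (edge_point G e a) \<le> \<bar>b - a\<bar>"
      if "e \<in> arcs G" "a \<in> {0..1}" "b \<in> {0..1}" for e a b
    proof -
      have *: "f (edge_point G e a) = (if tail G e = v then a else if head G e = v then 1 - a else (1::real))" for a
        using no_loops[OF that(1)] by (auto simp: f_def edge_point_def)
      show ?thesis unfolding * by auto
    qed
    have "\<exists>e \<in> arcs G. \<exists>a \<in> {0..1}. \<exists>b \<in> {0..1}.
      x = edge_point G e a \<and> y = edge_point G e b \<and> \<bar>b - a\<bar> \<le> path_dist G x y"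
      if y: "y \<in> points G" and d: "path_dist G x y < 1" for y
    proof -
      have "f y - f x \<le> path_dist G x y"
        using lipschitz_edge_path[of f, OF lip] by (intro path_dist_ge x y) auto
      moreover have "f x = 0" using 1 by (simp add: f_def)
      ultimately have fy: "f y \<le> path_dist G x y" "f y < 1" using d by auto
      show ?thesis
      proof (cases y)
        case (Vertex w)
        then have "w = v" using fy by (auto simp: f_def split: if_splits)
        then have "y = x" using Vertex 1 by simp
        moreover obtain e a where "e \<in> arcs G" "a \<in> {0..1}" "x = edge_point G e a"
          using point_edge_cases[OF x] .
        ultimately show ?thesis using path_dist_nonneg[of x x] by (intro bexI[of _ e] bexI[of _ a]) auto
      next
        case (Inner e s)
        then have e: "e \<in> arcs G" "0 < s" "s < 1" using y by (auto simp: points_def)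
        from fy(2) Inner consider "tail G e = v" | "tail G e \<noteq> v" "head G e = v"
          by (auto simp: f_def split: if_splits)
        then show ?thesis
        proof cases
          case a: 1
          then have "s \<le> path_dist G x y" using fy Inner by (simp add: f_def)
          then show ?thesis
            using e a 1 Inner by (intro bexI[of _ e] bexI[of _ "0::real"] bexI[of _ s]) (auto simp: edge_point_def)
        next
          case a: 2
          then have "1 - s \<le> path_dist G x y" using fy Inner by (simp add: f_def)
          then show ?thesis
            using e a 1 Inner by (intro bexI[of _ e] bexI[of _ "1::real"] bexI[of _ s]) (auto simp: edge_point_def)
        qed
      qed
    qed
    then show ?thesis by (intro exI[of _ 1]) auto
  next
    case 2
    define m where "m = min s (1 - s)"
    define f where "f z = (case z of Vertex w \<Rightarrow> m |
      Inner e' s' \<Rightarrow> if e' = e then min \<bar>s' - s\<bar> m else m)" for z :: "('v,'e) point"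
    have m: "m > 0" using 2 by (auto simp: m_def)
    have lip: "f (edge_point G e' b) - f (edge_point G e' a) \<le> \<bar>b - a\<bar>"
      if "e' \<in> arcs G" "a \<in> {0..1}" "b \<in> {0..1}" for e' a b
    proof -
      have *: "f (edge_point G e' a) = (if e' = e then min \<bar>a - s\<bar> m else m)" for a
        using 2 by (auto simp: f_def edge_point_def m_def)
      show ?thesis unfolding * by auto
    qed
    have "\<exists>e \<in> arcs G. \<exists>a \<in> {0..1}. \<exists>b \<in> {0..1}.
      x = edge_point G e a \<and> y = edge_point G e b \<and> \<bar>b - a\<bar> \<le> path_dist G x y"
      if y: "y \<in> points G" and d: "path_dist G x y < m" for y
    proof -
      have "f y - f x \<le> path_dist G x y"
        using lipschitz_edge_path[of f, OF lip] by (intro path_dist_ge x y) auto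
      moreover have "f x = 0" using 2 m by (simp add: f_def)
      ultimately have fy: "f y \<le> path_dist G x y" "f y < m" using d by auto
      then obtain s' where s': "y = Inner e s'" "\<bar>s' - s\<bar> < m" "\<bar>s' - s\<bar> \<le> path_dist G x y"
        by (auto simp: f_def split: point.splits if_splits)
      then show ?thesis using 2 y
        by (intro bexI[of _ e] bexI[of _ s] bexI[of _ s']) (auto simp: edge_point_def points_def)
    qed
    then show ?thesis using m by (intro exI[of _ m]) auto
  qed
qed

lemma finite_edges_through:
  assumes x: "x \<in> points G"
  shows "finite {e \<in> arcs G. \<exists>a \<in> {0..1}. x = edge_point G e a}"
proof -
  from x consider v where "x = Vertex v" "v \<in> verts G" | e s where "x = Inner e s" "e \<in> arcs G" "0 < s" "s < 1"
    by (auto simp: points_def)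
  then show ?thesis
  proof cases
    case 1
    have "{e \<in> arcs G. \<exists>a \<in> {0..1}. x = edge_point G e a} \<subseteq> incident_edges G v"
      using 1 by (auto simp: edge_point_def incident_edges_def split: if_splits)
    then show ?thesis using finite_incident[OF 1(2)] by (rule finite_subset)
  next
    case 2
    have "{e \<in> arcs G. \<exists>a \<in> {0..1}. x = edge_point G e a} \<subseteq> {e}"
      using 2 by (auto simp: edge_point_def split: if_splits)
    then show ?thesis by (rule finite_subset) simp
  qed
qed

lemma continuous_edge_point:
  assumes e: "e \<in> arcs G"
  shows "continuous_map (top_of_set {0..1}) (mtopology_of (graph_metric G)) (edge_point G e)"
  unfolding mtopology_of_def mspace_graph_metric mdist_graph_metric
    Metric_space.continuous_map_to_metric[OF Metric_space_points]
proof (intro ballI allI impI)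
  fix x \<epsilon> :: real assume x: "x \<in> topspace (top_of_set {0..1})" and \<epsilon>: "0 < \<epsilon>"
  show "\<exists>U. openin (top_of_set {0..1}) U \<and> x \<in> U \<and>
      (\<forall>y \<in> U. edge_point G e y \<in> Metric_space.mball (points G) (path_dist G) (edge_point G e x) \<epsilon>)"
  proof (intro exI[of _ "{0..1} \<inter> ball x \<epsilon>"] conjI ballI)
    fix y assume y: "y \<in> {0..1} \<inter> ball x \<epsilon>"
    then have "path_dist G (edge_point G e x) (edge_point G e y) < \<epsilon>"
      using path_dist_edge_points[OF e, of x y] x by (auto simp: dist_real_def)
    then show "edge_point G e y \<in> Metric_space.mball (points G) (path_dist G) (edge_point G e x) \<epsilon>"
      using edge_point_in[OF e] x y by (simp add: Metric_space.in_mball[OF Metric_space_points])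
  qed (use x \<epsilon> in auto)
qed

lemma continuous_edge_function:
  assumes "continuous_on_graph G u" "e \<in> arcs G"
  shows "continuous_on {0..1} (edge_function G u e)"
proof -
  have "continuous_map (top_of_set {0..1}) euclidean (u \<circ> edge_point G e)"
    using continuous_map_compose[OF continuous_edge_point[OF assms(2)]] assms(1)
    unfolding continuous_on_graph_def by blast
  then show ?thesis by (simp add: o_def edge_function_def[abs_def])
qed

text \<open>The constants \<open>L e\<close> may be unbounded over the graph. Near a given point
  only the finitely many edges through it occur, and \<open>M\<close> dominates their
  constants.\<close>

lemma continuous_on_graph_edgewise_lipschitz:
  assumes lip: "\<And>e a b. e \<in> arcs G \<Longrightarrow> a \<in> {0..1} \<Longrightarrow> b \<in> {0..1} \<Longrightarrow>
    norm (edge_function G u e b - edge_function G u e a) \<le> L e * \<bar>b - a\<bar>"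
  shows "continuous_on_graph G u"
proof -
  have "openin (mtopology_of (graph_metric G)) {x \<in> points G. u x \<in> W}" if W: "open W" for W
    unfolding mtopology_of_def mspace_graph_metric mdist_graph_metric
      Metric_space.openin_mtopology[OF Metric_space_points]
  proof (intro conjI ballI allI impI)
    fix x assume "x \<in> {x \<in> points G. u x \<in> W}"
    then have x: "x \<in> points G" "u x \<in> W" by auto
    obtain \<epsilon> where \<epsilon>: "0 < \<epsilon>" "\<And>w. dist w (u x) < \<epsilon> \<Longrightarrow> w \<in> W"
      using W x(2) unfolding open_dist by blast
    obtain r where r: "0 < r" "\<And>y. y \<in> points G \<Longrightarrow> path_dist G x y < r \<Longrightarrow>
      \<exists>e \<in> arcs G. \<exists>a \<in> {0..1}. \<exists>b \<in> {0..1}.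
        x = edge_point G e a \<and> y = edge_point G e b \<and> \<bar>b - a\<bar> \<le> path_dist G x y"
      using common_edge[OF x(1)] by auto
    define E where "E = {e \<in> arcs G. \<exists>a \<in> {0..1}. x = edge_point G e a}"
    define M where "M = 1 + (\<Sum>e \<in> E. \<bar>L e\<bar>)"
    have M: "1 \<le> M" "L e \<le> M" if "e \<in> E" for e
      using member_le_sum[of e E "\<lambda>e. \<bar>L e\<bar>"] that finite_edges_through[OF x(1)]
      by (auto simp: M_def E_def sum_nonneg)
    have M0: "0 < M" unfolding M_def by (intro add_pos_nonneg sum_nonneg) auto
    show "\<exists>r>0. Metric_space.mball (points G) (path_dist G) x r \<subseteq> {x \<in> points G. u x \<in> W}"
    proof (intro exI[of _ "min r (\<epsilon> / M)"] conjI subsetI)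
      fix y assume "y \<in> Metric_space.mball (points G) (path_dist G) x (min r (\<epsilon> / M))"
      then have y: "y \<in> points G" "path_dist G x y < r" "path_dist G x y < \<epsilon> / M"
        by (auto simp: Metric_space.in_mball[OF Metric_space_points])
      obtain e a b where e: "e \<in> arcs G" "a \<in> {0..1}" "b \<in> {0..1}" "x = edge_point G e a"
        "y = edge_point G e b" "\<bar>b - a\<bar> \<le> path_dist G x y"
        using r(2)[OF y(1,2)] by blast
      have "e \<in> E" using e by (auto simp: E_def)
      have "norm (u y - u x) \<le> L e * \<bar>b - a\<bar>"
        using lip[OF e(1-3)] e by (simp add: edge_function_def)
      also have "\<dots> \<le> M * path_dist G x y" using M[OF \<open>e \<in> E\<close>] e(6) by (intro mult_mono) auto
      also have "\<dots> < \<epsilon>" using y(3) M0 by (simp add: field_simps)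
      finally show "y \<in> {x \<in> points G. u x \<in> W}" using \<epsilon>(2) y(1) by (simp add: dist_norm)
    qed (use r \<epsilon> M0 in auto)
  qed auto
  then show ?thesis
    unfolding continuous_on_graph_def continuous_map_def by simp
qed

section \<open>Conductances, and distances between vertices and between edges\<close>

definition other :: "'e \<Rightarrow> 'v \<Rightarrow> 'v" where
  "other e v = (if v = tail G e then head G e else tail G e)"

lemma other_in_verts: "e \<in> arcs G \<Longrightarrow> other e v \<in> verts G"
  by (simp add: other_def)

lemma other_other: "e \<in> incident_edges G v \<Longrightarrow> other e (other e v) = v"
  by (auto simp: other_def incident_edges_def)

lemma other_incident: "e \<in> incident_edges G v \<Longrightarrow> e \<in> incident_edges G (other e v)"
  by (auto simp: other_def incident_edges_def)

text \<open>The reversing measure of the random walk with conductances \<open>c\<close>; the vertex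
  operator is symmetric with respect to it.\<close>

definition weight :: "'v \<Rightarrow> real" where
  "weight v = (\<Sum>e \<in> incident_edges G v. c e)"

lemma weight_pos: "v \<in> verts G \<Longrightarrow> 0 < weight v"
  unfolding weight_def
  by (intro sum_pos incident_edges_nonempty finite_incident) (auto simp: incident_edges_def conductivity_pos)

lemma conductivity_le_weight: "v \<in> verts G \<Longrightarrow> e \<in> incident_edges G v \<Longrightarrow> c e \<le> weight v"
  unfolding weight_def using finite_incident[of v]
  by (intro member_le_sum) (simp_all add: incident_edges_def[of G v] less_imp_le[OF conductivity_pos])

definition vdist :: "'v \<Rightarrow> 'v \<Rightarrow> real" where
  "vdist v w = path_dist G (Vertex v) (Vertex w)"

lemma vdist_nonneg: "0 \<le> vdist v w" by (simp add: vdist_def path_dist_nonneg)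

lemma vdist_commute: "vdist v w = vdist w v" by (simp add: vdist_def path_dist_commute)

lemma vdist_self [simp]: "v \<in> verts G \<Longrightarrow> vdist v v = 0"
  by (simp add: vdist_def path_dist_refl points_def)

lemma vdist_triangle: "u \<in> verts G \<Longrightarrow> v \<in> verts G \<Longrightarrow> w \<in> verts G \<Longrightarrow> vdist u w \<le> vdist u v + vdist v w"
  unfolding vdist_def by (rule path_dist_triangle) (auto simp: points_def)

lemma vdist_ends: "e \<in> arcs G \<Longrightarrow> vdist (tail G e) (head G e) \<le> 1"
  using path_dist_edge_points[of e 0 1] by (simp add: vdist_def edge_point_def)

lemma vdist_incident:
  assumes "e \<in> incident_edges G v"
  shows "vdist v (tail G e) \<le> 1" "vdist v (head G e) \<le> 1" "vdist v (other e v) \<le> 1"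
proof -
  have e: "e \<in> arcs G" "v = tail G e \<or> v = head G e" using assms by (auto simp: incident_edges_def)
  then show "vdist v (tail G e) \<le> 1" "vdist v (head G e) \<le> 1" "vdist v (other e v) \<le> 1"
    using vdist_ends[OF e(1)] by (auto simp: other_def vdist_commute)
qed

lemma incident_in_verts: "e \<in> incident_edges G v \<Longrightarrow> v \<in> verts G"
  by (auto simp: incident_edges_def)

text \<open>Initial vertices represent the edges because the growth condition centres its balls
  there. Distinct edges can have distance \<open>0\<close>.\<close>

definition edist :: "'e \<Rightarrow> 'e \<Rightarrow> real" where
  "edist e e' = vdist (tail G e) (tail G e')"

lemma edist_nonneg: "0 \<le> edist e e'" by (simp add: edist_def vdist_nonneg)

lemma edist_commute: "edist e e' = edist e' e" by (simp add: edist_def vdist_commute)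

lemma edist_self [simp]: "e \<in> arcs G \<Longrightarrow> edist e e = 0" by (simp add: edist_def)

text \<open>Either initial vertex is within distance \<open>1\<close> of the chosen end. Passing
  between decay in \<open>vdist\<close> and decay in \<open>edist\<close> therefore costs only a
  constant factor.\<close>

lemma edist_le_incident:
  assumes "e \<in> incident_edges G v" "e' \<in> incident_edges G w"
  shows "edist e e' \<le> vdist v w + 2" "vdist v w \<le> edist e e' + 2"
proof -
  have v: "v \<in> verts G" "w \<in> verts G" "tail G e \<in> verts G" "tail G e' \<in> verts G"
    using assms by (auto simp: incident_edges_def)
  note d = vdist_incident(1)[OF assms(1)] vdist_incident(1)[OF assms(2)]
  show "edist e e' \<le> vdist v w + 2"
    using vdist_triangle[OF v(3,1,4)] vdist_triangle[OF v(1,2,4)] d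
    by (simp add: edist_def vdist_commute)
  show "vdist v w \<le> edist e e' + 2"
    using vdist_triangle[OF v(1,3,2)] vdist_triangle[OF v(3,4,2)] d
    by (simp add: edist_def vdist_commute)
qed

end

section \<open>Subexponential growth of conductivities and of balls\<close>

locale growth_graph = metric_graph G c for G :: "('v, 'e) pre_digraph" and c +
  assumes growth: "growth_condition G c"
begin

text \<open>Points of \<open>e'\<close> are within distance \<open>1\<close> of its initial vertex,
  so a constant enlargement of the radius puts the whole edge into the ball; in the growth condition
  this affects only the constant.\<close>

lemma edge_in_ball:
  assumes e: "e \<in> arcs G" "e' \<in> arcs G" and d: "edist e e' \<le> r"
  shows "Inner e' ` {0<..<1} \<subseteq> mball_of (graph_metric G) (Vertex (tail G e)) (r + 2)"
proof
  fix x :: "('v, 'e) point" assume "x \<in> Inner e' ` {0<..<1}"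
  then obtain s where s: "0 < s" "s < 1" "x = Inner e' s" by auto
  have in_pts: "Vertex (tail G e) \<in> points G" "Vertex (tail G e') \<in> points G" "x \<in> points G"
    using s e by (auto simp: points_def)
  have "path_dist G (Vertex (tail G e')) x \<le> s"
    using path_dist_edge_points[OF e(2), of 0 s] s by (simp add: edge_point_def)
  then have "path_dist G (Vertex (tail G e)) x < r + 2"
    using path_dist_triangle[OF in_pts] d s by (simp add: edist_def vdist_def)
  then show "x \<in> mball_of (graph_metric G) (Vertex (tail G e)) (r + 2)"
    using in_pts by simp
qed

lemma finite_edge_ball: "e \<in> arcs G \<Longrightarrow> finite {e' \<in> arcs G. edist e e' \<le> r}"
  by (rule finite_subset[OF _ finite_edges_in_ball[of "tail G e" "r + 2"]]) (use edge_in_ball in blast)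

lemma sum_conductivity_ball:
  assumes \<epsilon>: "0 < \<epsilon>"
  shows "\<exists>C>0. \<forall>e \<in> arcs G. \<forall>r\<ge>0. (\<Sum>e' | e' \<in> arcs G \<and> edist e e' \<le> r. c e') \<le> C * exp (\<epsilon> * r) * c e"
proof -
  obtain C where C: "0 < C" "\<And>e r. e \<in> arcs G \<Longrightarrow> 0 < r \<Longrightarrow>
      (\<Sum>e' | e' \<in> arcs G \<and> Inner e' ` {0<..<1} \<subseteq> mball_of (graph_metric G) (Vertex (tail G e)) r. c e')
        \<le> C * exp (\<epsilon> * r) * c e"
    using growth \<epsilon> unfolding growth_condition_def by meson
  show ?thesis
  proof (intro exI[of _ "C * exp (\<epsilon> * 2)"] conjI ballI allI impI)
    show "0 < C * exp (\<epsilon> * 2)" using C by simp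
    fix e and r :: real assume e: "e \<in> arcs G" and r: "0 \<le> r"
    have "(\<Sum>e' | e' \<in> arcs G \<and> edist e e' \<le> r. c e')
        \<le> (\<Sum>e' | e' \<in> arcs G \<and> Inner e' ` {0<..<1} \<subseteq> mball_of (graph_metric G) (Vertex (tail G e)) (r + 2). c e')"
    proof (rule sum_mono2[OF finite_edges_in_ball])
      show "{e' \<in> arcs G. edist e e' \<le> r} \<subseteq>
        {e' \<in> arcs G. Inner e' ` {0<..<1} \<subseteq> mball_of (graph_metric G) (Vertex (tail G e)) (r + 2)}"
        using edge_in_ball[OF e] by blast
    qed (auto intro: less_imp_le[OF conductivity_pos])
    also have "\<dots> \<le> C * exp (\<epsilon> * (r + 2)) * c e" using C(2)[OF e, of "r + 2"] r by simp
    also have "\<dots> = C * exp (\<epsilon> * 2) * exp (\<epsilon> * r) * c e" by (simp add: exp_add distrib_left)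
    finally show "(\<Sum>e' | e' \<in> arcs G \<and> edist e e' \<le> r. c e') \<le> C * exp (\<epsilon> * 2) * exp (\<epsilon> * r) * c e" .
  qed
qed

text \<open>The edge \<open>e'\<close> is one term of the sum over the ball of radius
  \<open>edist e e'\<close> about \<open>e\<close>. As the two edges can be exchanged,
  conductivities vary at most subexponentially in both directions.\<close>

lemma conductivity_ratio:
  assumes \<epsilon>: "0 < \<epsilon>"
  shows "\<exists>C>0. \<forall>e \<in> arcs G. \<forall>e' \<in> arcs G. c e' \<le> C * exp (\<epsilon> * edist e e') * c e"
proof -
  obtain C where C: "0 < C" "\<And>e r. e \<in> arcs G \<Longrightarrow> 0 \<le> r \<Longrightarrow>
      (\<Sum>e' | e' \<in> arcs G \<and> edist e e' \<le> r. c e') \<le> C * exp (\<epsilon> * r) * c e"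
    using sum_conductivity_ball[OF \<epsilon>] by blast
  have "c e' \<le> C * exp (\<epsilon> * edist e e') * c e" if e: "e \<in> arcs G" "e' \<in> arcs G" for e e'
  proof -
    have "c e' \<le> (\<Sum>e'' | e'' \<in> arcs G \<and> edist e e'' \<le> edist e e'. c e'')"
      by (rule member_le_sum) (use e finite_edge_ball in \<open>auto intro: less_imp_le[OF conductivity_pos]\<close>)
    also have "\<dots> \<le> C * exp (\<epsilon> * edist e e') * c e" by (rule C(2)[OF e(1) edist_nonneg])
    finally show ?thesis .
  qed
  then show ?thesis using C(1) by blast
qed

text \<open>By \<open>conductivity_ratio\<close> no edge of the ball has a conductivity much smaller
  than that of \<open>e\<close>, so a bound for the sum of conductivities is also one for the number
  of edges. Each of the two estimates spends \<open>\<epsilon> / 2\<close>.\<close>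

lemma card_edge_ball:
  assumes \<epsilon>: "0 < \<epsilon>"
  shows "\<exists>C>0. \<forall>e \<in> arcs G. \<forall>r\<ge>0. real (card {e' \<in> arcs G. edist e e' \<le> r}) \<le> C * exp (\<epsilon> * r)"
proof -
  obtain C where C: "0 < C" "\<And>e r. e \<in> arcs G \<Longrightarrow> 0 \<le> r \<Longrightarrow>
      (\<Sum>e' | e' \<in> arcs G \<and> edist e e' \<le> r. c e') \<le> C * exp (\<epsilon> / 2 * r) * c e"
    using sum_conductivity_ball[of "\<epsilon> / 2"] \<epsilon> by auto
  obtain D where D: "0 < D" "\<And>e e'. e \<in> arcs G \<Longrightarrow> e' \<in> arcs G \<Longrightarrow> c e' \<le> D * exp (\<epsilon> / 2 * edist e e') * c e"
    using conductivity_ratio[of "\<epsilon> / 2"] \<epsilon> by auto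
  show ?thesis
  proof (intro exI[of _ "D * C"] conjI ballI allI impI)
    show "0 < D * C" using C D by simp
    fix e and r :: real assume e: "e \<in> arcs G" and r: "0 \<le> r"
    let ?B = "{e' \<in> arcs G. edist e e' \<le> r}"
    have "real (card ?B) * c e = (\<Sum>e' \<in> ?B. c e)" by simp
    also have "\<dots> \<le> (\<Sum>e' \<in> ?B. D * exp (\<epsilon> / 2 * r) * c e')"
    proof (rule sum_mono)
      fix e' assume e': "e' \<in> ?B"
      have "c e \<le> D * exp (\<epsilon> / 2 * edist e' e) * c e'" using D(2)[of e' e] e e' by simp
      also have "\<dots> \<le> D * exp (\<epsilon> / 2 * r) * c e'"
        using e' \<epsilon> D(1) conductivity_pos[of e'] by (auto simp: edist_commute intro!: mult_right_mono mult_left_mono)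
      finally show "c e \<le> D * exp (\<epsilon> / 2 * r) * c e'" .
    qed
    also have "\<dots> = D * exp (\<epsilon> / 2 * r) * (\<Sum>e' \<in> ?B. c e')" by (simp add: sum_distrib_left)
    also have "\<dots> \<le> D * exp (\<epsilon> / 2 * r) * (C * exp (\<epsilon> / 2 * r) * c e)"
      using C(2)[OF e r] D(1) by (intro mult_left_mono) auto
    also have "\<dots> = D * C * exp (\<epsilon> * r) * c e"
      by (simp add: mult_exp_exp[symmetric] algebra_simps flip: exp_add)
    finally show "real (card ?B) \<le> D * C * exp (\<epsilon> * r)" using conductivity_pos[OF e] by simp
  qed
qed

text \<open>At most \<open>C * exp (\<delta> / 2 * k)\<close> edges lie within distance
  \<open>k\<close>, against a weight of order \<open>exp (- \<delta> * k)\<close>. The bound is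
  uniform in \<open>e\<close>, as a Schur test requires.\<close>

lemma exp_edist_summable:
  assumes \<delta>: "0 < \<delta>"
  shows "\<exists>K>0. \<forall>e \<in> arcs G. (\<lambda>e'. exp (- \<delta> * edist e e')) summable_on arcs G \<and>
    (\<Sum>\<^sub>\<infinity>e' \<in> arcs G. exp (- \<delta> * edist e e')) \<le> K"
proof -
  obtain C where C: "0 < C" "\<And>e r. e \<in> arcs G \<Longrightarrow> 0 \<le> r \<Longrightarrow>
      real (card {e' \<in> arcs G. edist e e' \<le> r}) \<le> C * exp (\<delta> / 2 * r)"
    using card_edge_ball[of "\<delta> / 2"] \<delta> by auto
  \<comment> \<open>The decay per unit distance that remains after half of \<delta> has been spent
    on counting.\<close>
  define q where "q = exp (- \<delta> / 2)"
  have q: "0 < q" "q < 1" using \<delta> by (auto simp: q_def)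
  define K where "K = exp \<delta> * (C * (1 / (1 - q)))"
  have K: "0 < K" using C q by (auto simp: K_def)
  have fin: "(\<Sum>e' \<in> F. exp (- \<delta> * edist e e')) \<le> K" if e: "e \<in> arcs G" and F: "finite F" "F \<subseteq> arcs G" for e F
  proof -
    define n where "n e' = nat \<lceil>edist e e'\<rceil>" for e'
    have n: "edist e e' \<le> n e'" "n e' \<le> edist e e' + 1" for e'
      using edist_nonneg[of e e'] by (auto simp: n_def)
    define M where "M = Suc (Max (insert 0 (n ` F)))"
    have nM: "n e' < M" if "e' \<in> F" for e' using that F(1) by (simp add: M_def less_Suc_eq_le)
    \<comment> \<open>The inner sum dominates its summand at \<open>k = n e'\<close>, the distance
      rounded up; the rounding costs the factor \<open>exp \<delta>\<close>.\<close>
    have "(\<Sum>e' \<in> F. exp (- \<delta> * edist e e'))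
        \<le> (\<Sum>e' \<in> F. exp \<delta> * (\<Sum>k<M. if edist e e' \<le> real k then exp (- \<delta> * real k) else 0))"
    proof (rule sum_mono)
      fix e' assume e': "e' \<in> F"
      have "\<delta> * n e' \<le> \<delta> * (edist e e' + 1)"
        using n(2)[of e'] \<delta> by (intro mult_left_mono) auto
      then have "exp (- \<delta> * edist e e') \<le> exp (\<delta> * (1 - real (n e')))"
        by (simp add: algebra_simps)
      also have "\<dots> = exp \<delta> * (if edist e e' \<le> real (n e') then exp (- \<delta> * real (n e')) else 0)"
        using n(1)[of e'] by (simp add: right_diff_distrib flip: exp_add)
      also have "\<dots> \<le> exp \<delta> * (\<Sum>k<M. if edist e e' \<le> real k then exp (- \<delta> * real k) else 0)"
        by (intro mult_left_mono member_le_sum[where f="\<lambda>k. if edist e e' \<le> real k then exp (- \<delta> * real k) else 0"])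
          (use nM[OF e'] in auto)
      finally show "exp (- \<delta> * edist e e') \<le> exp \<delta> * (\<Sum>k<M. if edist e e' \<le> real k then exp (- \<delta> * real k) else 0)" .
    qed
    also have "\<dots> = exp \<delta> * (\<Sum>k<M. \<Sum>e' \<in> F. if edist e e' \<le> real k then exp (- \<delta> * real k) else 0)"
      by (subst sum.swap) (simp add: sum_distrib_left)
    also have "\<dots> \<le> exp \<delta> * (\<Sum>k<M. C * q ^ k)"
    proof (intro mult_left_mono sum_mono)
      fix k
      have "(\<Sum>e' \<in> F. if edist e e' \<le> real k then exp (- \<delta> * real k) else 0)
          = exp (- \<delta> * k) * card {e' \<in> F. edist e e' \<le> k}"
        using F by (simp add: sum.If_cases Int_def)
      also have "\<dots> \<le> exp (- \<delta> * k) * (C * exp (\<delta> / 2 * k))"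
      proof (rule mult_left_mono)
        have "card {e' \<in> F. edist e e' \<le> k} \<le> card {e' \<in> arcs G. edist e e' \<le> k}"
          by (rule card_mono[OF finite_edge_ball[OF e]]) (use F in auto)
        then show "real (card {e' \<in> F. edist e e' \<le> k}) \<le> C * exp (\<delta> / 2 * k)"
          using C(2)[OF e, of "real k"] by simp
      qed simp
      also have "\<dots> = C * q ^ k"
        by (simp add: q_def mult.left_commute flip: exp_add exp_of_nat_mult)
      finally show "(\<Sum>e' \<in> F. if edist e e' \<le> real k then exp (- \<delta> * real k) else 0) \<le> C * q ^ k" .
    qed simp
    also have "\<dots> \<le> K" unfolding K_def
    proof (intro mult_left_mono)
      have "(\<Sum>k<M. q ^ k) \<le> (\<Sum>k. q ^ k)" by (rule sum_le_suminf) (use q in auto)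
      also have "\<dots> = 1 / (1 - q)" using q by (simp add: suminf_geometric)
      finally show "(\<Sum>k<M. C * q ^ k) \<le> C * (1 / (1 - q))"
        unfolding sum_distrib_left[symmetric] using C by (intro mult_left_mono) auto
    qed simp
    finally show ?thesis .
  qed
  have s: "(\<lambda>e'. exp (- \<delta> * edist e e')) summable_on arcs G" if "e \<in> arcs G" for e
    by (rule nonneg_bdd_above_summable_on) (use fin[OF that] in \<open>auto intro!: bdd_aboveI[of _ K]\<close>)
  show ?thesis
    using K s infsum_le_finite_sums[OF s fin] by blast
qed

end

section \<open>The vertex operator and its Green kernel\<close>

lemma has_sum_finite_sum:
  fixes f :: "'i \<Rightarrow> 'a \<Rightarrow> complex"
  assumes "finite I" "\<And>i. i \<in> I \<Longrightarrow> (f i has_sum s i) A"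
  shows "((\<lambda>x. \<Sum>i\<in>I. f i x) has_sum (\<Sum>i\<in>I. s i)) A"
  using assms by (induction I rule: finite_induct) (auto intro: has_sum_add)

lemma abs_summable_complexI:
  fixes f :: "'a \<Rightarrow> complex" and g :: "'a \<Rightarrow> real"
  assumes "g summable_on A" "\<And>x. x \<in> A \<Longrightarrow> norm (f x) \<le> g x"
  shows "f summable_on A" "(\<lambda>x. norm (f x)) summable_on A"
proof -
  show "(\<lambda>x. norm (f x)) summable_on A"
    by (rule summable_on_comparison_test[OF assms]) auto
  then show "f summable_on A" by (rule abs_summable_summable)
qed

lemma norm_infsum_le_real:
  fixes f :: "'a \<Rightarrow> complex" and g :: "'a \<Rightarrow> real"
  assumes g: "g summable_on A" and le: "\<And>x. x \<in> A \<Longrightarrow> norm (f x) \<le> g x"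
  shows "norm (infsum f A) \<le> infsum g A"
proof -
  have s: "(\<lambda>x. norm (f x)) summable_on A" using abs_summable_complexI[OF assms] by blast
  have "norm (infsum f A) \<le> infsum (\<lambda>x. norm (f x)) A" by (rule norm_infsum_bound[OF s])
  also have "\<dots> \<le> infsum g A" by (rule infsum_mono[OF s g le])
  finally show ?thesis .
qed

context metric_graph
begin

text \<open>The transition operator of the random walk with conductances \<open>c\<close>, minus \<open>\<mu>\<close>.\<close>

definition vertex_op :: "complex \<Rightarrow> ('v \<Rightarrow> complex) \<Rightarrow> 'v \<Rightarrow> complex" where
  "vertex_op \<mu> a v =
    (\<Sum>e \<in> incident_edges G v. of_real (c e) * (a (other e v) - \<mu> * a v)) / of_real (weight v)"

lemma weight_vertex_op:
  assumes "v \<in> verts G"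
  shows "of_real (weight v) * vertex_op \<mu> a v
    = (\<Sum>e \<in> incident_edges G v. of_real (c e) * (a (other e v) - \<mu> * a v))"
  using weight_pos[OF assms] by (simp add: vertex_op_def)

text \<open>The coefficients \<open>c e / weight v\<close> are transition probabilities, hence at
  most \<open>1\<close>; after this estimate the conductivities have disappeared.\<close>

lemma norm_vertex_sum_le:
  fixes f :: "'e \<Rightarrow> complex"
  assumes v: "v \<in> verts G"
  shows "norm ((\<Sum>e \<in> incident_edges G v. of_real (c e) * f e) / of_real (weight v))
    \<le> (\<Sum>e \<in> incident_edges G v. norm (f e))"
proof -
  have "norm ((\<Sum>e \<in> incident_edges G v. of_real (c e) * f e) / of_real (weight v))
      = norm (\<Sum>e \<in> incident_edges G v. of_real (c e / weight v) * f e)"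
    by (simp add: sum_divide_distrib)
  also have "\<dots> \<le> (\<Sum>e \<in> incident_edges G v. norm (of_real (c e / weight v) * f e))" by (rule norm_sum)
  also have "\<dots> \<le> (\<Sum>e \<in> incident_edges G v. norm (f e))"
  proof (rule sum_mono)
    fix e assume e: "e \<in> incident_edges G v"
    have "0 < c e" "c e \<le> weight v"
      using conductivity_pos conductivity_le_weight[OF v e] e by (auto simp: incident_edges_def)
    then have "\<bar>c e / weight v\<bar> \<le> 1" by (simp add: divide_le_eq)
    then show "norm (of_real (c e / weight v) * f e) \<le> norm (f e)"
      unfolding norm_mult norm_of_real by (intro mult_left_le_one_le) auto
  qed
  finally show ?thesis .
qed

text \<open>Functions on the vertices are measured by functions on the edges, so that only sequence spaces
  over the edges are needed.\<close>

definition edge_norm :: "('v \<Rightarrow> complex) \<Rightarrow> 'e \<Rightarrow> real" where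
  "edge_norm a e = norm (a (tail G e)) + norm (a (head G e))"

lemma edge_norm_nonneg: "0 \<le> edge_norm a e" by (simp add: edge_norm_def)

lemma norm_le_edge_norm: "e \<in> incident_edges G v \<Longrightarrow> norm (a v) \<le> edge_norm a e"
  "e \<in> incident_edges G v \<Longrightarrow> norm (a (other e v)) \<le> edge_norm a e"
  by (auto simp: edge_norm_def incident_edges_def other_def)

lemma norm_vertex_op_le:
  assumes v: "v \<in> verts G"
  shows "norm (vertex_op \<mu> a v) \<le> (1 + norm \<mu>) * (\<Sum>e \<in> incident_edges G v. edge_norm a e)"
proof -
  have "norm (vertex_op \<mu> a v) \<le> (\<Sum>e \<in> incident_edges G v. norm (a (other e v) - \<mu> * a v))"
    unfolding vertex_op_def by (rule norm_vertex_sum_le[OF v])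
  also have "\<dots> \<le> (\<Sum>e \<in> incident_edges G v. (1 + norm \<mu>) * edge_norm a e)"
  proof (rule sum_mono)
    fix e assume e: "e \<in> incident_edges G v"
    have "norm (a (other e v) - \<mu> * a v) \<le> norm (a (other e v)) + norm \<mu> * norm (a v)"
      using norm_triangle_ineq4[of "a (other e v)" "\<mu> * a v"] by (simp add: norm_mult)
    also have "\<dots> \<le> edge_norm a e + norm \<mu> * edge_norm a e"
      by (intro add_mono mult_left_mono norm_le_edge_norm e) auto
    finally show "norm (a (other e v) - \<mu> * a v) \<le> (1 + norm \<mu>) * edge_norm a e" by (simp add: algebra_simps)
  qed
  finally show ?thesis by (simp add: sum_distrib_left)
qed

text \<open>A resolvent kernel of the vertex operator, \<open>g y\<close> being its column at \<open>y\<close>.\<close>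

definition green_kernel :: "complex \<Rightarrow> ('v \<Rightarrow> 'v \<Rightarrow> complex) \<Rightarrow> bool" where
  "green_kernel \<mu> g \<longleftrightarrow>
    (\<exists>K>0. \<exists>\<delta>>0. \<forall>x \<in> verts G. \<forall>y \<in> verts G. norm (g y x) \<le> K * exp (- \<delta> * vdist x y)) \<and>
    (\<forall>x \<in> verts G. \<forall>y \<in> verts G. vertex_op \<mu> (g y) x = (if x = y then 1 else 0))"

text \<open>The positive operator that dominates exponentially decaying kernels; its boundedness on
  a sequence space is the Schur test.\<close>

definition kernel_sum :: "real \<Rightarrow> ('e \<Rightarrow> real) \<Rightarrow> 'e \<Rightarrow> real" where
  "kernel_sum \<delta> \<alpha> e = (\<Sum>\<^sub>\<infinity>e' \<in> arcs G. exp (- \<delta> * edist e e') * \<alpha> e')"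

end

text \<open>The constant \<open>4\<close> here and the constant \<open>2\<close> in \<open>laplacian_space\<close> below are not sharp; they make
  the inequalities of Minkowski and Hoelder dispensable.\<close>

locale edge_sequence_space = growth_graph G c
  for G :: "('v, 'e) pre_digraph" and c +
  fixes Z :: "('e \<Rightarrow> real) set" and N :: "('e \<Rightarrow> real) \<Rightarrow> real"
  assumes Z_nonneg: "\<alpha> \<in> Z \<Longrightarrow> e \<in> arcs G \<Longrightarrow> 0 \<le> \<alpha> e"
    and solid: "\<alpha> \<in> Z \<Longrightarrow> (\<And>e. e \<in> arcs G \<Longrightarrow> 0 \<le> \<beta> e \<and> \<beta> e \<le> \<alpha> e) \<Longrightarrow> \<beta> \<in> Z \<and> N \<beta> \<le> N \<alpha>"
    and scale: "\<alpha> \<in> Z \<Longrightarrow> 0 \<le> t \<Longrightarrow> (\<lambda>e. t * \<alpha> e) \<in> Z \<and> N (\<lambda>e. t * \<alpha> e) = t * N \<alpha>"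
    and add: "\<alpha> \<in> Z \<Longrightarrow> \<beta> \<in> Z \<Longrightarrow> (\<lambda>e. \<alpha> e + \<beta> e) \<in> Z \<and> N (\<lambda>e. \<alpha> e + \<beta> e) \<le> 4 * (N \<alpha> + N \<beta>)"
    and kernel: "0 < \<delta> \<Longrightarrow> \<exists>K>0. \<forall>\<alpha> \<in> Z.
      (\<forall>e \<in> arcs G. (\<lambda>e'. exp (- \<delta> * edist e e') * \<alpha> e') summable_on arcs G) \<and>
      kernel_sum \<delta> \<alpha> \<in> Z \<and> N (kernel_sum \<delta> \<alpha>) \<le> K * N \<alpha>"
    and unit: "e \<in> arcs G \<Longrightarrow> indicator {e} \<in> Z \<and> 0 < N (indicator {e})"
    and unit_ratio: "0 < \<epsilon> \<Longrightarrow> \<exists>K>0. \<forall>e \<in> arcs G. \<forall>e' \<in> arcs G.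
      N (indicator {e'}) \<le> K * exp (\<epsilon> * edist e e') * N (indicator {e})"
begin

lemma N_nonneg: "\<alpha> \<in> Z \<Longrightarrow> 0 \<le> N \<alpha>"
  using solid[of \<alpha> "\<lambda>e. 0 * \<alpha> e"] scale[of \<alpha> 0] Z_nonneg[of \<alpha>] by auto

lemma kernel_summable:
  assumes "0 < \<delta>" "\<alpha> \<in> Z" "e \<in> arcs G"
  shows "(\<lambda>e'. exp (- \<delta> * edist e e') * \<alpha> e') summable_on arcs G"
  using kernel[OF assms(1)] assms(2,3) by blast

lemma dominated:
  assumes "0 < \<delta>" "0 \<le> B"
  shows "\<exists>K>0. \<forall>\<alpha> \<in> Z. \<forall>\<beta>. (\<forall>e \<in> arcs G. 0 \<le> \<beta> e \<and> \<beta> e \<le> B * kernel_sum \<delta> \<alpha> e) \<longrightarrow> \<beta> \<in> Z \<and> N \<beta> \<le> K * N \<alpha>"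
proof -
  obtain K where K: "0 < K" "\<And>\<alpha>. \<alpha> \<in> Z \<Longrightarrow> kernel_sum \<delta> \<alpha> \<in> Z \<and> N (kernel_sum \<delta> \<alpha>) \<le> K * N \<alpha>"
    using kernel[OF assms(1)] by blast
  show ?thesis
  \<comment> \<open>\<open>B + 1\<close> keeps the constant positive when
    \<open>B = 0\<close>.\<close>
  proof (intro exI[of _ "(B + 1) * K"] conjI ballI allI impI)
    show "0 < (B + 1) * K" using K assms by simp
    fix \<alpha> \<beta> assume \<alpha>: "\<alpha> \<in> Z" and \<beta>: "\<forall>e \<in> arcs G. 0 \<le> \<beta> e \<and> \<beta> e \<le> B * kernel_sum \<delta> \<alpha> e"
    note k = K(2)[OF \<alpha>] and s = scale[of "kernel_sum \<delta> \<alpha>" B]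
    have sol: "\<beta> \<in> Z \<and> N \<beta> \<le> N (\<lambda>e. B * kernel_sum \<delta> \<alpha> e)"
      by (rule solid) (use k s \<beta> assms in auto)
    then show "\<beta> \<in> Z" by simp
    have "N \<beta> \<le> B * N (kernel_sum \<delta> \<alpha>)" using sol k s assms by simp
    also have "\<dots> \<le> (B + 1) * (K * N \<alpha>)"
      using k assms N_nonneg[of "kernel_sum \<delta> \<alpha>"] by (intro mult_mono) auto
    finally show "N \<beta> \<le> (B + 1) * K * N \<alpha>" by (simp add: mult.assoc)
  qed
qed

text \<open>Edges at a common vertex have \<open>edist\<close> at most \<open>2\<close>, so the
  kernel with \<open>\<delta> = 1\<close> is at least \<open>exp (- 2)\<close> on them.\<close>

lemma sum_incident_le_kernel_sum:
  assumes \<alpha>: "\<alpha> \<in> Z" and e: "e \<in> incident_edges G v"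
  shows "(\<Sum>e' \<in> incident_edges G v. \<alpha> e') \<le> exp 2 * kernel_sum 1 \<alpha> e"
proof -
  have v: "v \<in> verts G" and e': "e \<in> arcs G" and sub: "incident_edges G v \<subseteq> arcs G"
    using e incident_in_verts by (auto simp: incident_edges_def)
  have "(\<Sum>e' \<in> incident_edges G v. \<alpha> e') \<le> (\<Sum>e' \<in> incident_edges G v. exp 2 * (exp (- 1 * edist e e') * \<alpha> e'))"
  proof (rule sum_mono)
    fix e' assume e'': "e' \<in> incident_edges G v"
    have "edist e e' \<le> 2" using edist_le_incident(1)[OF e e''] v by simp
    then have "1 * \<alpha> e' \<le> exp (2 - edist e e') * \<alpha> e'"
      using Z_nonneg[OF \<alpha>, of e'] e'' sub by (intro mult_right_mono) auto
    then show "\<alpha> e' \<le> exp 2 * (exp (- 1 * edist e e') * \<alpha> e')" by (simp add: exp_diff exp_minus field_simps)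
  qed
  also have "\<dots> = exp 2 * (\<Sum>e' \<in> incident_edges G v. exp (- 1 * edist e e') * \<alpha> e')"
    by (simp add: sum_distrib_left)
  also have "\<dots> \<le> exp 2 * kernel_sum 1 \<alpha> e" unfolding kernel_sum_def
    by (intro mult_left_mono finite_sum_le_infsum kernel_summable finite_incident v \<alpha> e' sub)
      (use Z_nonneg[OF \<alpha>] in auto)
  finally show ?thesis .
qed

text \<open>Local operations are special exponential kernels, so the axiom \<open>kernel\<close>
  covers them too. The factor \<open>2\<close> in the proof counts the ends of an edge.\<close>

lemma vertex_sum_bounded:
  assumes B: "0 \<le> B"
  shows "\<exists>K>0. \<forall>\<alpha> \<in> Z. \<forall>b. (\<forall>v \<in> verts G. norm (b v) \<le> B * (\<Sum>e \<in> incident_edges G v. \<alpha> e)) \<longrightarrow>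
    edge_norm b \<in> Z \<and> N (edge_norm b) \<le> K * N \<alpha>"
proof -
  obtain K where K: "0 < K" "\<And>\<alpha> \<beta>. \<alpha> \<in> Z \<Longrightarrow>
     (\<forall>e \<in> arcs G. 0 \<le> \<beta> e \<and> \<beta> e \<le> (2 * B * exp 2) * kernel_sum 1 \<alpha> e) \<Longrightarrow> \<beta> \<in> Z \<and> N \<beta> \<le> K * N \<alpha>"
    using dominated[of 1 "2 * B * exp 2"] B by auto
  show ?thesis
  proof (intro exI[of _ K] conjI[OF K(1)] ballI allI impI)
    fix \<alpha> and b :: "'v \<Rightarrow> complex"
    assume \<alpha>: "\<alpha> \<in> Z" and b: "\<forall>v \<in> verts G. norm (b v) \<le> B * (\<Sum>e \<in> incident_edges G v. \<alpha> e)"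
    show "edge_norm b \<in> Z \<and> N (edge_norm b) \<le> K * N \<alpha>"
    proof (rule K(2)[OF \<alpha>], intro ballI conjI edge_norm_nonneg)
      fix e assume e: "e \<in> arcs G"
      have "norm (b v) \<le> B * (exp 2 * kernel_sum 1 \<alpha> e)" if "e \<in> incident_edges G v" for v
        using b sum_incident_le_kernel_sum[OF \<alpha> that] incident_in_verts[OF that] B
        by (meson mult_left_mono order_trans)
      from this[of "tail G e"] this[of "head G e"] e
      show "edge_norm b e \<le> 2 * B * exp 2 * kernel_sum 1 \<alpha> e"
        by (auto simp: edge_norm_def incident_edges_def)
    qed
  qed
qed

lemma vertex_op_bounded:
  "\<exists>K>0. \<forall>a. edge_norm a \<in> Z \<longrightarrow> edge_norm (vertex_op \<mu> a) \<in> Z \<and> N (edge_norm (vertex_op \<mu> a)) \<le> K * N (edge_norm a)"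
proof -
  obtain K where "0 < K" "\<forall>\<alpha> \<in> Z. \<forall>b. (\<forall>v \<in> verts G. norm (b v) \<le> (1 + norm \<mu>) * (\<Sum>e \<in> incident_edges G v. \<alpha> e)) \<longrightarrow>
    edge_norm b \<in> Z \<and> N (edge_norm b) \<le> K * N \<alpha>"
    using vertex_sum_bounded[of "1 + norm \<mu>"] by auto
  then show ?thesis using norm_vertex_op_le by (intro exI[of _ K]) blast
qed

end

section \<open>The Green kernel: uniqueness, solutions and construction\<close>

lemma summable_on_diff_complex:
  fixes f g :: "'a \<Rightarrow> complex"
  assumes "f summable_on A" "g summable_on A"
  shows "(\<lambda>x. f x - g x) summable_on A" "infsum (\<lambda>x. f x - g x) A = infsum f A - infsum g A"
proof -
  have g: "(\<lambda>x. - g x) summable_on A" using assms(2) summable_on_uminus[of g A] by simp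
  show "(\<lambda>x. f x - g x) summable_on A" using summable_on_add[OF assms(1) g] by simp
  show "infsum (\<lambda>x. f x - g x) A = infsum f A - infsum g A"
    using infsum_add[OF assms(1) g] infsum_uminus[of g A] by simp
qed

context edge_sequence_space
begin

lemma incident_arcE:
  assumes "v \<in> verts G"
  obtains e where "e \<in> incident_edges G v" "e \<in> arcs G"
  using incident_edges_nonempty[OF assms] by (auto simp: incident_edges_def)

lemma exp_vdist_le_edist:
  assumes "e \<in> incident_edges G v" "e' \<in> incident_edges G w" "0 < \<delta>"
  shows "exp (- \<delta> * vdist v w) \<le> exp (2 * \<delta>) * exp (- \<delta> * edist e e')"
proof -
  have "\<delta> * edist e e' \<le> \<delta> * (vdist v w + 2)"
    using edist_le_incident(1)[OF assms(1,2)] assms(3) by (intro mult_left_mono) auto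
  then show ?thesis by (simp add: algebra_simps flip: exp_add)
qed

lemma self_incident: "e \<in> arcs G \<Longrightarrow> e \<in> incident_edges G (tail G e)"
  "e \<in> arcs G \<Longrightarrow> e \<in> incident_edges G (head G e)"
  by (auto simp: incident_edges_def)

text \<open>Summation by parts over the pairs of a vertex and an incident edge: the weighted vertex operator
  is symmetric.\<close>

lemma green_kernel_injective:
  assumes g: "green_kernel \<mu> g" and a: "edge_norm a \<in> Z"
    and zero: "\<And>v. v \<in> verts G \<Longrightarrow> vertex_op \<mu> a v = 0" and x: "x \<in> verts G"
  shows "a x = 0"
proof -
  obtain K \<delta> where K: "0 < K" "0 < \<delta>"
    "\<And>x y. x \<in> verts G \<Longrightarrow> y \<in> verts G \<Longrightarrow> norm (g y x) \<le> K * exp (- \<delta> * vdist x y)"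
    and g1: "\<And>x y. x \<in> verts G \<Longrightarrow> y \<in> verts G \<Longrightarrow> vertex_op \<mu> (g y) x = (if x = y then 1 else 0)"
    using g unfolding green_kernel_def by blast
  obtain e0 where e0: "e0 \<in> incident_edges G x" "e0 \<in> arcs G" using incident_arcE[OF x] .
  obtain D where D: "0 < D" "\<And>e. e \<in> arcs G \<Longrightarrow> c e \<le> D * exp (\<delta> / 2 * edist e0 e) * c e0"
    using conductivity_ratio[of "\<delta> / 2"] K(2) e0 by (auto simp: mult.assoc)
  define h where "h = g x"
  have h: "norm (h v) \<le> K * (exp (2 * \<delta>) * exp (- \<delta> * edist e0 e))" if e: "e \<in> incident_edges G v" for v e
  proof -
    have "norm (h v) \<le> K * exp (- \<delta> * vdist x v)"
      unfolding h_def vdist_commute[of x v] by (rule K(3)[OF incident_in_verts[OF e] x])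
    also have "\<dots> \<le> K * (exp (2 * \<delta>) * exp (- \<delta> * edist e0 e))"
      by (intro mult_left_mono exp_vdist_le_edist e0 e K) (use K in auto)
    finally show ?thesis .
  qed
  \<comment> \<open>Half of the decay of the column absorbs the growth of \<open>c\<close>; the
    other half makes the majorant summable together with \<open>edge_norm a\<close>, by the axiom
    \<open>kernel\<close>. With this majorant the double sums may be rearranged.\<close>
  define B where "B e = D * c e0 * K * exp (2 * \<delta>) * (1 + norm \<mu>) * (exp (- (\<delta> / 2) * edist e0 e) * edge_norm a e)" for e
  have B: "B summable_on arcs G"
    unfolding B_def using K(2) by (intro summable_on_cmult_right kernel_summable a e0) auto
  have bound: "norm (of_real (c e) * h v * b) \<le> B e"
    if e: "e \<in> incident_edges G v" and b: "norm b \<le> (1 + norm \<mu>) * edge_norm a e" for v e b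
  proof -
    have e': "e \<in> arcs G" using e by (simp add: incident_edges_def)
    have "norm (of_real (c e) * h v * b) = c e * norm (h v) * norm b"
      using conductivity_pos[OF e'] by (simp add: norm_mult)
    also have "\<dots> \<le> (D * exp (\<delta> / 2 * edist e0 e) * c e0) * (K * (exp (2 * \<delta>) * exp (- \<delta> * edist e0 e)))
        * ((1 + norm \<mu>) * edge_norm a e)"
      using D(1) K(1) conductivity_pos[OF e'] conductivity_pos[OF e0(2)]
      by (intro mult_mono D(2) e' h[OF e] b) (auto intro!: mult_nonneg_nonneg simp: edge_norm_nonneg)
    also have "\<dots> = D * c e0 * K * exp (2 * \<delta>) * (1 + norm \<mu>)
        * ((exp (\<delta> / 2 * edist e0 e) * exp (- \<delta> * edist e0 e)) * edge_norm a e)"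
      by (simp only: ac_simps)
    also have "exp (\<delta> / 2 * edist e0 e) * exp (- \<delta> * edist e0 e) = exp (- (\<delta> / 2) * edist e0 e)"
      by (simp add: field_simps flip: exp_add)
    finally show ?thesis unfolding B_def .
  qed
  define T where "T = Sigma (verts G) (incident_edges G)"
  have T: "(v, e) \<in> T \<longleftrightarrow> e \<in> incident_edges G v" for v e
    using incident_in_verts by (auto simp: T_def)
  have BT: "(\<lambda>(v, e). B e) summable_on T"
  proof -
    have "(\<lambda>(v, e). B e) summable_on (\<lambda>e. (tail G e, e)) ` arcs G"
      "(\<lambda>(v, e). B e) summable_on (\<lambda>e. (head G e, e)) ` arcs G"
      using B by (subst summable_on_reindex; simp add: inj_on_def o_def)+
    moreover have "T = (\<lambda>e. (tail G e, e)) ` arcs G \<union> (\<lambda>e. (head G e, e)) ` arcs G"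
      unfolding T_def by (auto simp: incident_edges_def)
    ultimately show ?thesis using summable_on_union by auto
  qed
  define F where "F = (\<lambda>(v, e). of_real (c e) * h v * (a (other e v) - \<mu> * a v))"
  define F1 where "F1 = (\<lambda>(v, e). of_real (c e) * h v * a (other e v))"
  define F2 where "F2 = (\<lambda>(v, e). of_real (c e) * h v * (\<mu> * a v))"
  define F3 where "F3 = (\<lambda>(v, e). of_real (c e) * a v * h (other e v))"
  have le1: "norm (a (other e v)) \<le> (1 + norm \<mu>) * edge_norm a e"
    and le2: "norm (\<mu> * a v) \<le> (1 + norm \<mu>) * edge_norm a e" if e: "e \<in> incident_edges G v" for v e
  proof -
    have "norm (a (other e v)) \<le> 1 * edge_norm a e" using norm_le_edge_norm(2)[OF e] by simp
    also have "\<dots> \<le> (1 + norm \<mu>) * edge_norm a e" by (intro mult_right_mono) (auto simp: edge_norm_nonneg)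
    finally show "norm (a (other e v)) \<le> (1 + norm \<mu>) * edge_norm a e" .
    show "norm (\<mu> * a v) \<le> (1 + norm \<mu>) * edge_norm a e"
      unfolding norm_mult by (intro mult_mono norm_le_edge_norm(1)[OF e]) auto
  qed
  have s1: "F1 summable_on T"
    by (rule abs_summable_complexI(1)[OF BT]) (use T bound le1 in \<open>auto simp: F1_def\<close>)
  have s2: "F2 summable_on T"
    by (rule abs_summable_complexI(1)[OF BT]) (use T bound le2 in \<open>auto simp: F2_def\<close>)
  \<comment> \<open>The involution that passes to the other end of the edge moves
    \<open>other\<close> from \<open>a\<close> to \<open>h\<close>. This is where the symmetry of
    the weighted operator lies.\<close>
  define \<sigma> where "\<sigma> = (\<lambda>(v, e). (other e v, e))"
  have \<sigma>: "bij_betw \<sigma> T T"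
    by (rule bij_betw_byWitness[where f'=\<sigma>])
      (auto simp: \<sigma>_def T other_other intro: other_incident)
  have F3\<sigma>: "F1 (\<sigma> p) = F3 p" if "p \<in> T" for p
    using that by (auto simp: F1_def F3_def \<sigma>_def T other_other split: prod.splits)
  have s3: "F3 summable_on T"
    using summable_on_reindex_bij_betw[OF \<sigma>, of F1] s1 summable_on_cong[of T "\<lambda>p. F1 (\<sigma> p)" F3] F3\<sigma> by auto
  have i13: "infsum F1 T = infsum F3 T"
    using infsum_reindex_bij_betw[OF \<sigma>, of F1] infsum_cong[of T "\<lambda>p. F1 (\<sigma> p)" F3] F3\<sigma> by auto
  \<comment> \<open>Summed at each vertex over its edges, \<open>F1 - F2\<close> is the weighted
    operator applied to \<open>a\<close>, times \<open>h v\<close>, and so vanishes.\<close>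
  have "infsum (\<lambda>p. F1 p - F2 p) T = (\<Sum>\<^sub>\<infinity>v \<in> verts G. \<Sum>\<^sub>\<infinity>e \<in> incident_edges G v. F1 (v, e) - F2 (v, e))"
    unfolding T_def
    by (rule infsum_Sigma_banach[OF summable_on_diff_complex(1)[OF s1 s2, unfolded T_def], symmetric])
  also have "\<dots> = (\<Sum>\<^sub>\<infinity>v \<in> verts G. 0)"
  proof (rule infsum_cong)
    fix v assume v: "v \<in> verts G"
    have "(\<Sum>e \<in> incident_edges G v. F1 (v, e) - F2 (v, e))
        = h v * (\<Sum>e \<in> incident_edges G v. of_real (c e) * (a (other e v) - \<mu> * a v))"
      by (simp add: F1_def F2_def sum_distrib_left algebra_simps)
    also have "\<dots> = 0" using weight_vertex_op[OF v, of \<mu> a] zero[OF v] by simp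
    finally show "(\<Sum>\<^sub>\<infinity>e \<in> incident_edges G v. F1 (v, e) - F2 (v, e)) = 0"
      using finite_incident[OF v] by simp
  qed
  finally have z1: "infsum (\<lambda>p. F1 p - F2 p) T = 0" by simp
  \<comment> \<open>In \<open>F3 - F2\<close> the operator acts on the column \<open>h\<close>, so
    only the vertex \<open>x\<close> contributes.\<close>
  have "infsum (\<lambda>p. F3 p - F2 p) T = (\<Sum>\<^sub>\<infinity>v \<in> verts G. \<Sum>\<^sub>\<infinity>e \<in> incident_edges G v. F3 (v, e) - F2 (v, e))"
    unfolding T_def
    by (rule infsum_Sigma_banach[OF summable_on_diff_complex(1)[OF s3 s2, unfolded T_def], symmetric])
  also have "\<dots> = (\<Sum>\<^sub>\<infinity>v \<in> verts G. if v = x then of_real (weight x) * a x else 0)"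
  proof (rule infsum_cong)
    fix v assume v: "v \<in> verts G"
    have "(\<Sum>e \<in> incident_edges G v. F3 (v, e) - F2 (v, e))
        = a v * (\<Sum>e \<in> incident_edges G v. of_real (c e) * (h (other e v) - \<mu> * h v))"
      by (simp add: F3_def F2_def sum_distrib_left algebra_simps)
    also have "\<dots> = (if v = x then of_real (weight x) * a x else 0)"
      using weight_vertex_op[OF v, of \<mu> h] g1[OF v x] by (auto simp: h_def simp flip: weight_vertex_op)
    finally show "(\<Sum>\<^sub>\<infinity>e \<in> incident_edges G v. F3 (v, e) - F2 (v, e)) = (if v = x then of_real (weight x) * a x else 0)"
      using finite_incident[OF v] by simp
  qed
  also have "\<dots> = (\<Sum>\<^sub>\<infinity>v \<in> {x}. if v = x then of_real (weight x) * a x else 0)"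
    by (rule infsum_cong_neutral) (use x in auto)
  also have "\<dots> = of_real (weight x) * a x" by simp
  finally have "infsum (\<lambda>p. F3 p - F2 p) T = of_real (weight x) * a x" .
  then have "of_real (weight x) * a x = 0"
    using z1 i13 summable_on_diff_complex(2)[OF s1 s2] summable_on_diff_complex(2)[OF s3 s2] by simp
  then show ?thesis using weight_pos[OF x] by simp
qed


text \<open>The right-hand side is given by contributions of edge ends because sources are integrals
  over edges, bounded by one entry \<nu> per edge. The solution superposes the columns at both ends
  of all edges, and \<open>dominated\<close> estimates it.\<close>

lemma green_kernel_solution:
  assumes g: "green_kernel \<mu> g"
  shows "\<exists>K>0. \<forall>\<nu> \<in> Z. \<forall>q0 q1. (\<forall>e \<in> arcs G. norm (q0 e) \<le> \<nu> e \<and> norm (q1 e) \<le> \<nu> e) \<longrightarrow>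
    (\<exists>a. edge_norm a \<in> Z \<and> N (edge_norm a) \<le> K * N \<nu> \<and>
      (\<forall>v \<in> verts G. vertex_op \<mu> a v = (\<Sum>e \<in> incident_edges G v. if v = tail G e then q0 e else q1 e)))"
proof -
  obtain M \<delta> where M: "0 < M" "0 < \<delta>"
    "\<And>x y. x \<in> verts G \<Longrightarrow> y \<in> verts G \<Longrightarrow> norm (g y x) \<le> M * exp (- \<delta> * vdist x y)"
    and g1: "\<And>x y. x \<in> verts G \<Longrightarrow> y \<in> verts G \<Longrightarrow> vertex_op \<mu> (g y) x = (if x = y then 1 else 0)"
    using g unfolding green_kernel_def by blast
  define B where "B = 2 * M * exp (2 * \<delta>)"
  have B: "0 < B" using M by (simp add: B_def)
  obtain K where K: "0 < K" "\<And>\<alpha> \<beta>. \<alpha> \<in> Z \<Longrightarrow>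
     (\<forall>e \<in> arcs G. 0 \<le> \<beta> e \<and> \<beta> e \<le> (2 * B) * kernel_sum \<delta> \<alpha> e) \<Longrightarrow> \<beta> \<in> Z \<and> N \<beta> \<le> K * N \<alpha>"
    using dominated[of \<delta> "2 * B"] B M by auto
  show ?thesis
  proof (intro exI[of _ K] conjI[OF K(1)] ballI allI impI)
    fix \<nu> and q0 q1 :: "'e \<Rightarrow> complex"
    assume \<nu>: "\<nu> \<in> Z" and q: "\<forall>e \<in> arcs G. norm (q0 e) \<le> \<nu> e \<and> norm (q1 e) \<le> \<nu> e"
    define h where "h e v = q0 e * g (tail G e) v + q1 e * g (head G e) v" for e v
    define a where "a v = (\<Sum>\<^sub>\<infinity>e \<in> arcs G. h e v)" for v
    have gb: "norm (g y v) \<le> M * (exp (2 * \<delta>) * exp (- \<delta> * edist e0 e))"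
      if "e0 \<in> incident_edges G v" "e \<in> incident_edges G y" for y v e e0
    proof -
      have "norm (g y v) \<le> M * exp (- \<delta> * vdist v y)"
        by (rule M(3)) (use that incident_in_verts in auto)
      also have "\<dots> \<le> M * (exp (2 * \<delta>) * exp (- \<delta> * edist e0 e))"
        by (intro mult_left_mono exp_vdist_le_edist that M) (use M in auto)
      finally show ?thesis .
    qed
    have hb: "norm (h e v) \<le> B * (exp (- \<delta> * edist e0 e) * \<nu> e)"
      if e0: "e0 \<in> incident_edges G v" and e: "e \<in> arcs G" for e0 e v
    proof -
      have "norm (h e v) \<le> norm (q0 e) * norm (g (tail G e) v) + norm (q1 e) * norm (g (head G e) v)"
        unfolding h_def by (rule order_trans[OF norm_triangle_ineq]) (simp add: norm_mult)
      also have "\<dots> \<le> \<nu> e * (M * (exp (2 * \<delta>) * exp (- \<delta> * edist e0 e))) + \<nu> e * (M * (exp (2 * \<delta>) * exp (- \<delta> * edist e0 e)))"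
        using q e Z_nonneg[OF \<nu> e] by (intro add_mono mult_mono gb e0 self_incident) auto
      also have "\<dots> = B * (exp (- \<delta> * edist e0 e) * \<nu> e)" by (simp add: B_def)
      finally show ?thesis .
    qed
    have ks: "(\<lambda>e. B * (exp (- \<delta> * edist e0 e) * \<nu> e)) summable_on arcs G" if "e0 \<in> arcs G" for e0
      by (intro summable_on_cmult_right kernel_summable M \<nu> that)
    have hs: "((\<lambda>e. h e v) has_sum a v) (arcs G)" if v: "v \<in> verts G" for v
    proof -
      obtain e0 where e0: "e0 \<in> incident_edges G v" "e0 \<in> arcs G" using incident_arcE[OF v] .
      have "(\<lambda>e. h e v) summable_on arcs G"
        by (rule abs_summable_complexI(1)[OF ks[OF e0(2)]]) (use hb[OF e0(1)] in auto)
      then show ?thesis unfolding a_def by (rule has_sum_infsum)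
    qed
    have ab: "norm (a v) \<le> B * kernel_sum \<delta> \<nu> e0" if e0: "e0 \<in> incident_edges G v" for v e0
    proof -
      have e0': "e0 \<in> arcs G" using e0 by (simp add: incident_edges_def)
      have "norm (a v) \<le> (\<Sum>\<^sub>\<infinity>e \<in> arcs G. B * (exp (- \<delta> * edist e0 e) * \<nu> e))"
        unfolding a_def by (rule norm_infsum_le_real[OF ks[OF e0']]) (use hb[OF e0] in auto)
      also have "\<dots> = B * kernel_sum \<delta> \<nu> e0"
        unfolding kernel_sum_def by (rule infsum_cmult_right) (use kernel_summable[OF M(2) \<nu> e0'] in simp)
      finally show ?thesis .
    qed
    have "edge_norm a \<in> Z \<and> N (edge_norm a) \<le> K * N \<nu>"
    proof (rule K(2)[OF \<nu>], intro ballI conjI edge_norm_nonneg)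
      fix e assume e: "e \<in> arcs G"
      show "edge_norm a e \<le> 2 * B * kernel_sum \<delta> \<nu> e"
        using ab[OF self_incident(1)[OF e]] ab[OF self_incident(2)[OF e]] by (simp add: edge_norm_def)
    qed
    moreover have "vertex_op \<mu> a v = (\<Sum>e \<in> incident_edges G v. if v = tail G e then q0 e else q1 e)"
      if v: "v \<in> verts G" for v
    proof -
      \<comment> \<open>\<open>vertex_op\<close> involves finitely many values, so it may be applied
        to the series termwise.\<close>
      have "((\<lambda>e. \<Sum>e' \<in> incident_edges G v. of_real (c e') * (h e (other e' v) - \<mu> * h e v))
          has_sum (\<Sum>e' \<in> incident_edges G v. of_real (c e') * (a (other e' v) - \<mu> * a v))) (arcs G)"
      proof (rule has_sum_finite_sum[OF finite_incident[OF v]])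
        fix e' assume e': "e' \<in> incident_edges G v"
        then have o: "other e' v \<in> verts G" by (simp add: incident_edges_def other_in_verts)
        have "((\<lambda>e. h e (other e' v) + (- \<mu>) * h e v) has_sum (a (other e' v) + (- \<mu>) * a v)) (arcs G)"
          by (intro has_sum_add has_sum_cmult_right hs v o)
        from has_sum_cmult_right[OF this, of "of_real (c e')"]
        show "((\<lambda>e. of_real (c e') * (h e (other e' v) - \<mu> * h e v))
          has_sum of_real (c e') * (a (other e' v) - \<mu> * a v)) (arcs G)" by simp
      qed
      \<comment> \<open>The operator turns columns into unit vectors, so \<open>e\<close>
        contributes only at its two ends, which are distinct.\<close>
      moreover have "(\<Sum>e' \<in> incident_edges G v. of_real (c e') * (h e (other e' v) - \<mu> * h e v))
          = of_real (weight v) * (if e \<in> incident_edges G v then if v = tail G e then q0 e else q1 e else 0)"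
        if e: "e \<in> arcs G" for e
      proof -
        have "(\<Sum>e' \<in> incident_edges G v. of_real (c e') * (h e (other e' v) - \<mu> * h e v))
          = q0 e * (\<Sum>e' \<in> incident_edges G v. of_real (c e') * (g (tail G e) (other e' v) - \<mu> * g (tail G e) v))
          + q1 e * (\<Sum>e' \<in> incident_edges G v. of_real (c e') * (g (head G e) (other e' v) - \<mu> * g (head G e) v))"
          by (simp add: h_def sum_distrib_left sum.distrib[symmetric] algebra_simps)
        also have "\<dots> = of_real (weight v) * (q0 e * (if v = tail G e then 1 else 0) + q1 e * (if v = head G e then 1 else 0))"
          using g1[OF v tail_in_verts[OF e]] g1[OF v head_in_verts[OF e]]
          by (simp add: weight_vertex_op[OF v, symmetric] distrib_left)
        also have "q0 e * (if v = tail G e then 1 else 0) + q1 e * (if v = head G e then 1 else 0)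
          = (if e \<in> incident_edges G v then if v = tail G e then q0 e else q1 e else 0)"
          using no_loops[OF e] e by (auto simp: incident_edges_def)
        finally show ?thesis .
      qed
      ultimately have "((\<lambda>e. of_real (weight v) * (if e \<in> incident_edges G v then if v = tail G e then q0 e else q1 e else 0))
          has_sum (\<Sum>e' \<in> incident_edges G v. of_real (c e') * (a (other e' v) - \<mu> * a v))) (arcs G)"
        by (subst (asm) has_sum_cong) auto
      then have "infsum (\<lambda>e. of_real (weight v) * (if e \<in> incident_edges G v then if v = tail G e then q0 e else q1 e else 0)) (arcs G)
          = of_real (weight v) * vertex_op \<mu> a v"
        unfolding weight_vertex_op[OF v] by (rule infsumI)
      moreover have "infsum (\<lambda>e. of_real (weight v) * (if e \<in> incident_edges G v then if v = tail G e then q0 e else q1 e else 0)) (arcs G)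
          = infsum (\<lambda>e. of_real (weight v) * (if v = tail G e then q0 e else q1 e)) (incident_edges G v)"
        by (rule infsum_cong_neutral) (auto simp: incident_edges_def)
      ultimately show ?thesis
        using weight_pos[OF v] finite_incident[OF v] by (simp flip: sum_distrib_left)
    qed
    ultimately show "\<exists>a. edge_norm a \<in> Z \<and> N (edge_norm a) \<le> K * N \<nu> \<and>
      (\<forall>v \<in> verts G. vertex_op \<mu> a v = (\<Sum>e \<in> incident_edges G v. if v = tail G e then q0 e else q1 e))"
      by blast
  qed
qed

lemma abs_one_minus_exp_le: "\<bar>t\<bar> \<le> \<epsilon> \<Longrightarrow> \<bar>1 - exp t\<bar> \<le> exp \<epsilon> - 1" for t \<epsilon> :: real
proof -
  assume t: "\<bar>t\<bar> \<le> \<epsilon>"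
  have "exp (- \<epsilon>) \<le> exp t" "exp t \<le> exp \<epsilon>" using t by auto
  moreover have "1 - exp (- \<epsilon>) \<le> exp \<epsilon> - 1"
    using add_mono[OF exp_ge_add_one_self[of \<epsilon>] exp_ge_add_one_self[of "- \<epsilon>"]] by simp
  ultimately show ?thesis by linarith
qed

text \<open>The Combes--Thomas argument: conjugation with the exponential weight \<open>\<rho>\<close>, cut off at \<open>R\<close> in
  order to stay in the space, changes the vertex operator only by a small amount.\<close>

lemma combes_thomas:
  assumes lower: "\<And>a. edge_norm a \<in> Z \<Longrightarrow> N (edge_norm a) \<le> A * N (edge_norm (vertex_op \<mu> a))"
    and solve: "\<And>y. y \<in> verts G \<Longrightarrow>
      \<exists>g. edge_norm g \<in> Z \<and> (\<forall>x \<in> verts G. vertex_op \<mu> g x = (if x = y then 1 else 0))"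
  shows "\<exists>g. green_kernel \<mu> g"
proof -
  obtain g where g: "\<And>y. y \<in> verts G \<Longrightarrow> edge_norm (g y) \<in> Z"
    "\<And>x y. y \<in> verts G \<Longrightarrow> x \<in> verts G \<Longrightarrow> vertex_op \<mu> (g y) x = (if x = y then 1 else 0)"
    using solve by metis
  obtain K where K: "0 < K" "\<And>\<alpha> b. \<alpha> \<in> Z \<Longrightarrow>
    (\<forall>v \<in> verts G. norm (b v) \<le> 1 * (\<Sum>e \<in> incident_edges G v. \<alpha> e)) \<Longrightarrow>
    edge_norm b \<in> Z \<and> N (edge_norm b) \<le> K * N \<alpha>"
    using vertex_sum_bounded[of 1] by auto
  \<comment> \<open>\<open>K\<close> comes from \<open>vertex_sum_bounded\<close> and
    \<open>4\<close> from the axiom \<open>add\<close>. With \<open>\<theta> = 1 / (2 * L)\<close>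
    the commutator term has relative size \<open>1/2\<close> and can be absorbed on the left;
    \<epsilon> is the exponent with \<open>exp \<epsilon> - 1 = \<theta>\<close>.\<close>
  define L where "L = (\<bar>A\<bar> + 1) * K * 4"
  have L: "0 < L" using K by (simp add: L_def)
  define \<theta> where "\<theta> = 1 / (2 * L)"
  define \<epsilon> where "\<epsilon> = ln (1 + \<theta>)"
  have \<theta>: "0 < \<theta>" "L * \<theta> = 1 / 2" using L by (auto simp: \<theta>_def)
  have \<epsilon>: "0 < \<epsilon>" "exp \<epsilon> = 1 + \<theta>" using \<theta> by (auto simp: \<epsilon>_def)
  \<comment> \<open>Comparing unit vectors near \<open>x\<close> and \<open>y\<close> uses up half
    of the decay rate \<epsilon>.\<close>
  obtain U where U: "0 < U" "\<And>e e'. e \<in> arcs G \<Longrightarrow> e' \<in> arcs G \<Longrightarrow>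
      N (indicator {e'}) \<le> U * exp (\<epsilon> / 2 * edist e e') * N (indicator {e})"
    using unit_ratio[of "\<epsilon> / 2"] \<epsilon> by auto
  have main: "norm (g y x) \<le> (2 * L * U * exp \<epsilon>) * exp (- (\<epsilon> / 2) * vdist x y)"
    if x: "x \<in> verts G" and y: "y \<in> verts G" for x y
  proof -
    obtain ex ey where ex: "ex \<in> incident_edges G x" "ex \<in> arcs G"
      and ey: "ey \<in> incident_edges G y" "ey \<in> arcs G"
      using incident_arcE[OF x] incident_arcE[OF y] by metis
    \<comment> \<open>The cut-off keeps the weight bounded, hence \<open>b\<close> in the space, and
      is placed where the weight still has its full value at \<open>x\<close>.\<close>
    define R where "R = vdist y x"
    define r where "r v = min (vdist y v) R" for v
    define \<rho> where "\<rho> v = exp (\<epsilon> * r v)" for v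
    have r0: "0 \<le> r v" "r v \<le> R" for v using vdist_nonneg by (auto simp: r_def R_def)
    have \<rho>0: "0 < \<rho> v" "\<rho> v \<le> exp (\<epsilon> * R)" for v
      using r0[of v] \<epsilon> by (auto simp: \<rho>_def)
    define b where "b v = of_real (\<rho> v) * g y v" for v
    have "edge_norm b e \<le> exp (\<epsilon> * R) * edge_norm (g y) e" for e
      using \<rho>0 by (auto simp: edge_norm_def b_def norm_mult distrib_left less_imp_le intro!: add_mono mult_right_mono)
    then have bZ: "edge_norm b \<in> Z"
      using solid[of "\<lambda>e. exp (\<epsilon> * R) * edge_norm (g y) e" "edge_norm b"] scale[OF g(1)[OF y], of "exp (\<epsilon> * R)"]
        edge_norm_nonneg[of b] by auto
    \<comment> \<open>A majorant for \<open>vertex_op \<mu> b\<close>: the unit vector stems from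
      the equation of the column, the multiple of \<open>edge_norm b\<close> from the commutator
      with the weight.\<close>
    define \<alpha> where "\<alpha> e = indicator {ey} e + \<theta> * edge_norm b e" for e
    have \<alpha>Z: "\<alpha> \<in> Z" and N\<alpha>: "N \<alpha> \<le> 4 * (N (indicator {ey}) + \<theta> * N (edge_norm b))"
      using add[of "indicator {ey}" "\<lambda>e. \<theta> * edge_norm b e"] unit[OF ey(2)] scale[OF bZ, of \<theta>] \<theta>(1)
      unfolding \<alpha>_def by auto
    have comm: "norm (vertex_op \<mu> b v) \<le> 1 * (\<Sum>e \<in> incident_edges G v. \<alpha> e)" if v: "v \<in> verts G" for v
    proof -
      have "(\<Sum>e \<in> incident_edges G v. of_real (c e) * (b (other e v) - \<mu> * b v))
          = of_real (\<rho> v) * (\<Sum>e \<in> incident_edges G v. of_real (c e) * (g y (other e v) - \<mu> * g y v))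
          + (\<Sum>e \<in> incident_edges G v. of_real (c e) * (of_real (1 - \<rho> v / \<rho> (other e v)) * b (other e v)))"
        unfolding sum_distrib_left sum.distrib[symmetric]
        by (rule sum.cong) (use \<rho>0(1) in \<open>auto simp: b_def field_simps less_imp_neq[symmetric]\<close>)
      then have "vertex_op \<mu> b v = of_real (\<rho> v) * vertex_op \<mu> (g y) v
          + (\<Sum>e \<in> incident_edges G v. of_real (c e) * (of_real (1 - \<rho> v / \<rho> (other e v)) * b (other e v))) / of_real (weight v)"
        by (simp add: vertex_op_def add_divide_distrib)
      then have "norm (vertex_op \<mu> b v) \<le> norm (of_real (\<rho> v) * vertex_op \<mu> (g y) v)
          + norm ((\<Sum>e \<in> incident_edges G v. of_real (c e) * (of_real (1 - \<rho> v / \<rho> (other e v)) * b (other e v))) / of_real (weight v))"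
        by (simp only: norm_triangle_ineq)
      also have "\<dots> \<le> (\<Sum>e \<in> incident_edges G v. indicator {ey} e) + (\<Sum>e \<in> incident_edges G v. \<theta> * edge_norm b e)"
      proof (rule add_mono)
        show "norm (of_real (\<rho> v) * vertex_op \<mu> (g y) v) \<le> (\<Sum>e \<in> incident_edges G v. indicator {ey} e)"
        proof (cases "v = y")
          case True
          have "norm (of_real (\<rho> v) * vertex_op \<mu> (g y) v) = indicator {ey} ey"
            using True g(2)[OF y y] y vdist_nonneg by (simp add: \<rho>_def r_def R_def)
          also have "\<dots> \<le> (\<Sum>e \<in> incident_edges G v. indicator {ey} e)"
            by (rule member_le_sum) (use True ey v in auto)
          finally show ?thesis .
        next
          case False
          then show ?thesis using g(2)[OF y v] by (simp add: sum_nonneg)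
        qed
        have "norm ((\<Sum>e \<in> incident_edges G v. of_real (c e) * (of_real (1 - \<rho> v / \<rho> (other e v)) * b (other e v))) / of_real (weight v))
          \<le> (\<Sum>e \<in> incident_edges G v. norm (of_real (1 - \<rho> v / \<rho> (other e v)) * b (other e v)))"
          by (rule norm_vertex_sum_le[OF v])
        also have "\<dots> \<le> (\<Sum>e \<in> incident_edges G v. \<theta> * edge_norm b e)"
        proof (rule sum_mono)
          fix e assume e: "e \<in> incident_edges G v"
          have o: "other e v \<in> verts G" using e by (simp add: incident_edges_def other_in_verts)
          \<comment> \<open>The exponent of the weight changes by at most \<epsilon> across an edge,
            so the quotient of the weights differs from \<open>1\<close> by at most
            \<theta>.\<close>
          have "vdist y v \<le> vdist y (other e v) + 1" "vdist y (other e v) \<le> vdist y v + 1"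
            using vdist_triangle[OF y o v] vdist_triangle[OF y v o] vdist_incident(3)[OF e]
            by (auto simp: vdist_commute)
          then have "\<bar>r v - r (other e v)\<bar> \<le> 1" by (auto simp: r_def min_def)
          then have "\<bar>\<epsilon> * (r v - r (other e v))\<bar> \<le> \<epsilon>" using \<epsilon>(1) by (simp add: abs_mult)
          then have "\<bar>1 - exp (\<epsilon> * (r v - r (other e v)))\<bar> \<le> \<theta>"
            using abs_one_minus_exp_le \<epsilon>(2) by fastforce
          then have "\<bar>1 - \<rho> v / \<rho> (other e v)\<bar> \<le> \<theta>" by (simp add: \<rho>_def right_diff_distrib exp_diff)
          then show "norm (of_real (1 - \<rho> v / \<rho> (other e v)) * b (other e v)) \<le> \<theta> * edge_norm b e"
            unfolding norm_mult norm_of_real by (intro mult_mono norm_le_edge_norm(2)[OF e]) (use \<theta> in auto)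
        qed
        finally show "norm ((\<Sum>e \<in> incident_edges G v. of_real (c e) * (of_real (1 - \<rho> v / \<rho> (other e v)) * b (other e v))) / of_real (weight v))
          \<le> (\<Sum>e \<in> incident_edges G v. \<theta> * edge_norm b e)" .
      qed
      finally show ?thesis by (simp add: \<alpha>_def sum.distrib)
    qed
    have Qb: "edge_norm (vertex_op \<mu> b) \<in> Z" "N (edge_norm (vertex_op \<mu> b)) \<le> K * N \<alpha>"
      using K(2)[OF \<alpha>Z, of "vertex_op \<mu> b"] comm by auto
    \<comment> \<open>The constants in this estimate are independent of the cut-off
      \<open>R\<close>, and therefore of \<open>x\<close> and \<open>y\<close>.\<close>
    have "N (edge_norm b) \<le> A * N (edge_norm (vertex_op \<mu> b))" by (rule lower[OF bZ])
    also have "\<dots> \<le> (\<bar>A\<bar> + 1) * (K * (4 * (N (indicator {ey}) + \<theta> * N (edge_norm b))))"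
    proof (rule mult_mono)
      show "N (edge_norm (vertex_op \<mu> b)) \<le> K * (4 * (N (indicator {ey}) + \<theta> * N (edge_norm b)))"
        by (rule order_trans[OF Qb(2) mult_left_mono[OF N\<alpha>]]) (use K in simp)
    qed (use N_nonneg[OF Qb(1)] in auto)
    also have "\<dots> = L * N (indicator {ey}) + (L * \<theta>) * N (edge_norm b)"
      by (simp add: L_def algebra_simps)
    finally have n: "N (edge_norm b) \<le> 2 * L * N (indicator {ey})" unfolding \<theta>(2) by simp
    \<comment> \<open>The value at \<open>x\<close> is recovered from the norm through the unit
      vector of one edge at \<open>x\<close>.\<close>
    have "norm (b x) * N (indicator {ex}) = N (\<lambda>e. norm (b x) * indicator {ex} e)"
      using scale[of "indicator {ex}" "norm (b x)"] unit[OF ex(2)] by simp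
    also have "\<dots> \<le> N (edge_norm b)"
      using solid[OF bZ, of "\<lambda>e. norm (b x) * indicator {ex} e"] norm_le_edge_norm(1)[OF ex(1), of b]
      by (auto simp: indicator_def edge_norm_nonneg split: if_splits)
    also note n
    also have "2 * L * N (indicator {ey}) \<le> 2 * L * (U * exp (\<epsilon> / 2 * edist ex ey) * N (indicator {ex}))"
      using L by (intro mult_left_mono U ex ey) auto
    finally have "norm (b x) \<le> 2 * L * U * exp (\<epsilon> / 2 * edist ex ey)"
      using unit[OF ex(2)] by (simp add: mult.assoc[symmetric])
    also have "\<dots> \<le> 2 * L * U * exp (\<epsilon> / 2 * (vdist x y + 2))"
      using edist_le_incident(1)[OF ex(1) ey(1)] \<epsilon> L U by (intro mult_left_mono) auto
    finally have "norm (b x) \<le> 2 * L * U * exp (\<epsilon> / 2 * (vdist x y + 2))" .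
    moreover have "norm (b x) = exp (\<epsilon> * vdist x y) * norm (g y x)"
      by (simp add: b_def norm_mult \<rho>_def r_def R_def vdist_commute)
    ultimately have "exp (- (\<epsilon> * vdist x y)) * (exp (\<epsilon> * vdist x y) * norm (g y x))
      \<le> exp (- (\<epsilon> * vdist x y)) * (2 * L * U * exp (\<epsilon> / 2 * (vdist x y + 2)))"
      by simp
    moreover have "exp (- (\<epsilon> * vdist x y)) * (exp (\<epsilon> * vdist x y) * norm (g y x)) = norm (g y x)"
      by (simp only: mult.assoc[symmetric] exp_add[symmetric] add.left_inverse exp_zero mult_1_left)
    ultimately have "norm (g y x) \<le> exp (- (\<epsilon> * vdist x y)) * (2 * L * U * exp (\<epsilon> / 2 * (vdist x y + 2)))"
      by (simp only:)
    also have "\<dots> = 2 * L * U * (exp (\<epsilon> / 2 * (vdist x y + 2)) * exp (- (\<epsilon> * vdist x y)))"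
      by (simp only: ac_simps)
    also have "exp (\<epsilon> / 2 * (vdist x y + 2)) * exp (- (\<epsilon> * vdist x y)) = exp \<epsilon> * exp (- (\<epsilon> / 2) * vdist x y)"
      unfolding exp_add[symmetric] by (rule arg_cong[of _ _ exp]) (simp add: field_simps)
    finally show ?thesis by (simp add: mult.assoc)
  qed
  have "0 < 2 * L * U * exp \<epsilon>" "0 < \<epsilon> / 2" using \<epsilon>(1) L U(1) by auto
  then have "green_kernel \<mu> g"
    unfolding green_kernel_def using main g(2) by blast
  then show ?thesis by blast
qed

end

section \<open>The Laplacian in terms of the vertex operator\<close>

lemma has_second_derivative_cong:
  assumes u: "has_second_derivative u g"
    and eq: "\<And>s. 0 < s \<Longrightarrow> s < 1 \<Longrightarrow> v s = u s" "\<And>s. 0 < s \<Longrightarrow> s < 1 \<Longrightarrow> h s = g s"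
  shows "has_second_derivative v h"
proof -
  obtain f' where f': "\<forall>s \<in> {0<..<1}. (u has_vector_derivative f' s) (at s)"
    "\<forall>a b. 0 < a \<and> a \<le> b \<and> b < 1 \<longrightarrow>
       set_integrable lborel {a..b} g \<and> f' b - f' a = (LBINT s:{a..b}. g s)"
    using u unfolding has_second_derivative_def by blast
  show ?thesis
    unfolding has_second_derivative_def
  proof (intro exI[of _ f'] conjI ballI allI impI)
    fix s :: real assume s: "s \<in> {0<..<1}"
    show "(v has_vector_derivative f' s) (at s)"
      by (rule has_vector_derivative_transform_within_open[of u "f' s" s "{0<..<1}"]) (use f' s eq in auto)
  next
    fix a b :: real assume ab: "0 < a \<and> a \<le> b \<and> b < 1"
    have "set_integrable lborel {a..b} h = set_integrable lborel {a..b} g"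
      by (rule set_integrable_cong) (use ab eq in auto)
    moreover have "(LBINT s:{a..b}. h s) = (LBINT s:{a..b}. g s)"
      by (rule set_lebesgue_integral_cong) (use ab eq in auto)
    ultimately show "set_integrable lborel {a..b} h" "f' b - f' a = (LBINT s:{a..b}. h s)"
      using f'(2) ab by auto
  qed
qed

context metric_graph
begin

lemma normal_derivative_eq:
  assumes sob: "sobolev_derivatives (edge_function G u e) u1 g"
  shows "normal_derivative G c u e v = (if v = tail G e then of_real (c e) * u1 0 else - of_real (c e) * u1 1)"
proof -
  let ?d = "\<lambda>s. vector_derivative (edge_function G u e) (at s)"
  have cont: "continuous_on {0..1} u1" using sob by (simp add: sobolev_derivatives_def)
  have d: "?d s = u1 s" if "s \<in> {0<..<1}" for s
    using sob that unfolding sobolev_derivatives_def by (auto intro: vector_derivative_at)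
  have "(u1 \<longlongrightarrow> u1 0) (at_right 0)" "(u1 \<longlongrightarrow> u1 1) (at_left 1)"
    using cont by (auto simp: continuous_on_Icc_at_rightD continuous_on_Icc_at_leftD)
  moreover have "eventually (\<lambda>s. u1 s = ?d s) (at_right 0)"
    by (rule eventually_mono[OF eventually_at_right_real[of 0 1]]) (use d in auto)
  moreover have "eventually (\<lambda>s. u1 s = ?d s) (at_left 1)"
    by (rule eventually_mono[OF eventually_at_left_real[of 0 1]]) (use d in auto)
  ultimately have "(?d \<longlongrightarrow> u1 0) (at_right 0)" "(?d \<longlongrightarrow> u1 1) (at_left 1)"
    by (auto elim: Lim_transform_eventually)
  then have "Lim (at_right 0) ?d = u1 0" "Lim (at_left 1) ?d = u1 1"
    by (auto intro!: tendsto_Lim)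
  then show ?thesis by (simp add: normal_derivative_def)
qed

lemma edge_function_ends: "edge_function G u e 0 = u (Vertex (tail G e))" "edge_function G u e 1 = u (Vertex (head G e))"
  by (simp_all add: edge_function_def edge_point_def)

end

text \<open>\<open>\<nu>\<close> is the norm on a single edge, and \<open>N\<close> collects the
  edges. New elements are obtained from \<open>lipschitz_vectors\<close>: bounds and Lipschitz
  constants dominated by one sequence in \<open>Z\<close> give a bounded Lipschitz function for
  \<open>BUC_space\<close>, compact superlevel sets for \<open>C0_space\<close>, and integrability
  for \<open>Lp\<close>. The axiom \<open>edge_sup_bound\<close> reflects the edge length
  \<open>1\<close>.\<close>

locale laplacian_space = edge_sequence_space G c Z N
  for G :: "('v, 'e) pre_digraph" and c Z N +
  fixes X :: "('v, 'e) point function_space" and \<nu> :: "(real \<Rightarrow> complex) \<Rightarrow> real"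
  assumes vectors_norm: "u \<in> vectors X \<Longrightarrow>
      (\<lambda>e. \<nu> (edge_function G u e)) \<in> Z \<and> snorm X u = N (\<lambda>e. \<nu> (edge_function G u e))"
    and vectors_integrable: "u \<in> vectors X \<Longrightarrow> e \<in> arcs G \<Longrightarrow>
      set_integrable lborel {0..1} (edge_function G u e) \<and>
      integral {0..1} (\<lambda>s. norm (edge_function G u e s)) \<le> 2 * \<nu> (edge_function G u e)"
    and edge_sup_bound: "u \<in> vectors X \<Longrightarrow> e \<in> arcs G \<Longrightarrow>
      (\<And>s. s \<in> {0..1} \<Longrightarrow> norm (edge_function G u e s) \<le> B) \<Longrightarrow> \<nu> (edge_function G u e) \<le> B"
    and lipschitz_vectors: "\<beta> \<in> Z \<Longrightarrow>
      (\<And>e s. e \<in> arcs G \<Longrightarrow> s \<in> {0..1} \<Longrightarrow> norm (edge_function G u e s) \<le> \<beta> e) \<Longrightarrow>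
      (\<And>e s t. e \<in> arcs G \<Longrightarrow> s \<in> {0..1} \<Longrightarrow> t \<in> {0..1} \<Longrightarrow>
        norm (edge_function G u e t - edge_function G u e s) \<le> \<beta> e * \<bar>t - s\<bar>) \<Longrightarrow> u \<in> vectors X"
    and vectors_diff: "f \<in> vectors X \<Longrightarrow> u \<in> vectors X \<Longrightarrow> (\<lambda>x. f x - a * u x) \<in> vectors X"

locale spectral_problem = laplacian_space G c Z N X \<nu> + fundamental_solutions z S C
  for G :: "('v, 'e) pre_digraph" and c Z N X \<nu> z S C +
  assumes S1: "S 1 \<noteq> 0"
begin

abbreviation source :: "(('v, 'e) point \<Rightarrow> complex) \<Rightarrow> 'e \<Rightarrow> 'v \<Rightarrow> complex" where
  "source f e v \<equiv> (if v = tail G e then source_tail (edge_function G f e) else source_head (edge_function G f e))"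

text \<open>The inhomogeneity \<open>b\<close> of \<open>(P - \<mu>) a = b\<close>.\<close>

definition vertex_source :: "(('v, 'e) point \<Rightarrow> complex) \<Rightarrow> 'v \<Rightarrow> complex" where
  "vertex_source f v = (\<Sum>e \<in> incident_edges G v. of_real (c e) * source f e v) / of_real (weight v)"

text \<open>By the Dirichlet-to-Neumann formulas, \<open>S 1\<close> times the outer derivative
  along \<open>e\<close> at \<open>v\<close> is \<open>c e\<close> times the following difference:
  the value at the opposite end, minus \<open>C 1\<close> times the value at \<open>v\<close>, minus
  the source. Summation over the incident edges gives the vertex equation, and \<open>S 1\<close>
  cancels.\<close>

lemma kirchhoff_iff:
  assumes u: "\<And>e. e \<in> arcs G \<Longrightarrow> \<exists>u1. sobolev_derivatives (edge_function G u e) u1 (\<lambda>s. edge_function G f e s - z * edge_function G u e s)"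
    and f: "\<And>e. e \<in> arcs G \<Longrightarrow> set_integrable lborel {0..1} (edge_function G f e)"
    and v: "v \<in> verts G"
  shows "(\<Sum>e \<in> incident_edges G v. normal_derivative G c u e v) = 0
    \<longleftrightarrow> vertex_op (C 1) (\<lambda>w. u (Vertex w)) v = vertex_source f v"
proof -
  have nd: "S 1 * normal_derivative G c u e v
      = of_real (c e) * (u (Vertex (other e v)) - C 1 * u (Vertex v)) - of_real (c e) * source f e v"
    if e: "e \<in> incident_edges G v" for e
  proof -
    have e': "e \<in> arcs G" and ends: "v = tail G e \<or> v = head G e" using e by (auto simp: incident_edges_def)
    obtain u1 where sob: "sobolev_derivatives (edge_function G u e) u1 (\<lambda>s. edge_function G f e s - z * edge_function G u e s)"
      using u[OF e'] by blast
    note t = derivative_at_tail[OF sob f[OF e']] and h = derivative_at_head[OF sob f[OF e']]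
    show ?thesis
    proof (cases "v = tail G e")
      case True
      have "S 1 * normal_derivative G c u e v = of_real (c e) * (S 1 * u1 0)"
        using True by (simp add: normal_derivative_eq[OF sob])
      then show ?thesis unfolding t using True by (simp add: edge_function_ends other_def right_diff_distrib)
    next
      case False
      have "S 1 * normal_derivative G c u e v = of_real (c e) * (- S 1 * u1 1)"
        using False by (simp add: normal_derivative_eq[OF sob])
      then show ?thesis unfolding h using False ends by (simp add: edge_function_ends other_def right_diff_distrib)
    qed
  qed
  have "S 1 * (\<Sum>e \<in> incident_edges G v. normal_derivative G c u e v)
      = (\<Sum>e \<in> incident_edges G v. of_real (c e) * (u (Vertex (other e v)) - C 1 * u (Vertex v)))
        - (\<Sum>e \<in> incident_edges G v. of_real (c e) * source f e v)"
    unfolding sum_distrib_left sum_subtractf[symmetric] by (rule sum.cong[OF HOL.refl nd])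
  also have "\<dots> = of_real (weight v) * vertex_op (C 1) (\<lambda>w. u (Vertex w)) v - of_real (weight v) * vertex_source f v"
    using weight_pos[OF v] by (simp add: weight_vertex_op[OF v] vertex_source_def)
  finally have "S 1 * (\<Sum>e \<in> incident_edges G v. normal_derivative G c u e v)
      = of_real (weight v) * (vertex_op (C 1) (\<lambda>w. u (Vertex w)) v - vertex_source f v)"
    by (simp only: right_diff_distrib)
  then show ?thesis using S1 weight_pos[OF v] by auto
qed

section \<open>Estimates and reconstruction between functions and vertex values\<close>

lemma source_bounded:
  "\<exists>M>0. \<forall>f \<in> vectors X. \<forall>e \<in> arcs G.
     norm (source_tail (edge_function G f e)) \<le> M * \<nu> (edge_function G f e) \<and>
     norm (source_head (edge_function G f e)) \<le> M * \<nu> (edge_function G f e)"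
proof -
  obtain M where M: "0 < M" "\<And>f. set_integrable lborel {0..1} f \<Longrightarrow>
    norm (source_tail f) \<le> M * integral {0..1} (\<lambda>t. norm (f t)) \<and>
    norm (source_head f) \<le> M * integral {0..1} (\<lambda>t. norm (f t))"
    using norm_source_le by auto
  show ?thesis
  proof (intro exI[of _ "2 * M"] conjI[of "0 < 2 * M"] ballI)
    fix f e assume fe: "f \<in> vectors X" "e \<in> arcs G"
    note i = vectors_integrable[OF fe]
    have "M * integral {0..1} (\<lambda>t. norm (edge_function G f e t)) \<le> M * (2 * \<nu> (edge_function G f e))"
      by (rule mult_left_mono) (use i M in auto)
    then show "norm (source_tail (edge_function G f e)) \<le> 2 * M * \<nu> (edge_function G f e) \<and>
     norm (source_head (edge_function G f e)) \<le> 2 * M * \<nu> (edge_function G f e)"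
      using M(2)[of "edge_function G f e"] i by (auto simp: mult_ac)
  qed (use M in simp)
qed

text \<open>As \<open>w\<close> is minus the second derivative of \<open>u\<close>, the function
  \<open>z * u - w\<close> is the source \<open>f\<close> in u'' + z u = f.\<close>

lemma laplacian_source:
  assumes "(u, w) \<in> neg_laplacian G c X"
  shows "(\<lambda>x. z * u x - w x) \<in> vectors X" (is "?f \<in> _")
    and "u \<in> vectors X"
    and "e \<in> arcs G \<Longrightarrow> \<exists>u1. sobolev_derivatives (edge_function G u e) u1
      (\<lambda>s. edge_function G (\<lambda>x. z * u x - w x) e s - z * edge_function G u e s)"
    and "v \<in> verts G \<Longrightarrow> vertex_op (C 1) (\<lambda>w. u (Vertex w)) v = vertex_source (\<lambda>x. z * u x - w x) v"
proof -
  obtain g where g: "w = (\<lambda>x. - g x)" "u \<in> vectors X" "g \<in> vectors X" "continuous_on_graph G u"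
    "\<And>e. e \<in> arcs G \<Longrightarrow> has_second_derivative (edge_function G u e) (edge_function G g e)"
    "\<And>v. v \<in> verts G \<Longrightarrow> (\<Sum>e \<in> incident_edges G v. normal_derivative G c u e v) = 0"
    using assms unfolding neg_laplacian_def by blast
  show f: "?f \<in> vectors X" using vectors_diff[OF g(3,2), of "-z"] g(1) by (simp add: add.commute)
  show "u \<in> vectors X" by (rule g)
  have eq: "edge_function G g e = (\<lambda>s. edge_function G ?f e s - z * edge_function G u e s)" for e
    by (rule ext) (simp add: edge_function_def g(1))
  show sob: "\<exists>u1. sobolev_derivatives (edge_function G u e) u1
      (\<lambda>s. edge_function G ?f e s - z * edge_function G u e s)" if e: "e \<in> arcs G" for e
    using has_second_derivative_extend[OF g(5)[OF e] _ continuous_edge_function[OF g(4) e]]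
      vectors_integrable[OF g(3) e] unfolding eq by blast
  show "vertex_op (C 1) (\<lambda>w. u (Vertex w)) v = vertex_source ?f v" if "v \<in> verts G" for v
    using kirchhoff_iff[OF sob _ that] vectors_integrable[OF f] g(6)[OF that] by blast
qed


text \<open>The norm of \<open>Lp\<close> does not see vertex values; for functions in the domain
  \<open>trace_bound\<close> controls them edge by edge.\<close>

lemma vertex_bound:
  "\<exists>K>0. \<forall>(u, w) \<in> neg_laplacian G c X.
    edge_norm (\<lambda>v. u (Vertex v)) \<in> Z \<and>
    N (edge_norm (\<lambda>v. u (Vertex v))) \<le> K * (snorm X u + snorm X (\<lambda>x. z * u x - w x))"
proof -
  obtain K where K: "0 < K" "\<And>f u u1. sobolev_derivatives u u1 (\<lambda>s. f s - z * u s) \<Longrightarrow> set_integrable lborel {0..1} f \<Longrightarrow>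
     norm (u 0) + norm (u 1) \<le> K * (integral {0..1} (\<lambda>t. norm (u t)) + integral {0..1} (\<lambda>t. norm (f t)))"
    using trace_bound by auto
  show ?thesis
  proof (intro exI[of _ "8 * K"] conjI[of "0 < 8 * K"] ballI, simp add: K, clarify)
    fix u w assume uw: "(u, w) \<in> neg_laplacian G c X"
    define f where "f = (\<lambda>x. z * u x - w x)"
    note src = laplacian_source[OF uw, folded f_def]
    let ?\<nu> = "\<lambda>h e. \<nu> (edge_function G h e)"
    note nu = vectors_norm[OF src(2)] and nf = vectors_norm[OF src(1)]
    define \<beta> where "\<beta> e = (2 * K) * (?\<nu> u e + ?\<nu> f e)" for e
    have le: "edge_norm (\<lambda>v. u (Vertex v)) e \<le> \<beta> e" if e: "e \<in> arcs G" for e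
    proof -
      obtain u1 where "sobolev_derivatives (edge_function G u e) u1 (\<lambda>s. edge_function G f e s - z * edge_function G u e s)"
        using src(3)[OF e] by blast
      from K(2)[OF this] vectors_integrable[OF src(1) e]
      have "edge_norm (\<lambda>v. u (Vertex v)) e \<le>
          K * (integral {0..1} (\<lambda>t. norm (edge_function G u e t)) + integral {0..1} (\<lambda>t. norm (edge_function G f e t)))"
        by (simp add: edge_function_ends edge_norm_def)
      also have "\<dots> \<le> K * (2 * ?\<nu> u e + 2 * ?\<nu> f e)"
        using vectors_integrable[OF src(1) e] vectors_integrable[OF src(2) e] K(1)
        by (intro mult_left_mono add_mono) auto
      finally show ?thesis by (simp add: \<beta>_def algebra_simps)
    qed
    have s: "(\<lambda>e. ?\<nu> u e + ?\<nu> f e) \<in> Z" "N (\<lambda>e. ?\<nu> u e + ?\<nu> f e) \<le> 4 * (snorm X u + snorm X f)"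
      using add[of "?\<nu> u" "?\<nu> f"] nu nf by auto
    have \<beta>: "\<beta> \<in> Z" "N \<beta> = 2 * K * N (\<lambda>e. ?\<nu> u e + ?\<nu> f e)"
      using scale[OF s(1), of "2 * K"] K unfolding \<beta>_def by auto
    have sol: "edge_norm (\<lambda>v. u (Vertex v)) \<in> Z \<and> N (edge_norm (\<lambda>v. u (Vertex v))) \<le> N \<beta>"
      by (rule solid[OF \<beta>(1)]) (use le edge_norm_nonneg in auto)
    have "N \<beta> \<le> 2 * K * (4 * (snorm X u + snorm X f))"
      unfolding \<beta>(2) by (rule mult_left_mono[OF s(2)]) (use K in simp)
    then show "edge_norm (\<lambda>v. u (Vertex v)) \<in> Z \<and>
        N (edge_norm (\<lambda>v. u (Vertex v))) \<le> 8 * K * (snorm X u + snorm X (\<lambda>x. z * u x - w x))"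
      using sol unfolding f_def[symmetric] by (simp add: algebra_simps)
  qed
qed

text \<open>The direction opposite to \<open>vertex_bound\<close>: \<open>solution_bounds\<close>
  estimates \<open>u\<close> pointwise on an edge by its end values and the source, and
  \<open>edge_sup_bound\<close> turns this into a bound for \<nu>.\<close>

lemma interior_bound:
  "\<exists>K>0. \<forall>(u, w) \<in> neg_laplacian G c X. edge_norm (\<lambda>v. u (Vertex v)) \<in> Z \<longrightarrow>
    snorm X u \<le> K * (N (edge_norm (\<lambda>v. u (Vertex v))) + snorm X (\<lambda>x. z * u x - w x))"
proof -
  obtain K where K: "0 < K" "\<And>f u u1 t. sobolev_derivatives u u1 (\<lambda>s. f s - z * u s) \<Longrightarrow> set_integrable lborel {0..1} f \<Longrightarrow>
     t \<in> {0..1} \<Longrightarrow> norm (u t) \<le> K * (norm (u 0) + norm (u 1) + integral {0..1} (\<lambda>t. norm (f t)))"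
    using solution_bounds[OF S1] by auto
  show ?thesis
  proof (intro exI[of _ "8 * K"] conjI[of "0 < 8 * K"] ballI, simp add: K, clarify)
    fix u w assume uw: "(u, w) \<in> neg_laplacian G c X" and a: "edge_norm (\<lambda>v. u (Vertex v)) \<in> Z"
    define f where "f = (\<lambda>x. z * u x - w x)"
    note src = laplacian_source[OF uw, folded f_def]
    let ?\<nu> = "\<lambda>h e. \<nu> (edge_function G h e)" and ?a = "edge_norm (\<lambda>v. u (Vertex v))"
    note nu = vectors_norm[OF src(2)] and nf = vectors_norm[OF src(1)]
    define \<beta> where "\<beta> e = (2 * K) * (?a e + ?\<nu> f e)" for e
    have le: "?\<nu> u e \<le> \<beta> e" if e: "e \<in> arcs G" for e
    proof (rule edge_sup_bound[OF src(2) e])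
      fix s :: real assume s: "s \<in> {0..1}"
      obtain u1 where "sobolev_derivatives (edge_function G u e) u1 (\<lambda>s. edge_function G f e s - z * edge_function G u e s)"
        using src(3)[OF e] by blast
      from K(2)[OF this _ s] vectors_integrable[OF src(1) e]
      have "norm (edge_function G u e s) \<le> K * (?a e + integral {0..1} (\<lambda>t. norm (edge_function G f e t)))"
        by (simp add: edge_function_ends edge_norm_def)
      also have "\<dots> \<le> K * (2 * ?a e + 2 * ?\<nu> f e)"
        using vectors_integrable[OF src(1) e] K(1) edge_norm_nonneg[of "\<lambda>v. u (Vertex v)" e]
        by (intro mult_left_mono add_mono) auto
      finally show "norm (edge_function G u e s) \<le> \<beta> e" by (simp add: \<beta>_def algebra_simps)
    qed
    have s: "(\<lambda>e. ?a e + ?\<nu> f e) \<in> Z" "N (\<lambda>e. ?a e + ?\<nu> f e) \<le> 4 * (N ?a + snorm X f)"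
      using add[OF a, of "?\<nu> f"] nf by auto
    have \<beta>: "\<beta> \<in> Z" "N \<beta> = 2 * K * N (\<lambda>e. ?a e + ?\<nu> f e)"
      using scale[OF s(1), of "2 * K"] K unfolding \<beta>_def by auto
    have "snorm X u \<le> N \<beta>"
      using solid[OF \<beta>(1), of "?\<nu> u"] le nu Z_nonneg[of "?\<nu> u"] by auto
    also have "\<dots> \<le> 2 * K * (4 * (N ?a + snorm X f))"
      unfolding \<beta>(2) by (rule mult_left_mono[OF s(2)]) (use K in simp)
    finally show "snorm X u \<le> 8 * K * (N ?a + snorm X (\<lambda>x. z * u x - w x))"
      unfolding f_def[symmetric] by (simp add: algebra_simps)
  qed
qed

text \<open>Edgewise solutions with the end values \<open>a\<close> are glued. Their values and
  slopes are bounded by \<open>solution_bounds\<close>, so \<open>lipschitz_vectors\<close> places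
  the result in \<open>X\<close>, and the vertex equation is Kirchhoff's condition.\<close>

lemma solve_from_vertices:
  assumes f: "f \<in> vectors X" and a: "edge_norm a \<in> Z"
    and eq: "\<And>v. v \<in> verts G \<Longrightarrow> vertex_op (C 1) a v = vertex_source f v"
  shows "\<exists>(u, w) \<in> neg_laplacian G c X. (\<lambda>x. z * u x - w x) = f \<and> (\<forall>v. u (Vertex v) = a v)"
proof -
  note fi = vectors_integrable[OF f]
  have "\<forall>e \<in> arcs G. \<exists>U. continuous_on {0..1} U \<and> U 0 = a (tail G e) \<and> U 1 = a (head G e) \<and>
      has_second_derivative U (\<lambda>s. edge_function G f e s - z * U s)"
    using ex_solution[OF _ S1] fi by simp
  from bchoice[OF this] obtain U where
    "\<forall>e \<in> arcs G. continuous_on {0..1} (U e) \<and> U e 0 = a (tail G e) \<and> U e 1 = a (head G e) \<and>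
      has_second_derivative (U e) (\<lambda>s. edge_function G f e s - z * U e s)" ..
  then have U: "\<And>e. e \<in> arcs G \<Longrightarrow> continuous_on {0..1} (U e)"
    "\<And>e. e \<in> arcs G \<Longrightarrow> U e 0 = a (tail G e)" "\<And>e. e \<in> arcs G \<Longrightarrow> U e 1 = a (head G e)"
    "\<And>e. e \<in> arcs G \<Longrightarrow> has_second_derivative (U e) (\<lambda>s. edge_function G f e s - z * U e s)"
    by simp_all
  define u where "u x = (case x of Vertex v \<Rightarrow> a v | Inner e s \<Rightarrow> U e s)" for x
  \<comment> \<open>Defining the second derivative through the equation, also at the vertices, puts
    it into \<open>X\<close> by \<open>vectors_diff\<close> and makes \<open>z * u - w = f\<close>
    hold at every point.\<close>
  define g where "g x = f x - z * u x" for x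
  have uU: "edge_function G u e s = U e s" if "e \<in> arcs G" "s \<in> {0..1}" for e s
    using U(2,3)[OF that(1)] by (auto simp: edge_function_def edge_point_def u_def)
  have cu: "continuous_on {0..1} (edge_function G u e)" if e: "e \<in> arcs G" for e
    using U(1)[OF e] continuous_on_cong[of "{0..1}" "{0..1}" "edge_function G u e" "U e"] uU[OF e] by auto
  have hs: "has_second_derivative (edge_function G u e) (edge_function G g e)" if e: "e \<in> arcs G" for e
    by (rule has_second_derivative_cong[OF U(4)[OF e]])
      (use uU[OF e] in \<open>auto simp: edge_function_def g_def\<close>)
  have eq_g: "edge_function G g e = (\<lambda>s. edge_function G f e s - z * edge_function G u e s)" for e
    by (rule ext) (simp add: edge_function_def g_def)
  have sob: "\<exists>u1. sobolev_derivatives (edge_function G u e) u1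
      (\<lambda>s. edge_function G f e s - z * edge_function G u e s)" if e: "e \<in> arcs G" for e
    using has_second_derivative_extend[OF hs[OF e, unfolded eq_g] integrable_source_minus cu[OF e]] fi[OF e] cu[OF e]
    by blast
  obtain K where K: "0 < K" "\<And>f u u1 t. sobolev_derivatives u u1 (\<lambda>s. f s - z * u s) \<Longrightarrow> set_integrable lborel {0..1} f \<Longrightarrow>
     t \<in> {0..1} \<Longrightarrow> norm (u t) \<le> K * (norm (u 0) + norm (u 1) + integral {0..1} (\<lambda>t. norm (f t))) \<and>
       norm (u1 t) \<le> K * (norm (u 0) + norm (u 1) + integral {0..1} (\<lambda>t. norm (f t)))"
    using solution_bounds[OF S1] by auto
  let ?\<nu> = "\<lambda>h e. \<nu> (edge_function G h e)"
  define \<beta> where "\<beta> e = (2 * K) * (edge_norm a e + ?\<nu> f e)" for e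
  have \<beta>: "\<beta> \<in> Z"
    using scale[of "\<lambda>e. edge_norm a e + ?\<nu> f e" "2 * K"] add[OF a, of "?\<nu> f"] vectors_norm[OF f] K
    unfolding \<beta>_def by auto
  have K\<beta>: "K * (norm (edge_function G u e 0) + norm (edge_function G u e 1)
      + integral {0..1} (\<lambda>t. norm (edge_function G f e t))) \<le> \<beta> e" if e: "e \<in> arcs G" for e
  proof -
    have "K * (edge_norm a e + integral {0..1} (\<lambda>t. norm (edge_function G f e t))) \<le> K * (2 * edge_norm a e + 2 * ?\<nu> f e)"
      using fi[OF e] K(1) edge_norm_nonneg[of a e] by (intro mult_left_mono add_mono) auto
    then show ?thesis using uU[OF e, of 0] uU[OF e, of 1] U(2,3)[OF e]
      by (simp add: edge_norm_def \<beta>_def algebra_simps)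
  qed
  have b1: "norm (edge_function G u e s) \<le> \<beta> e" if "e \<in> arcs G" "s \<in> {0..1}" for e s
    using sob[OF that(1)] K(2)[of "edge_function G u e" _ "edge_function G f e" s] fi[OF that(1)] K\<beta>[OF that(1)] that(2)
    by (meson order_trans)
  have b2: "norm (edge_function G u e t - edge_function G u e s) \<le> \<beta> e * \<bar>t - s\<bar>"
    if e: "e \<in> arcs G" and st: "s \<in> {0..1}" "t \<in> {0..1}" for e s t
  proof -
    obtain u1 where u1: "sobolev_derivatives (edge_function G u e) u1
      (\<lambda>s. edge_function G f e s - z * edge_function G u e s)" using sob[OF e] by blast
    show ?thesis
    proof (rule lipschitz_from_derivative[where ?u1.0=u1])
      show "norm (u1 r) \<le> \<beta> e" if "r \<in> {0<..<1}" for r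
        using K(2)[OF u1, of r] fi[OF e] K\<beta>[OF e] that by auto
    qed (use u1 st in \<open>auto simp: sobolev_derivatives_def\<close>)
  qed
  have uX: "u \<in> vectors X" by (rule lipschitz_vectors[OF \<beta> b1 b2])
  have gX: "g \<in> vectors X" unfolding g_def by (rule vectors_diff[OF f uX])
  have kir: "(\<Sum>e \<in> incident_edges G v. normal_derivative G c u e v) = 0" if v: "v \<in> verts G" for v
  proof -
    have "(\<lambda>w. u (Vertex w)) = a" by (simp add: u_def)
    then show ?thesis using kirchhoff_iff[OF sob _ v] fi eq[OF v] by simp
  qed
  have "(u, \<lambda>x. - g x) \<in> neg_laplacian G c X"
    unfolding neg_laplacian_def
    using uX gX hs continuous_on_graph_edgewise_lipschitz[of u \<beta>, OF b2] kir by blast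
  moreover have "(\<lambda>x. z * u x - - g x) = f" by (simp add: g_def)
  ultimately show ?thesis by (intro bexI[of _ "(u, \<lambda>x. - g x)"]) (auto simp: u_def)
qed

text \<open>On each edge the dual sources are weighted with the values of \<open>b\<close> at the
  corresponding ends. Every edge at \<open>v\<close> then contributes the same source
  \<open>b v\<close>, and so does the weighted mean. This bounded right inverse of
  \<open>vertex_source\<close> carries the invertibility of the Laplacian over to the vertex
  operator.\<close>

lemma dual_source:
  "\<exists>K>0. \<forall>b. edge_norm b \<in> Z \<longrightarrow>
    (\<exists>f \<in> vectors X. snorm X f \<le> K * N (edge_norm b) \<and> (\<forall>v \<in> verts G. vertex_source f v = b v))"
proof -
  obtain \<phi>0 \<phi>1 L where \<phi>: "\<phi>0 0 = 0" "\<phi>0 1 = 0" "\<phi>1 0 = 0" "\<phi>1 1 = 0"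
    and src: "source_tail \<phi>0 = 1" "source_head \<phi>0 = 0" "source_tail \<phi>1 = 0" "source_head \<phi>1 = 1"
    and L: "0 < L" and cont: "continuous_on {0..1} \<phi>0" "continuous_on {0..1} \<phi>1"
    and bd: "\<And>s. s \<in> {0..1} \<Longrightarrow> norm (\<phi>0 s) \<le> L \<and> norm (\<phi>1 s) \<le> L"
    and lip: "\<And>s t. s \<in> {0..1} \<Longrightarrow> t \<in> {0..1} \<Longrightarrow> norm (\<phi>0 t - \<phi>0 s) \<le> L * \<bar>t - s\<bar> \<and> norm (\<phi>1 t - \<phi>1 s) \<le> L * \<bar>t - s\<bar>"
    using ex_dual_sources[OF S1] by blast
  show ?thesis
  proof (intro exI[of _ L] conjI[OF L] allI impI)
    fix b assume b: "edge_norm b \<in> Z"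
    define f where "f x = (case x of Vertex v \<Rightarrow> 0 | Inner e s \<Rightarrow> b (tail G e) * \<phi>0 s + b (head G e) * \<phi>1 s)"
      for x :: "('v, 'e) point"
    have fe: "edge_function G f e = (\<lambda>s. b (tail G e) * \<phi>0 s + b (head G e) * \<phi>1 s)" for e
      by (rule ext) (auto simp: edge_function_def edge_point_def f_def \<phi>)
    define \<beta> where "\<beta> e = L * edge_norm b e" for e
    have \<beta>: "\<beta> \<in> Z" "N \<beta> = L * N (edge_norm b)" using scale[OF b, of L] L unfolding \<beta>_def by auto
    have comb: "norm (p * x + q * y) \<le> (norm p + norm q) * B" if "norm x \<le> B" "norm y \<le> B" for p q x y :: complex and B
    proof -
      have "norm (p * x + q * y) \<le> norm p * norm x + norm q * norm y"
        using norm_triangle_ineq[of "p * x" "q * y"] by (simp add: norm_mult)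
      also have "\<dots> \<le> norm p * B + norm q * B" by (intro add_mono mult_left_mono that) auto
      finally show ?thesis by (simp add: algebra_simps)
    qed
    have b1: "norm (edge_function G f e s) \<le> \<beta> e" if "s \<in> {0..1}" for e s
      unfolding fe \<beta>_def edge_norm_def using comb[of "\<phi>0 s" L "\<phi>1 s" "b (tail G e)" "b (head G e)"] bd[OF that]
      by (simp add: mult.commute[of L])
    have b2: "norm (edge_function G f e t - edge_function G f e s) \<le> \<beta> e * \<bar>t - s\<bar>"
      if "s \<in> {0..1}" "t \<in> {0..1}" for e s t
    proof -
      have "edge_function G f e t - edge_function G f e s
        = b (tail G e) * (\<phi>0 t - \<phi>0 s) + b (head G e) * (\<phi>1 t - \<phi>1 s)" unfolding fe by (simp add: algebra_simps)
      then show ?thesis using comb[of "\<phi>0 t - \<phi>0 s" "L * \<bar>t - s\<bar>" "\<phi>1 t - \<phi>1 s" "b (tail G e)" "b (head G e)"] lip[OF that]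
        by (simp add: \<beta>_def edge_norm_def mult_ac)
    qed
    have fX: "f \<in> vectors X" by (rule lipschitz_vectors[OF \<beta>(1) b1 b2])
    note nf = vectors_norm[OF fX]
    have "snorm X f \<le> N \<beta>"
      using solid[OF \<beta>(1), of "\<lambda>e. \<nu> (edge_function G f e)"] edge_sup_bound[OF fX _ b1] nf Z_nonneg by auto
    moreover have "vertex_source f v = b v" if v: "v \<in> verts G" for v
    proof -
      have "source f e v = b v" if e: "e \<in> incident_edges G v" for e
      proof -
        have lin: "integral {0..1} (\<lambda>t. S' t * (p * \<phi>0 t + q * \<phi>1 t))
          = p * integral {0..1} (\<lambda>t. S' t * \<phi>0 t) + q * integral {0..1} (\<lambda>t. S' t * \<phi>1 t)"
          if "continuous_on {0..1} S'" for p q and S' :: "real \<Rightarrow> complex"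
        proof -
          have "(\<lambda>t. S' t * \<phi>0 t) integrable_on {0..1}" "(\<lambda>t. S' t * \<phi>1 t) integrable_on {0..1}"
            by (intro integrable_continuous_real continuous_on_mult cont that)+
          then have "integral {0..1} (\<lambda>t. p * (S' t * \<phi>0 t) + q * (S' t * \<phi>1 t))
            = p * integral {0..1} (\<lambda>t. S' t * \<phi>0 t) + q * integral {0..1} (\<lambda>t. S' t * \<phi>1 t)"
            by (subst Henstock_Kurzweil_Integration.integral_add) (auto intro: integrable_on_mult_right)
          then show ?thesis by (simp add: algebra_simps)
        qed
        have cS: "continuous_on {0..1} (\<lambda>t. S (1 - t))"
          by (auto intro!: continuous_at_imp_continuous_on has_vector_derivative_continuous S_shift)
        have "source_tail (edge_function G f e) = b (tail G e)" "source_head (edge_function G f e) = b (head G e)"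
          using src lin[OF cS] lin[OF continuous_S] unfolding fe source_tail_def source_head_def by simp_all
        then show ?thesis using e by (auto simp: incident_edges_def)
      qed
      then have "vertex_source f v = (\<Sum>e \<in> incident_edges G v. of_real (c e) * b v) / of_real (weight v)"
        by (simp add: vertex_source_def)
      also have "\<dots> = b v" using weight_pos[OF v] by (simp add: weight_def flip: sum_distrib_right of_real_sum)
      finally show ?thesis .
    qed
    ultimately show "\<exists>f \<in> vectors X. snorm X f \<le> L * N (edge_norm b) \<and> (\<forall>v \<in> verts G. vertex_source f v = b v)"
      using fX \<beta>(2) by auto
  qed
qed

section \<open>From the resolvent set to the Green kernel and back\<close>

lemma snorm_eq_0_edge:
  assumes r: "r \<in> vectors X" "snorm X r = 0" and e: "e \<in> arcs G"
  shows "\<nu> (edge_function G r e) = 0"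
proof -
  let ?n = "\<lambda>e. \<nu> (edge_function G r e)"
  note nr = vectors_norm[OF r(1)]
  have pos: "0 \<le> ?n e" using Z_nonneg nr e by blast
  have "?n e * N (indicator {e}) = N (\<lambda>e'. ?n e * indicator {e} e')"
    using scale[of "indicator {e}" "?n e"] unit[OF e] pos by simp
  also have "\<dots> \<le> N ?n"
  proof -
    have "(\<lambda>e'. ?n e * indicator {e} e') \<in> Z \<and> N (\<lambda>e'. ?n e * indicator {e} e') \<le> N ?n"
      by (rule solid) (use nr Z_nonneg[of ?n] pos in \<open>auto simp: indicator_def\<close>)
    then show ?thesis by simp
  qed
  finally have "?n e * N (indicator {e}) \<le> 0" using nr r(2) by simp
  then have "?n e \<le> 0" using unit[OF e] by (simp add: mult_le_0_iff)
  then show ?thesis using pos by simp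
qed

text \<open>Surjectivity in \<open>resolvent_set\<close> solves the equation only up to seminorm
  \<open>0\<close>, so the vertex source must depend on the class of the source alone. It does,
  since its ingredients are bounded by \<nu> on each edge.\<close>

lemma vertex_source_cong:
  assumes f: "f \<in> vectors X" "h \<in> vectors X" and eq: "snorm X (\<lambda>x. h x - f x) = 0" and v: "v \<in> verts G"
  shows "vertex_source h v = vertex_source f v"
proof -
  define r where "r = (\<lambda>x. h x - f x)"
  have r: "r \<in> vectors X" using vectors_diff[OF f(2,1), of 1] by (simp add: r_def)
  obtain M where M: "\<And>e. e \<in> arcs G \<Longrightarrow> norm (source_tail (edge_function G r e)) \<le> M * \<nu> (edge_function G r e) \<and>
     norm (source_head (edge_function G r e)) \<le> M * \<nu> (edge_function G r e)"
    using source_bounded r by blast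
  have "source h e v = source f e v" if e: "e \<in> incident_edges G v" for e
  proof -
    have e': "e \<in> arcs G" using e by (simp add: incident_edges_def)
    note i = vectors_integrable[OF f(1) e', THEN conjunct1] vectors_integrable[OF f(2) e', THEN conjunct1]
    have cS: "continuous_on {0..1} (\<lambda>t. S (1 - t))"
      by (auto intro!: continuous_at_imp_continuous_on has_vector_derivative_continuous S_shift)
    have lin: "integral {0..1} (\<lambda>t. S' t * edge_function G r e t)
        = integral {0..1} (\<lambda>t. S' t * edge_function G h e t) - integral {0..1} (\<lambda>t. S' t * edge_function G f e t)"
      if "continuous_on {0..1} S'" for S'
    proof -
      have "(\<lambda>t. S' t * edge_function G h e t) integrable_on {0..1}" "(\<lambda>t. S' t * edge_function G f e t) integrable_on {0..1}"
        using set_borel_integral_eq_integral(1)[OF set_integrable_lborel_mult_continuous[OF _ that]] i by blast+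
      from Henstock_Kurzweil_Integration.integral_diff[OF this]
      show ?thesis by (simp add: r_def edge_function_def right_diff_distrib)
    qed
    have "source_tail (edge_function G r e) = 0" "source_head (edge_function G r e) = 0"
      using M[OF e'] snorm_eq_0_edge[OF r _ e'] eq by (auto simp: r_def)
    then have "source_tail (edge_function G h e) = source_tail (edge_function G f e)"
      "source_head (edge_function G h e) = source_head (edge_function G f e)"
      using lin[OF cS] lin[OF continuous_S] unfolding source_tail_def source_head_def by auto
    then show ?thesis by simp
  qed
  then show ?thesis by (simp add: vertex_source_def)
qed

text \<open>By \<open>dual_source\<close> and \<open>solve_from_vertices\<close>, every
  \<open>a\<close> is the vertex trace of some function in the domain with a controlled source; the
  resolvent bound for that function gives the lower bound asked for by \<open>combes_thomas\<close>.
  The columns are traces of solutions whose vertex source is a unit vector.\<close>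

lemma resolvent_imp_green_kernel:
  assumes z: "z \<in> resolvent_set X (neg_laplacian G c X)"
  shows "\<exists>g. green_kernel (C 1) g"
proof -
  obtain A where A: "\<And>u w. (u, w) \<in> neg_laplacian G c X \<Longrightarrow> snorm X u \<le> A * snorm X (\<lambda>x. z * u x - w x)"
    using resolvent_set_boundedD[OF z] by blast
  obtain K1 where K1: "0 < K1" "\<And>u w. (u, w) \<in> neg_laplacian G c X \<Longrightarrow>
    edge_norm (\<lambda>v. u (Vertex v)) \<in> Z \<and>
    N (edge_norm (\<lambda>v. u (Vertex v))) \<le> K1 * (snorm X u + snorm X (\<lambda>x. z * u x - w x))"
    using vertex_bound by auto
  obtain K2 where K2: "0 < K2" "\<And>b. edge_norm b \<in> Z \<Longrightarrow>
    \<exists>f \<in> vectors X. snorm X f \<le> K2 * N (edge_norm b) \<and> (\<forall>v \<in> verts G. vertex_source f v = b v)"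
    using dual_source by blast
  obtain K3 where K3: "\<And>a. edge_norm a \<in> Z \<Longrightarrow> edge_norm (vertex_op (C 1) a) \<in> Z"
    using vertex_op_bounded by blast
  show ?thesis
  proof (rule combes_thomas)
    fix a assume a: "edge_norm a \<in> Z"
    let ?b = "vertex_op (C 1) a"
    obtain f where f: "f \<in> vectors X" "snorm X f \<le> K2 * N (edge_norm ?b)"
      "\<And>v. v \<in> verts G \<Longrightarrow> vertex_source f v = ?b v"
      using K2(2)[OF K3[OF a]] by blast
    obtain u w where uw: "(u, w) \<in> neg_laplacian G c X" "(\<lambda>x. z * u x - w x) = f" "\<And>v. u (Vertex v) = a v"
      using solve_from_vertices[OF f(1) a] f(3) by auto
    have f0: "0 \<le> snorm X f" using N_nonneg vectors_norm[OF f(1)] by auto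
    have "N (edge_norm a) \<le> K1 * (snorm X u + snorm X f)"
      using K1(2)[OF uw(1)] by (simp add: uw(2,3))
    also have "\<dots> \<le> K1 * ((\<bar>A\<bar> + 1) * snorm X f)"
    proof (rule mult_left_mono)
      have "snorm X u \<le> A * snorm X f" using A[OF uw(1)] by (simp add: uw(2))
      also have "\<dots> \<le> \<bar>A\<bar> * snorm X f" using f0 by (intro mult_right_mono) auto
      finally show "snorm X u + snorm X f \<le> (\<bar>A\<bar> + 1) * snorm X f" by (simp add: distrib_right)
    qed (use K1 in simp)
    also have "\<dots> \<le> K1 * ((\<bar>A\<bar> + 1) * (K2 * N (edge_norm ?b)))"
      using f(2) K1 by (intro mult_left_mono) auto
    finally show "N (edge_norm a) \<le> (K1 * ((\<bar>A\<bar> + 1) * K2)) * N (edge_norm ?b)" by (simp add: mult.assoc)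
  next
    fix y assume y: "y \<in> verts G"
    define b where "b x = (if x = y then 1 else 0 :: complex)" for x
    obtain ey where ey: "ey \<in> incident_edges G y" "ey \<in> arcs G" using incident_arcE[OF y] .
    have "edge_norm b \<in> Z"
    proof -
      have "norm (b v) \<le> 1 * (\<Sum>e \<in> incident_edges G v. indicator {ey} e)" if "v \<in> verts G" for v
        using member_le_sum[of ey "incident_edges G v" "indicator {ey} :: 'e \<Rightarrow> real"] ey that
        by (auto simp: b_def sum_nonneg)
      then show ?thesis using vertex_sum_bounded[of 1] unit[OF ey(2)] by (meson zero_le_one)
    qed
    then obtain f where f: "f \<in> vectors X" "\<And>v. v \<in> verts G \<Longrightarrow> vertex_source f v = b v"
      using K2(2) by blast
    obtain u w where uw: "(u, w) \<in> neg_laplacian G c X" "snorm X (\<lambda>x. z * u x - w x - f x) = 0"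
      using resolvent_set_surjD[OF z f(1)] by blast
    note src = laplacian_source[OF uw(1)]
    have "vertex_op (C 1) (\<lambda>w. u (Vertex w)) x = (if x = y then 1 else 0)" if x: "x \<in> verts G" for x
      using src(4)[OF x] vertex_source_cong[OF f(1) src(1) uw(2) x] f(2)[OF x] by (simp add: b_def)
    then show "\<exists>g. edge_norm g \<in> Z \<and> (\<forall>x \<in> verts G. vertex_op (C 1) g x = (if x = y then 1 else 0))"
      using K1(2)[OF uw(1)] by blast
  qed
qed

text \<open>\<open>green_kernel_solution\<close> and \<open>solve_from_vertices\<close> solve the
  equation. For arbitrary \<open>u\<close> in the domain, \<open>green_kernel_injective\<close>
  identifies its vertex values with those constructed from its source, so the bound for the latter
  and \<open>interior_bound\<close> estimate \<open>u\<close>. Injectivity is the case of a source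
  of seminorm \<open>0\<close>.\<close>

lemma green_kernel_imp_resolvent:
  assumes g: "green_kernel (C 1) g"
  shows "z \<in> resolvent_set X (neg_laplacian G c X)"
proof -
  obtain M where M: "0 < M" "\<And>f e. f \<in> vectors X \<Longrightarrow> e \<in> arcs G \<Longrightarrow>
     norm (source_tail (edge_function G f e)) \<le> M * \<nu> (edge_function G f e) \<and>
     norm (source_head (edge_function G f e)) \<le> M * \<nu> (edge_function G f e)"
    using source_bounded by blast
  obtain K1 where K1: "0 < K1" "\<And>\<alpha> q0 q1. \<alpha> \<in> Z \<Longrightarrow> (\<forall>e \<in> arcs G. norm (q0 e) \<le> \<alpha> e \<and> norm (q1 e) \<le> \<alpha> e) \<Longrightarrow>
    \<exists>a. edge_norm a \<in> Z \<and> N (edge_norm a) \<le> K1 * N \<alpha> \<and>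
      (\<forall>v \<in> verts G. vertex_op (C 1) a v = (\<Sum>e \<in> incident_edges G v. if v = tail G e then q0 e else q1 e))"
    using green_kernel_solution[OF g] by blast
  have solve: "\<exists>a. edge_norm a \<in> Z \<and> N (edge_norm a) \<le> K1 * M * snorm X f \<and>
      (\<forall>v \<in> verts G. vertex_op (C 1) a v = vertex_source f v)" if f: "f \<in> vectors X" for f
  proof -
    let ?n = "\<lambda>e. \<nu> (edge_function G f e)"
    note nf = vectors_norm[OF f]
    \<comment> \<open>Splits the weighted mean at a vertex into contributions of edge ends, with
      factors at most \<open>1\<close>.\<close>
    define q0 where "q0 e = of_real (c e / weight (tail G e)) * source_tail (edge_function G f e)" for e
    define q1 where "q1 e = of_real (c e / weight (head G e)) * source_head (edge_function G f e)" for e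
    have le: "norm (of_real (c e / weight v) * x) \<le> M * ?n e"
      if e: "e \<in> incident_edges G v" and x: "norm x \<le> M * ?n e" for e v and x :: complex
    proof -
      have v: "v \<in> verts G" and e': "e \<in> arcs G" using e incident_in_verts by (auto simp: incident_edges_def)
      have "0 < c e" "c e \<le> weight v" using conductivity_pos[OF e'] conductivity_le_weight[OF v e] by auto
      then have "\<bar>c e / weight v\<bar> \<le> 1" by (simp add: divide_le_eq)
      then have "norm (of_real (c e / weight v) * x) \<le> norm x"
        unfolding norm_mult norm_of_real by (intro mult_left_le_one_le) auto
      with x show ?thesis by linarith
    qed
    have q: "\<forall>e \<in> arcs G. norm (q0 e) \<le> M * ?n e \<and> norm (q1 e) \<le> M * ?n e"
      unfolding q0_def q1_def using le self_incident M(2)[OF f] by blast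
    have s: "(\<lambda>e. M * ?n e) \<in> Z" "N (\<lambda>e. M * ?n e) = M * snorm X f"
      using scale[of ?n M] nf M by auto
    obtain a where a: "edge_norm a \<in> Z" "N (edge_norm a) \<le> K1 * (M * snorm X f)"
      "\<And>v. v \<in> verts G \<Longrightarrow> vertex_op (C 1) a v = (\<Sum>e \<in> incident_edges G v. if v = tail G e then q0 e else q1 e)"
      using K1(2)[OF s(1) q] unfolding s(2) by blast
    have "(\<Sum>e \<in> incident_edges G v. if v = tail G e then q0 e else q1 e) = vertex_source f v" for v
      unfolding vertex_source_def sum_divide_distrib
      by (rule sum.cong) (auto simp: q0_def q1_def incident_edges_def)
    then show ?thesis using a by (auto simp: mult.assoc)
  qed
  have surj: "\<exists>(u, w) \<in> neg_laplacian G c X. snorm X (\<lambda>x. z * u x - w x - f x) = 0" if f: "f \<in> vectors X" for f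
  proof -
    obtain a where "edge_norm a \<in> Z" "\<And>v. v \<in> verts G \<Longrightarrow> vertex_op (C 1) a v = vertex_source f v"
      using solve[OF f] by blast
    then obtain u w where uw: "(u, w) \<in> neg_laplacian G c X" "(\<lambda>x. z * u x - w x) = f"
      using solve_from_vertices[OF f] by blast
    \<comment> \<open>The error is literally the zero function; that its seminorm is
      \<open>0\<close> comes from \<open>scale\<close> with factor \<open>0\<close>.\<close>
    define o0 where "o0 = (\<lambda>x. z * u x - w x - f x)"
    have o0: "o0 = (\<lambda>x. 0)" using uw(2) by (auto simp: o0_def fun_eq_iff)
    have v0: "o0 \<in> vectors X" using vectors_diff[OF f f, of 1] by (simp add: o0)
    have "(\<lambda>e. \<nu> (edge_function G o0 e)) \<in> Z \<and> N (\<lambda>e. \<nu> (edge_function G o0 e)) \<le> N (\<lambda>e. 0 * \<nu> (edge_function G o0 e))"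
    proof (rule solid)
      show "(\<lambda>e. 0 * \<nu> (edge_function G o0 e)) \<in> Z" using scale[of _ 0] vectors_norm[OF v0] by blast
      fix e assume e: "e \<in> arcs G"
      have "\<nu> (edge_function G o0 e) \<le> 0"
        by (rule edge_sup_bound[OF v0 e]) (simp add: o0 edge_function_def)
      then show "0 \<le> \<nu> (edge_function G o0 e) \<and> \<nu> (edge_function G o0 e) \<le> 0 * \<nu> (edge_function G o0 e)"
        using Z_nonneg[OF _ e] vectors_norm[OF v0] by fastforce
    qed
    then have "snorm X o0 \<le> 0"
      using scale[of "\<lambda>e. \<nu> (edge_function G o0 e)" 0] vectors_norm[OF v0] by auto
    moreover have "0 \<le> snorm X o0" using vectors_norm[OF v0] N_nonneg by auto
    ultimately show ?thesis using uw(1) unfolding o0_def by (intro bexI[of _ "(u, w)"]) auto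
  qed
  obtain K2 where K2: "0 < K2" "\<And>u w. (u, w) \<in> neg_laplacian G c X \<Longrightarrow> edge_norm (\<lambda>v. u (Vertex v)) \<in> Z \<Longrightarrow>
    snorm X u \<le> K2 * (N (edge_norm (\<lambda>v. u (Vertex v))) + snorm X (\<lambda>x. z * u x - w x))"
    using interior_bound by auto
  have bound: "snorm X u \<le> (K2 * (K1 * M + 1)) * snorm X (\<lambda>x. z * u x - w x)" if uw: "(u, w) \<in> neg_laplacian G c X" for u w
  proof -
    define f where "f = (\<lambda>x. z * u x - w x)"
    note src = laplacian_source[OF uw, folded f_def]
    obtain a where a: "edge_norm a \<in> Z" "N (edge_norm a) \<le> K1 * M * snorm X f"
      "\<And>v. v \<in> verts G \<Longrightarrow> vertex_op (C 1) a v = vertex_source f v"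
      using solve[OF src(1)] by blast
    let ?u = "\<lambda>v. u (Vertex v)"
    have uZ: "edge_norm ?u \<in> Z" using vertex_bound uw by blast
    define d where "d v = ?u v - a v" for v
    have dZ: "edge_norm d \<in> Z"
    proof -
      have "(\<lambda>e. edge_norm ?u e + edge_norm a e) \<in> Z" using add[OF uZ a(1)] by simp
      moreover have "edge_norm d e \<le> edge_norm ?u e + edge_norm a e" for e
        using norm_triangle_ineq4[of "?u (tail G e)" "a (tail G e)"] norm_triangle_ineq4[of "?u (head G e)" "a (head G e)"]
        by (simp add: edge_norm_def d_def)
      ultimately show ?thesis using solid edge_norm_nonneg by blast
    qed
    have d0: "d v = 0" if v: "v \<in> verts G" for v
    proof (rule green_kernel_injective[OF g dZ _ v])
      fix v assume v: "v \<in> verts G"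
      have "vertex_op (C 1) d v = vertex_op (C 1) ?u v - vertex_op (C 1) a v"
        unfolding vertex_op_def d_def diff_divide_distrib[symmetric] sum_subtractf[symmetric]
        by (simp add: algebra_simps)
      then show "vertex_op (C 1) d v = 0" using src(4)[OF v] a(3)[OF v] by simp
    qed
    have sol: "edge_norm ?u \<in> Z \<and> N (edge_norm ?u) \<le> N (edge_norm a)"
      by (rule solid[OF a(1)]) (use d0 edge_norm_nonneg in \<open>auto simp: edge_norm_def d_def\<close>)
    have "snorm X u \<le> K2 * (N (edge_norm ?u) + snorm X f)" using K2(2)[OF uw uZ] by (simp add: f_def)
    also have "\<dots> \<le> K2 * (K1 * M * snorm X f + snorm X f)"
      using sol a(2) K2(1) by (intro mult_left_mono add_mono) auto
    finally show ?thesis unfolding f_def[symmetric] by (simp add: algebra_simps)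
  qed
  have inj: "snorm X u = 0" if uw: "(u, w) \<in> neg_laplacian G c X" "snorm X (\<lambda>x. z * u x - w x) = 0" for u w
  proof (rule antisym)
    show "snorm X u \<le> 0" using bound[OF uw(1)] uw(2) by simp
    show "0 \<le> snorm X u" using N_nonneg vectors_norm[OF laplacian_source(2)[OF uw(1)]] by auto
  qed
  show ?thesis
    unfolding resolvent_set_def mem_Collect_eq
    using inj surj bound by (intro conjI exI[of _ "K2 * (K1 * M + 1)"]) auto
qed

theorem resolvent_iff_green_kernel:
  "z \<in> resolvent_set X (neg_laplacian G c X) \<longleftrightarrow> (\<exists>g. green_kernel (C 1) g)"
  using resolvent_imp_green_kernel green_kernel_imp_resolvent by blast

end

section \<open>Sequence spaces over the edges\<close>

text \<open>If \<open>x > r\<close>, the second summand is x (x / r)^(p - 1) and exceeds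
  \<open>x\<close>. With \<open>r\<close> left free and chosen after integration, this replaces
  Hoelder's inequality.\<close>

lemma le_plus_powr:
  fixes x r p :: real
  assumes "0 \<le> x" "0 < r" "1 \<le> p"
  shows "x \<le> r + r powr (1 - p) * x powr p"
proof (cases "x \<le> r")
  case True
  have "0 \<le> r powr (1 - p) * x powr p" by simp
  with True show ?thesis by linarith
next
  case False
  then have "x powr (1 - p) \<le> r powr (1 - p)" using assms by (intro powr_mono2') auto
  then have "x powr (1 - p) * x powr p \<le> r powr (1 - p) * x powr p" by (rule mult_right_mono) simp
  moreover have "x powr (1 - p) * x powr p = x" using False assms by (simp flip: powr_add)
  ultimately show ?thesis using assms by linarith
qed

text \<open>Optimising the parameter in the previous bound gives a form of Jensen's inequality.\<close>

lemma powr_le_of_parametric_bound: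
  fixes x A s p :: real
  assumes p: "1 \<le> p" and A: "0 < A" and s: "0 \<le> s"
    and bound: "\<And>r. 0 < r \<Longrightarrow> x \<le> r * A + r powr (1 - p) * s"
  shows "x \<le> 2 * A * (s / A) powr (1 / p)"
proof (cases "s = 0")
  case True
  have "x \<le> 0"
  proof (rule ccontr)
    assume "\<not> x \<le> 0"
    \<comment> \<open>For \<open>s = 0\<close> this parameter makes the bound
      \<open>x / 2\<close>.\<close>
    then have "x \<le> x / (2 * A) * A" using bound[of "x / (2 * A)"] A True by simp
    with \<open>\<not> x \<le> 0\<close> A show False by (simp add: field_simps)
  qed
  then show ?thesis using True by simp
next
  case False
  \<comment> \<open>This \<open>r\<close> makes both terms of the bound equal, whence the factor
    \<open>2\<close>.\<close>
  define r where "r = (s / A) powr (1 / p)"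
  have r: "0 < r" using False s A by (simp add: r_def)
  have "r powr p = s / A" using p s A False by (simp add: r_def powr_powr)
  then have "r powr (1 - p) * s = r * A"
    using r A False s by (simp add: powr_diff field_simps)
  then show ?thesis using bound[OF r] by (simp add: r_def)
qed

lemma powr_add_le:
  fixes x y p :: real
  assumes "0 \<le> x" "0 \<le> y" "0 \<le> p"
  shows "(x + y) powr p \<le> 2 powr p * (x powr p + y powr p)"
proof -
  have "(x + y) powr p \<le> (2 * max x y) powr p" using assms by (intro powr_mono2) auto
  also have "\<dots> = 2 powr p * max x y powr p" using assms by (simp add: powr_mult)
  also have "\<dots> \<le> 2 powr p * (x powr p + y powr p)" by (intro mult_left_mono) (auto simp: max_def)
  finally show ?thesis .
qed

section \<open>Weighted p-summable sequences\<close>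

context growth_graph
begin

definition lp_seq :: "real \<Rightarrow> ('e \<Rightarrow> real) set" where
  "lp_seq p = {\<alpha>. (\<forall>e \<in> arcs G. 0 \<le> \<alpha> e) \<and> (\<lambda>e. c e * \<alpha> e powr p) summable_on arcs G}"

definition lp_norm :: "real \<Rightarrow> ('e \<Rightarrow> real) \<Rightarrow> real" where
  "lp_norm p \<alpha> = (\<Sum>\<^sub>\<infinity>e \<in> arcs G. c e * \<alpha> e powr p) powr (1 / p)"

lemma lp_sum_nonneg: "0 \<le> (\<Sum>\<^sub>\<infinity>e \<in> arcs G. c e * \<alpha> e powr p)"
  by (rule infsum_nonneg) (auto intro: mult_nonneg_nonneg less_imp_le[OF conductivity_pos])

lemma lp_norm_mono:
  assumes p: "1 \<le> p" and B: "0 \<le> B" and le: "(\<Sum>\<^sub>\<infinity>e \<in> arcs G. c e * \<beta> e powr p) \<le> B powr p * (\<Sum>\<^sub>\<infinity>e \<in> arcs G. c e * \<alpha> e powr p)"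
  shows "lp_norm p \<beta> \<le> B * lp_norm p \<alpha>"
proof -
  have "lp_norm p \<beta> \<le> (B powr p * (\<Sum>\<^sub>\<infinity>e \<in> arcs G. c e * \<alpha> e powr p)) powr (1 / p)"
    unfolding lp_norm_def using p le lp_sum_nonneg by (intro powr_mono2) auto
  also have "\<dots> = B * lp_norm p \<alpha>"
    using p B lp_sum_nonneg unfolding lp_norm_def by (simp add: powr_mult powr_powr)
  finally show ?thesis .
qed

text \<open>Schur test: row sums are bounded by \<open>exp_edist_summable\<close>, and for column
  sums with respect to the weights \<open>c\<close> half of the decay pays for replacing
  \<open>c e\<close> by \<open>c e'\<close>. Jensen's inequality, in the form of
  \<open>powr_le_of_parametric_bound\<close>, reduces the power of a sum to a sum of powers.\<close>

lemma lp_kernel: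
  assumes p: "1 \<le> p" and \<delta>: "0 < \<delta>"
  shows "\<exists>K>0. \<forall>\<alpha> \<in> lp_seq p.
      (\<forall>e \<in> arcs G. (\<lambda>e'. exp (- \<delta> * edist e e') * \<alpha> e') summable_on arcs G) \<and>
      kernel_sum \<delta> \<alpha> \<in> lp_seq p \<and> lp_norm p (kernel_sum \<delta> \<alpha>) \<le> K * lp_norm p \<alpha>"
proof -
  obtain A where A: "0 < A" "\<And>e. e \<in> arcs G \<Longrightarrow> (\<lambda>e'. exp (- \<delta> * edist e e')) summable_on arcs G"
    "\<And>e. e \<in> arcs G \<Longrightarrow> (\<Sum>\<^sub>\<infinity>e' \<in> arcs G. exp (- \<delta> * edist e e')) \<le> A"
    using exp_edist_summable[OF \<delta>] by blast
  obtain A' where A': "0 < A'" "\<And>e. e \<in> arcs G \<Longrightarrow> (\<lambda>e'. exp (- (\<delta> / 2) * edist e e')) summable_on arcs G"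
    "\<And>e. e \<in> arcs G \<Longrightarrow> (\<Sum>\<^sub>\<infinity>e' \<in> arcs G. exp (- (\<delta> / 2) * edist e e')) \<le> A'"
    using exp_edist_summable[of "\<delta> / 2"] \<delta> by auto
  obtain D where D: "0 < D" "\<And>e e'. e \<in> arcs G \<Longrightarrow> e' \<in> arcs G \<Longrightarrow> c e' \<le> D * exp (\<delta> / 2 * edist e e') * c e"
    using conductivity_ratio[of "\<delta> / 2"] \<delta> by auto
  have ck: "c e * exp (- \<delta> * edist e e') \<le> D * c e' * exp (- (\<delta> / 2) * edist e' e)"
    if e: "e \<in> arcs G" "e' \<in> arcs G" for e e'
  proof -
    have "c e * exp (- \<delta> * edist e e') \<le> D * exp (\<delta> / 2 * edist e' e) * c e' * exp (- \<delta> * edist e e')"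
      by (rule mult_right_mono[OF D(2)[OF e(2,1)]]) simp
    also have "\<dots> = D * c e' * (exp (\<delta> / 2 * edist e' e) * exp (- \<delta> * edist e' e))"
      by (simp add: edist_commute[of e e'])
    also have "exp (\<delta> / 2 * edist e' e) * exp (- \<delta> * edist e' e) = exp (- (\<delta> / 2) * edist e' e)"
      unfolding exp_add[symmetric] by (rule arg_cong[of _ _ exp]) (simp add: field_simps)
    finally show ?thesis .
  qed
  \<comment> \<open>The constant from Jensen's inequality times the bound of the weighted column
    sums.\<close>
  define B where "B = (2 * A) powr p / A * (D * A')"
  have B: "0 < B" using A A' D by (simp add: B_def)
  show ?thesis
  proof (intro exI[of _ "B powr (1 / p)"] conjI[of "0 < B powr (1 / p)"] ballI)
    show "0 < B powr (1 / p)" using B by simp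
    fix \<alpha> assume \<alpha>: "\<alpha> \<in> lp_seq p"
    then have \<alpha>0: "\<And>e. e \<in> arcs G \<Longrightarrow> 0 \<le> \<alpha> e" and \<alpha>s: "(\<lambda>e. c e * \<alpha> e powr p) summable_on arcs G"
      by (auto simp: lp_seq_def)
    \<comment> \<open>A bound for the total contribution of the entry at \<open>e'\<close>, the
      weight being already moved from \<open>e\<close> to \<open>e'\<close>.\<close>
    define s where "s = (\<lambda>e'. \<Sum>\<^sub>\<infinity>e \<in> arcs G. D * (c e' * \<alpha> e' powr p) * exp (- (\<delta> / 2) * edist e' e))"
    have s_le: "s e' \<le> D * A' * (c e' * \<alpha> e' powr p)" and s0: "0 \<le> s e'" if e': "e' \<in> arcs G" for e'
    proof -
      have "s e' = D * (c e' * \<alpha> e' powr p) * (\<Sum>\<^sub>\<infinity>e \<in> arcs G. exp (- (\<delta> / 2) * edist e' e))"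
        unfolding s_def by (rule infsum_cmult_right) (use A'(2)[OF e'] in simp)
      also have "\<dots> \<le> D * (c e' * \<alpha> e' powr p) * A'"
        using D conductivity_pos[OF e'] by (intro mult_left_mono A' e') auto
      finally show "s e' \<le> D * A' * (c e' * \<alpha> e' powr p)" by (simp add: mult_ac)
      show "0 \<le> s e'" unfolding s_def
        by (rule infsum_nonneg) (use D conductivity_pos[OF e'] in auto)
    qed
    have ss: "s summable_on arcs G"
      by (rule summable_on_comparison_test[OF summable_on_cmult_right[OF \<alpha>s, of "D * A'"]]) (use s_le s0 in auto)
    \<comment> \<open>A summable majorant of the double series, which permits exchanging rows and
      columns.\<close>
    have H: "(\<lambda>(e', e). D * (c e' * \<alpha> e' powr p) * exp (- (\<delta> / 2) * edist e' e)) summable_on arcs G \<times> arcs G"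
    proof (rule summable_on_SigmaI[OF _ ss])
      fix e' assume e': "e' \<in> arcs G"
      have "(\<lambda>e. D * (c e' * \<alpha> e' powr p) * exp (- (\<delta> / 2) * edist e' e)) summable_on arcs G"
        by (intro summable_on_cmult_right A' e')
      then show "((\<lambda>y. case (e', y) of (e', e) \<Rightarrow> D * (c e' * \<alpha> e' powr p) * exp (- (\<delta> / 2) * edist e' e)) has_sum s e') (arcs G)"
        unfolding s_def using has_sum_infsum by simp
    qed (use D conductivity_pos in \<open>auto intro!: mult_nonneg_nonneg simp: less_imp_le\<close>)
    define F where "F e e' = c e * (exp (- \<delta> * edist e e') * \<alpha> e' powr p)" for e e'
    have F0: "0 \<le> F e e'" if "e \<in> arcs G" for e e'
      using conductivity_pos[OF that] by (simp add: F_def)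
    have F_le: "F e e' \<le> D * (c e' * \<alpha> e' powr p) * exp (- (\<delta> / 2) * edist e' e)"
      if "e \<in> arcs G" "e' \<in> arcs G" for e e'
    proof -
      have "F e e' = (c e * exp (- \<delta> * edist e e')) * \<alpha> e' powr p" by (simp add: F_def)
      also have "\<dots> \<le> (D * c e' * exp (- (\<delta> / 2) * edist e' e)) * \<alpha> e' powr p"
        by (rule mult_right_mono[OF ck[OF that]]) simp
      finally show ?thesis by (simp add: mult_ac)
    qed
    have FS': "(\<lambda>(e', e). F e e') summable_on arcs G \<times> arcs G"
      by (rule summable_on_comparison_test[OF H]) (use F_le F0 in auto)
    then have FS: "(\<lambda>(e, e'). F e e') summable_on arcs G \<times> arcs G"
      using summable_on_swap[of "\<lambda>(e, e'). F e e'" "arcs G" "arcs G"] by simp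
    have Fe: "F e summable_on arcs G" if e: "e \<in> arcs G" for e
      using summable_on_Sigma_banach[OF FS] summable_on_SigmaD1[OF FS] e F0 by auto
    define \<sigma> where "\<sigma> e = (\<Sum>\<^sub>\<infinity>e' \<in> arcs G. exp (- \<delta> * edist e e') * \<alpha> e' powr p)" for e
    have c\<sigma>: "c e * \<sigma> e = infsum (F e) (arcs G)" for e
      unfolding \<sigma>_def F_def by (rule infsum_cmult_right'[symmetric])
    have ks: "(\<lambda>e'. exp (- \<delta> * edist e e') * \<alpha> e' powr p) summable_on arcs G" if e: "e \<in> arcs G" for e
      using summable_on_cmult_right[OF Fe[OF e], of "1 / c e"] conductivity_pos[OF e]
      by (simp add: F_def)
    have \<sigma>0: "0 \<le> \<sigma> e" for e unfolding \<sigma>_def by (rule infsum_nonneg) simp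
    have k_le: "exp (- \<delta> * edist e e') * \<alpha> e' \<le> r * exp (- \<delta> * edist e e') + r powr (1 - p) * (exp (- \<delta> * edist e e') * \<alpha> e' powr p)"
      if "e' \<in> arcs G" "0 < r" for e e' r
    proof -
      have "exp (- \<delta> * edist e e') * \<alpha> e' \<le> exp (- \<delta> * edist e e') * (r + r powr (1 - p) * \<alpha> e' powr p)"
        using le_plus_powr[OF \<alpha>0[OF that(1)] that(2) p] by (intro mult_left_mono) auto
      then show ?thesis by (simp add: algebra_simps)
    qed
    have rs: "(\<lambda>e'. r * exp (- \<delta> * edist e e') + r powr (1 - p) * (exp (- \<delta> * edist e e') * \<alpha> e' powr p)) summable_on arcs G"
      if "e \<in> arcs G" for e r
      by (intro summable_on_add summable_on_cmult_right A ks that)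
    have k\<alpha>: "(\<lambda>e'. exp (- \<delta> * edist e e') * \<alpha> e') summable_on arcs G" if e: "e \<in> arcs G" for e
      by (rule summable_on_comparison_test[OF rs[OF e, of 1]]) (use k_le[of _ 1 e] \<alpha>0 in auto)
    have kn: "0 \<le> kernel_sum \<delta> \<alpha> e" for e
      unfolding kernel_sum_def by (rule infsum_nonneg) (use \<alpha>0 in auto)
    \<comment> \<open>Jensen's inequality: the row has mass at most \<open>A\<close>, and the
      optimised parameter costs a factor \<open>2\<close> before the power is taken.\<close>
    have kb: "kernel_sum \<delta> \<alpha> e powr p \<le> (2 * A) powr p / A * \<sigma> e" if e: "e \<in> arcs G" for e
    proof -
      have "kernel_sum \<delta> \<alpha> e \<le> 2 * A * (\<sigma> e / A) powr (1 / p)"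
      proof (rule powr_le_of_parametric_bound[OF p A(1) \<sigma>0])
        fix r :: real assume r: "0 < r"
        have "kernel_sum \<delta> \<alpha> e \<le> (\<Sum>\<^sub>\<infinity>e' \<in> arcs G. r * exp (- \<delta> * edist e e') + r powr (1 - p) * (exp (- \<delta> * edist e e') * \<alpha> e' powr p))"
          unfolding kernel_sum_def by (rule infsum_mono[OF k\<alpha>[OF e] rs[OF e] k_le[OF _ r]])
        also have "\<dots> = r * (\<Sum>\<^sub>\<infinity>e' \<in> arcs G. exp (- \<delta> * edist e e')) + r powr (1 - p) * \<sigma> e"
          unfolding \<sigma>_def
          by (simp only: infsum_cmult_right'
              infsum_add[OF summable_on_cmult_right[OF A(2)[OF e]] summable_on_cmult_right[OF ks[OF e]]])
        also have "\<dots> \<le> r * A + r powr (1 - p) * \<sigma> e"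
          using A(3)[OF e] r by simp
        finally show "kernel_sum \<delta> \<alpha> e \<le> r * A + r powr (1 - p) * \<sigma> e" .
      qed
      then have "kernel_sum \<delta> \<alpha> e powr p \<le> (2 * A * (\<sigma> e / A) powr (1 / p)) powr p"
        using p kn by (intro powr_mono2) auto
      also have "\<dots> = (2 * A) powr p * (\<sigma> e / A)"
        using p A \<sigma>0[of e] by (simp add: powr_mult powr_powr)
      finally show ?thesis by simp
    qed
    have c\<sigma>s: "(\<lambda>e. c e * \<sigma> e) summable_on arcs G"
      unfolding c\<sigma> using summable_on_Sigma_banach[OF FS] by simp
    have "(\<Sum>\<^sub>\<infinity>e \<in> arcs G. c e * \<sigma> e) = (\<Sum>\<^sub>\<infinity>e' \<in> arcs G. \<Sum>\<^sub>\<infinity>e \<in> arcs G. F e e')"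
      unfolding c\<sigma> by (rule infsum_swap_banach[OF FS])
    also have "\<dots> \<le> infsum s (arcs G)"
    proof (rule infsum_mono[OF _ ss])
      show "(\<lambda>e'. \<Sum>\<^sub>\<infinity>e \<in> arcs G. F e e') summable_on arcs G" using summable_on_Sigma_banach[OF FS'] by simp
      fix e' assume e': "e' \<in> arcs G"
      have "(\<lambda>e. D * (c e' * \<alpha> e' powr p) * exp (- (\<delta> / 2) * edist e' e)) summable_on arcs G"
        by (intro summable_on_cmult_right A' e')
      moreover from this have "(\<lambda>e. F e e') summable_on arcs G"
        by (rule summable_on_comparison_test) (use F_le F0 e' in auto)
      ultimately show "(\<Sum>\<^sub>\<infinity>e \<in> arcs G. F e e') \<le> s e'" unfolding s_def by (intro infsum_mono F_le e')
    qed
    also have "\<dots> \<le> (\<Sum>\<^sub>\<infinity>e' \<in> arcs G. D * A' * (c e' * \<alpha> e' powr p))"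
      by (rule infsum_mono[OF ss summable_on_cmult_right[OF \<alpha>s] s_le])
    also have "\<dots> = D * A' * (\<Sum>\<^sub>\<infinity>e' \<in> arcs G. c e' * \<alpha> e' powr p)" by (rule infsum_cmult_right')
    finally have sum_c\<sigma>: "(\<Sum>\<^sub>\<infinity>e \<in> arcs G. c e * \<sigma> e) \<le> D * A' * (\<Sum>\<^sub>\<infinity>e' \<in> arcs G. c e' * \<alpha> e' powr p)" .
    have cK_le: "c e * kernel_sum \<delta> \<alpha> e powr p \<le> (2 * A) powr p / A * (c e * \<sigma> e)" if e: "e \<in> arcs G" for e
      using mult_left_mono[OF kb[OF e] less_imp_le[OF conductivity_pos[OF e]]] by (simp add: mult_ac)
    have Ks: "(\<lambda>e. c e * kernel_sum \<delta> \<alpha> e powr p) summable_on arcs G"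
      by (rule summable_on_comparison_test[OF summable_on_cmult_right[OF c\<sigma>s] cK_le])
        (auto intro: mult_nonneg_nonneg less_imp_le[OF conductivity_pos])
    have "(\<Sum>\<^sub>\<infinity>e \<in> arcs G. c e * kernel_sum \<delta> \<alpha> e powr p) \<le> (\<Sum>\<^sub>\<infinity>e \<in> arcs G. (2 * A) powr p / A * (c e * \<sigma> e))"
      by (rule infsum_mono[OF Ks summable_on_cmult_right[OF c\<sigma>s] cK_le])
    also have "\<dots> = (2 * A) powr p / A * (\<Sum>\<^sub>\<infinity>e \<in> arcs G. c e * \<sigma> e)" by (rule infsum_cmult_right')
    also have "\<dots> \<le> (2 * A) powr p / A * (D * A' * (\<Sum>\<^sub>\<infinity>e' \<in> arcs G. c e' * \<alpha> e' powr p))"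
      using A by (intro mult_left_mono sum_c\<sigma>) auto
    also have "\<dots> = B * (\<Sum>\<^sub>\<infinity>e' \<in> arcs G. c e' * \<alpha> e' powr p)"
      by (simp add: B_def mult.assoc)
    also have "B = (B powr (1 / p)) powr p" using B p by (simp add: powr_powr)
    finally have "lp_norm p (kernel_sum \<delta> \<alpha>) \<le> B powr (1 / p) * lp_norm p \<alpha>"
      by (intro lp_norm_mono p) auto
    then show "(\<forall>e \<in> arcs G. (\<lambda>e'. exp (- \<delta> * edist e e') * \<alpha> e') summable_on arcs G) \<and>
      kernel_sum \<delta> \<alpha> \<in> lp_seq p \<and> lp_norm p (kernel_sum \<delta> \<alpha>) \<le> B powr (1 / p) * lp_norm p \<alpha>"
      using k\<alpha> kn Ks by (auto simp: lp_seq_def)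
  qed
qed

lemma lp_unit_sum: "e \<in> arcs G \<Longrightarrow> ((\<lambda>e'. c e' * indicator {e} e' powr p) has_sum c e) (arcs G)"
  by (rule has_sum_finite_neutralI[of "{e}"]) (auto simp: indicator_def)

lemma lp_edge_sequence_space:
  assumes p: "1 \<le> p"
  shows "edge_sequence_space G c (lp_seq p) (lp_norm p)"
proof (intro_locales, unfold_locales)
  fix \<alpha> assume \<alpha>: "\<alpha> \<in> lp_seq p"
  then have \<alpha>0: "\<And>e. e \<in> arcs G \<Longrightarrow> 0 \<le> \<alpha> e" and \<alpha>s: "(\<lambda>e. c e * \<alpha> e powr p) summable_on arcs G"
    by (auto simp: lp_seq_def)
  show "0 \<le> \<alpha> e" if "e \<in> arcs G" for e by (rule \<alpha>0[OF that])
  show "\<beta> \<in> lp_seq p \<and> lp_norm p \<beta> \<le> lp_norm p \<alpha>" if \<beta>: "\<And>e. e \<in> arcs G \<Longrightarrow> 0 \<le> \<beta> e \<and> \<beta> e \<le> \<alpha> e" for \<beta>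
  proof -
    have le: "c e * \<beta> e powr p \<le> c e * \<alpha> e powr p" if "e \<in> arcs G" for e
      using \<beta>[OF that] p conductivity_pos[OF that] by (intro mult_left_mono powr_mono2) auto
    have s: "(\<lambda>e. c e * \<beta> e powr p) summable_on arcs G"
      by (rule summable_on_comparison_test[OF \<alpha>s le]) (auto intro: mult_nonneg_nonneg less_imp_le[OF conductivity_pos])
    have "lp_norm p \<beta> \<le> 1 * lp_norm p \<alpha>"
      by (rule lp_norm_mono[OF p]) (use infsum_mono[OF s \<alpha>s le] in auto)
    then show ?thesis using s \<beta> by (auto simp: lp_seq_def)
  qed
  show "(\<lambda>e. t * \<alpha> e) \<in> lp_seq p \<and> lp_norm p (\<lambda>e. t * \<alpha> e) = t * lp_norm p \<alpha>" if t: "0 \<le> t" for t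
  proof -
    have eq: "c e * (t * \<alpha> e) powr p = t powr p * (c e * \<alpha> e powr p)" if "e \<in> arcs G" for e
      using \<alpha>0[OF that] t by (simp add: powr_mult)
    have "(\<lambda>e. c e * (t * \<alpha> e) powr p) summable_on arcs G"
      by (rule summable_on_cong[THEN iffD2, OF eq summable_on_cmult_right[OF \<alpha>s]])
    moreover have "lp_norm p (\<lambda>e. t * \<alpha> e) = (t powr p * (\<Sum>\<^sub>\<infinity>e \<in> arcs G. c e * \<alpha> e powr p)) powr (1 / p)"
      unfolding lp_norm_def infsum_cmult_right'[symmetric] by (simp only: eq cong: infsum_cong)
    moreover have "\<dots> = t * lp_norm p \<alpha>"
      using t p lp_sum_nonneg by (simp add: lp_norm_def powr_mult powr_powr)
    ultimately show ?thesis using \<alpha>0 t by (auto simp: lp_seq_def)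
  qed
  show "(\<lambda>e. \<alpha> e + \<beta> e) \<in> lp_seq p \<and> lp_norm p (\<lambda>e. \<alpha> e + \<beta> e) \<le> 4 * (lp_norm p \<alpha> + lp_norm p \<beta>)"
    if \<beta>: "\<beta> \<in> lp_seq p" for \<beta>
  proof -
    have \<beta>0: "\<And>e. e \<in> arcs G \<Longrightarrow> 0 \<le> \<beta> e" and \<beta>s: "(\<lambda>e. c e * \<beta> e powr p) summable_on arcs G"
      using \<beta> by (auto simp: lp_seq_def)
    let ?a = "\<Sum>\<^sub>\<infinity>e \<in> arcs G. c e * \<alpha> e powr p" and ?b = "\<Sum>\<^sub>\<infinity>e \<in> arcs G. c e * \<beta> e powr p"
    have le: "c e * (\<alpha> e + \<beta> e) powr p \<le> 2 powr p * (c e * \<alpha> e powr p + c e * \<beta> e powr p)" if e: "e \<in> arcs G" for e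
      using mult_left_mono[OF powr_add_le[OF \<alpha>0[OF e] \<beta>0[OF e], of p] less_imp_le[OF conductivity_pos[OF e]]] p
      by (simp add: algebra_simps)
    note rs = summable_on_cmult_right[OF summable_on_add[OF \<alpha>s \<beta>s], of "2 powr p"]
    have s: "(\<lambda>e. c e * (\<alpha> e + \<beta> e) powr p) summable_on arcs G"
      by (rule summable_on_comparison_test[OF rs le])
        (auto intro: mult_nonneg_nonneg less_imp_le[OF conductivity_pos])
    have "(\<Sum>\<^sub>\<infinity>e \<in> arcs G. c e * (\<alpha> e + \<beta> e) powr p) \<le> 2 powr p * (?a + ?b)"
      using infsum_mono[OF s rs le] by (simp add: infsum_cmult_right' infsum_add[OF \<alpha>s \<beta>s])
    \<comment> \<open>Since \<open>p \<ge> 1\<close>, the sum is at most \<open>2 powr p\<close>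
      times the maximum. The two powers combine to \<open>4 powr p\<close>, whose root is the
      constant \<open>4\<close> of the axiom \<open>add\<close>.\<close>
    also have "\<dots> \<le> 2 powr p * (2 powr p * max ?a ?b)"
    proof (intro mult_left_mono)
      have "2 powr 1 \<le> 2 powr p" using p by (intro powr_mono) auto
      then have "2 * max ?a ?b \<le> 2 powr p * max ?a ?b"
        using lp_sum_nonneg[of \<alpha> p] by (intro mult_right_mono) auto
      then show "?a + ?b \<le> 2 powr p * max ?a ?b" by simp
    qed simp
    also have "\<dots> = 4 powr p * max ?a ?b" by (simp add: powr_mult[symmetric] flip: mult.assoc)
    finally have key: "(\<Sum>\<^sub>\<infinity>e \<in> arcs G. c e * (\<alpha> e + \<beta> e) powr p) \<le> 4 powr p * max ?a ?b" .
    have nn: "0 \<le> lp_norm p \<alpha>" "0 \<le> lp_norm p \<beta>" by (simp_all add: lp_norm_def)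
    have "lp_norm p (\<lambda>e. \<alpha> e + \<beta> e) \<le> 4 * lp_norm p \<alpha> \<or> lp_norm p (\<lambda>e. \<alpha> e + \<beta> e) \<le> 4 * lp_norm p \<beta>"
      using key lp_norm_mono[OF p, of 4 "\<lambda>e. \<alpha> e + \<beta> e" \<alpha>] lp_norm_mono[OF p, of 4 "\<lambda>e. \<alpha> e + \<beta> e" \<beta>]
      by (auto simp: max_def split: if_splits)
    then have "lp_norm p (\<lambda>e. \<alpha> e + \<beta> e) \<le> 4 * (lp_norm p \<alpha> + lp_norm p \<beta>)" using nn by auto
    then show ?thesis using s \<alpha>0 \<beta>0 by (auto simp: lp_seq_def)
  qed
next
  show "\<exists>K>0. \<forall>\<alpha> \<in> lp_seq p.
      (\<forall>e \<in> arcs G. (\<lambda>e'. exp (- \<delta> * edist e e') * \<alpha> e') summable_on arcs G) \<and>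
      kernel_sum \<delta> \<alpha> \<in> lp_seq p \<and> lp_norm p (kernel_sum \<delta> \<alpha>) \<le> K * lp_norm p \<alpha>" if "0 < \<delta>" for \<delta>
    by (rule lp_kernel[OF p that])
next
  have N: "lp_norm p (indicator {e}) = c e powr (1 / p)" if "e \<in> arcs G" for e
    unfolding lp_norm_def using infsumI[OF lp_unit_sum[OF that]] by simp
  show "indicator {e} \<in> lp_seq p \<and> 0 < lp_norm p (indicator {e})" if e: "e \<in> arcs G" for e
    using has_sum_imp_summable[OF lp_unit_sum[OF e, of p]] N[OF e] conductivity_pos[OF e] by (simp add: lp_seq_def)
  show "\<exists>K>0. \<forall>e \<in> arcs G. \<forall>e' \<in> arcs G.
      lp_norm p (indicator {e'}) \<le> K * exp (\<epsilon> * edist e e') * lp_norm p (indicator {e})" if \<epsilon>: "0 < \<epsilon>" for \<epsilon>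
  proof -
    obtain D where D: "0 < D" "\<And>e e'. e \<in> arcs G \<Longrightarrow> e' \<in> arcs G \<Longrightarrow> c e' \<le> D * exp (\<epsilon> * edist e e') * c e"
      using conductivity_ratio[OF \<epsilon>] by auto
    show ?thesis
    proof (intro exI[of _ "D powr (1 / p)"] conjI ballI)
      show "0 < D powr (1 / p)" using D by simp
      fix e e' assume e: "e \<in> arcs G" "e' \<in> arcs G"
      have "c e' powr (1 / p) \<le> (D * exp (\<epsilon> * edist e e') * c e) powr (1 / p)"
        using D(2)[OF e] conductivity_pos[OF e(2)] p by (intro powr_mono2) auto
      also have "\<dots> = D powr (1 / p) * exp (\<epsilon> * edist e e' / p) * c e powr (1 / p)"
        using D(1) conductivity_pos[OF e(1)] by (simp add: powr_mult exp_powr_real)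
      also have "\<dots> \<le> D powr (1 / p) * exp (\<epsilon> * edist e e') * c e powr (1 / p)"
      proof (intro mult_right_mono mult_left_mono)
        have "\<epsilon> * edist e e' / p \<le> \<epsilon> * edist e e' / 1"
          using p \<epsilon> edist_nonneg[of e e'] by (intro divide_left_mono) auto
        then show "exp (\<epsilon> * edist e e' / p) \<le> exp (\<epsilon> * edist e e')" by simp
      qed auto
      finally show "lp_norm p (indicator {e'}) \<le> D powr (1 / p) * exp (\<epsilon> * edist e e') * lp_norm p (indicator {e})"
        by (simp add: N e)
    qed
  qed
qed


section \<open>Bounded sequences and null sequences\<close>

definition bounded_seq :: "('e \<Rightarrow> real) set" where
  "bounded_seq = {\<alpha>. (\<forall>e \<in> arcs G. 0 \<le> \<alpha> e) \<and> bdd_above (\<alpha> ` arcs G)}"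

definition null_seq :: "('e \<Rightarrow> real) set" where
  "null_seq = {\<alpha> \<in> bounded_seq. \<forall>\<epsilon>>0. finite {e \<in> arcs G. \<epsilon> \<le> \<alpha> e}}"

definition sup_seq :: "('e \<Rightarrow> real) \<Rightarrow> real" where
  "sup_seq \<alpha> = (SUP e \<in> arcs G. \<alpha> e)"

lemma sup_seq_upper: "\<alpha> \<in> bounded_seq \<Longrightarrow> e \<in> arcs G \<Longrightarrow> \<alpha> e \<le> sup_seq \<alpha>"
  unfolding sup_seq_def bounded_seq_def by (auto intro: cSUP_upper)

lemma sup_seq_least: "(\<And>e. e \<in> arcs G \<Longrightarrow> \<alpha> e \<le> B) \<Longrightarrow> sup_seq \<alpha> \<le> B"
  unfolding sup_seq_def using nonempty_arcs by (auto intro: cSUP_least)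

lemma bounded_seqI: "(\<And>e. e \<in> arcs G \<Longrightarrow> 0 \<le> \<alpha> e \<and> \<alpha> e \<le> B) \<Longrightarrow> \<alpha> \<in> bounded_seq"
  unfolding bounded_seq_def by (auto intro!: bdd_aboveI[of _ B])

lemma sup_seq_nonneg: "\<alpha> \<in> bounded_seq \<Longrightarrow> 0 \<le> sup_seq \<alpha>"
proof -
  assume \<alpha>: "\<alpha> \<in> bounded_seq"
  obtain e where e: "e \<in> arcs G" using nonempty_arcs by auto
  have "0 \<le> \<alpha> e" using \<alpha> e by (simp add: bounded_seq_def)
  also have "\<dots> \<le> sup_seq \<alpha>" by (rule sup_seq_upper[OF \<alpha> e])
  finally show ?thesis .
qed

lemma sup_unit: "e \<in> arcs G \<Longrightarrow> sup_seq (indicator {e}) = 1"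
proof (rule antisym)
  assume e: "e \<in> arcs G"
  show "sup_seq (indicator {e}) \<le> 1" by (rule sup_seq_least) (auto simp: indicator_def)
  have "indicator {e} e \<le> sup_seq (indicator {e})"
    by (rule sup_seq_upper[OF bounded_seqI[of _ 1] e]) (auto simp: indicator_def)
  then show "1 \<le> sup_seq (indicator {e})" by simp
qed

text \<open>The last conjunct separates a finite set \<open>F\<close> from the entries of size at
  most \<eta>. With \<open>F\<close> empty it gives the bound in the sup norm; with \<open>F\<close>
  the set of large entries it shows in \<open>null_kernel\<close> that null sequences are
  preserved.\<close>

lemma sup_kernel:
  assumes \<delta>: "0 < \<delta>"
  shows "\<exists>K>0. \<forall>\<alpha> \<in> bounded_seq.
      (\<forall>e \<in> arcs G. (\<lambda>e'. exp (- \<delta> * edist e e') * \<alpha> e') summable_on arcs G) \<and>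
      kernel_sum \<delta> \<alpha> \<in> bounded_seq \<and> sup_seq (kernel_sum \<delta> \<alpha>) \<le> K * sup_seq \<alpha> \<and>
      (\<forall>e \<in> arcs G. \<forall>\<eta>\<ge>0. \<forall>F. finite F \<and> F \<subseteq> arcs G \<and> (\<forall>e' \<in> arcs G - F. \<alpha> e' \<le> \<eta>) \<longrightarrow>
        kernel_sum \<delta> \<alpha> e \<le> \<eta> * K + sup_seq \<alpha> * (\<Sum>e' \<in> F. exp (- \<delta> * edist e e')))"
proof -
  obtain A where A: "0 < A" "\<And>e. e \<in> arcs G \<Longrightarrow> (\<lambda>e'. exp (- \<delta> * edist e e')) summable_on arcs G"
    "\<And>e. e \<in> arcs G \<Longrightarrow> (\<Sum>\<^sub>\<infinity>e' \<in> arcs G. exp (- \<delta> * edist e e')) \<le> A"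
    using exp_edist_summable[OF \<delta>] by blast
  show ?thesis
  proof (intro exI[of _ A] conjI[OF A(1)] conjI ballI)
    fix \<alpha> assume \<alpha>: "\<alpha> \<in> bounded_seq"
    then have \<alpha>0: "\<And>e. e \<in> arcs G \<Longrightarrow> 0 \<le> \<alpha> e" by (simp add: bounded_seq_def)
    note up = sup_seq_upper[OF \<alpha>]
    have k_le: "exp (- \<delta> * edist e e') * \<alpha> e' \<le> sup_seq \<alpha> * exp (- \<delta> * edist e e')" if "e' \<in> arcs G" for e e'
      using mult_left_mono[OF up[OF that], of "exp (- \<delta> * edist e e')"] by (simp add: mult.commute)
    have ks: "(\<lambda>e'. exp (- \<delta> * edist e e') * \<alpha> e') summable_on arcs G" if e: "e \<in> arcs G" for e
      by (rule summable_on_comparison_test[OF summable_on_cmult_right[OF A(2)[OF e]] k_le]) (use \<alpha>0 in auto)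
    have kn: "0 \<le> kernel_sum \<delta> \<alpha> e" for e
      unfolding kernel_sum_def by (rule infsum_nonneg) (use \<alpha>0 in auto)
    have tail: "kernel_sum \<delta> \<alpha> e \<le> \<eta> * A + sup_seq \<alpha> * (\<Sum>e' \<in> F. exp (- \<delta> * edist e e'))"
      if e: "e \<in> arcs G" and \<eta>: "0 \<le> \<eta>" and F: "finite F" "F \<subseteq> arcs G" "\<forall>e' \<in> arcs G - F. \<alpha> e' \<le> \<eta>" for e \<eta> F
    proof -
      let ?k = "\<lambda>e'. exp (- \<delta> * edist e e')"
      have ind: "((\<lambda>e'. if e' \<in> F then sup_seq \<alpha> * ?k e' else 0) has_sum (\<Sum>e' \<in> F. sup_seq \<alpha> * ?k e')) (arcs G)"
        by (rule has_sum_finite_neutralI[OF F(1,2)]) auto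
      note s = summable_on_cmult_right[OF A(2)[OF e], of \<eta>]
      have le: "?k e' * \<alpha> e' \<le> \<eta> * ?k e' + (if e' \<in> F then sup_seq \<alpha> * ?k e' else 0)" if e': "e' \<in> arcs G" for e'
      proof (cases "e' \<in> F")
        case True
        then show ?thesis using k_le[OF e', of e] \<eta> by (auto intro: add_increasing)
      next
        case False
        then have "?k e' * \<alpha> e' \<le> ?k e' * \<eta>" using F(3) e' by (intro mult_left_mono) auto
        then show ?thesis using False by (simp add: mult.commute)
      qed
      have "kernel_sum \<delta> \<alpha> e \<le> (\<Sum>\<^sub>\<infinity>e' \<in> arcs G. \<eta> * ?k e' + (if e' \<in> F then sup_seq \<alpha> * ?k e' else 0))"
        unfolding kernel_sum_def by (rule infsum_mono[OF ks[OF e] summable_on_add[OF s has_sum_imp_summable[OF ind]] le])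
      also have "\<dots> = \<eta> * (\<Sum>\<^sub>\<infinity>e' \<in> arcs G. ?k e') + (\<Sum>e' \<in> F. sup_seq \<alpha> * ?k e')"
        by (simp only: infsum_add[OF s has_sum_imp_summable[OF ind]] infsum_cmult_right' infsumI[OF ind])
      also have "\<dots> \<le> \<eta> * A + (\<Sum>e' \<in> F. sup_seq \<alpha> * ?k e')" using A(3)[OF e] \<eta> by (intro add_mono mult_left_mono) auto
      finally show ?thesis by (simp add: sum_distrib_left)
    qed
    have kb: "kernel_sum \<delta> \<alpha> e \<le> A * sup_seq \<alpha>" if "e \<in> arcs G" for e
      using tail[OF that sup_seq_nonneg[OF \<alpha>], of "{}"] up by (simp add: mult.commute)
    show "(\<lambda>e'. exp (- \<delta> * edist e e') * \<alpha> e') summable_on arcs G" if "e \<in> arcs G" for e by (rule ks[OF that])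
    show "kernel_sum \<delta> \<alpha> \<in> bounded_seq" using kn kb by (intro bounded_seqI[of _ "A * sup_seq \<alpha>"]) auto
    show "sup_seq (kernel_sum \<delta> \<alpha>) \<le> A * sup_seq \<alpha>" by (rule sup_seq_least[OF kb])
    show "\<forall>\<eta>\<ge>0. \<forall>F. finite F \<and> F \<subseteq> arcs G \<and> (\<forall>e' \<in> arcs G - F. \<alpha> e' \<le> \<eta>) \<longrightarrow>
        kernel_sum \<delta> \<alpha> e \<le> \<eta> * A + sup_seq \<alpha> * (\<Sum>e' \<in> F. exp (- \<delta> * edist e e'))" if "e \<in> arcs G" for e
      using tail[OF that] by simp
  qed
qed

lemma sup_edge_sequence_space: "edge_sequence_space G c bounded_seq sup_seq"
proof (intro_locales, unfold_locales)
  fix \<alpha> assume \<alpha>: "\<alpha> \<in> bounded_seq"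
  then have \<alpha>0: "\<And>e. e \<in> arcs G \<Longrightarrow> 0 \<le> \<alpha> e" by (simp add: bounded_seq_def)
  note up = sup_seq_upper[OF \<alpha>]
  show "0 \<le> \<alpha> e" if "e \<in> arcs G" for e by (rule \<alpha>0[OF that])
  show "\<beta> \<in> bounded_seq \<and> sup_seq \<beta> \<le> sup_seq \<alpha>" if \<beta>: "\<And>e. e \<in> arcs G \<Longrightarrow> 0 \<le> \<beta> e \<and> \<beta> e \<le> \<alpha> e" for \<beta>
    using \<beta> up by (intro conjI bounded_seqI[of _ "sup_seq \<alpha>"] sup_seq_least) fastforce+
  show "(\<lambda>e. t * \<alpha> e) \<in> bounded_seq \<and> sup_seq (\<lambda>e. t * \<alpha> e) = t * sup_seq \<alpha>" if t: "0 \<le> t" for t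
  proof -
    have m: "(\<lambda>e. t * \<alpha> e) \<in> bounded_seq"
      using up \<alpha>0 t by (intro bounded_seqI[of _ "t * sup_seq \<alpha>"]) (auto intro: mult_left_mono)
    have "t * sup_seq \<alpha> \<le> sup_seq (\<lambda>e. t * \<alpha> e)"
    proof (cases "t = 0")
      case False
      then have "\<alpha> e \<le> sup_seq (\<lambda>e. t * \<alpha> e) / t" if "e \<in> arcs G" for e
        using sup_seq_upper[OF m that] t by (simp add: field_simps)
      then have "sup_seq \<alpha> \<le> sup_seq (\<lambda>e. t * \<alpha> e) / t" by (rule sup_seq_least)
      then show ?thesis using False t by (simp add: field_simps)
    qed (use sup_seq_nonneg[OF m] in simp)
    moreover have "sup_seq (\<lambda>e. t * \<alpha> e) \<le> t * sup_seq \<alpha>"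
      by (rule sup_seq_least) (use up t in \<open>auto intro: mult_left_mono\<close>)
    ultimately show ?thesis using m by simp
  qed
  show "(\<lambda>e. \<alpha> e + \<beta> e) \<in> bounded_seq \<and> sup_seq (\<lambda>e. \<alpha> e + \<beta> e) \<le> 4 * (sup_seq \<alpha> + sup_seq \<beta>)"
    if \<beta>: "\<beta> \<in> bounded_seq" for \<beta>
  proof -
    have \<beta>0: "\<And>e. e \<in> arcs G \<Longrightarrow> 0 \<le> \<beta> e" using \<beta> by (simp add: bounded_seq_def)
    have le: "\<alpha> e + \<beta> e \<le> sup_seq \<alpha> + sup_seq \<beta>" if "e \<in> arcs G" for e
      using up[OF that] sup_seq_upper[OF \<beta> that] by simp
    have "sup_seq (\<lambda>e. \<alpha> e + \<beta> e) \<le> sup_seq \<alpha> + sup_seq \<beta>" by (rule sup_seq_least[OF le])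
    also have "\<dots> \<le> 4 * (sup_seq \<alpha> + sup_seq \<beta>)"
      using sup_seq_nonneg[OF \<alpha>] sup_seq_nonneg[OF \<beta>] by simp
    finally have "sup_seq (\<lambda>e. \<alpha> e + \<beta> e) \<le> 4 * (sup_seq \<alpha> + sup_seq \<beta>)" .
    then show ?thesis using le \<alpha>0 \<beta>0 by (intro conjI bounded_seqI[of _ "sup_seq \<alpha> + sup_seq \<beta>"]) auto
  qed
next
  show "\<exists>K>0. \<forall>\<alpha> \<in> bounded_seq.
      (\<forall>e \<in> arcs G. (\<lambda>e'. exp (- \<delta> * edist e e') * \<alpha> e') summable_on arcs G) \<and>
      kernel_sum \<delta> \<alpha> \<in> bounded_seq \<and> sup_seq (kernel_sum \<delta> \<alpha>) \<le> K * sup_seq \<alpha>" if "0 < \<delta>" for \<delta>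
  proof -
    from sup_kernel[OF that] obtain K where "0 < K" "\<forall>\<alpha> \<in> bounded_seq.
      (\<forall>e \<in> arcs G. (\<lambda>e'. exp (- \<delta> * edist e e') * \<alpha> e') summable_on arcs G) \<and>
      kernel_sum \<delta> \<alpha> \<in> bounded_seq \<and> sup_seq (kernel_sum \<delta> \<alpha>) \<le> K * sup_seq \<alpha> \<and>
      (\<forall>e \<in> arcs G. \<forall>\<eta>\<ge>0. \<forall>F. finite F \<and> F \<subseteq> arcs G \<and> (\<forall>e' \<in> arcs G - F. \<alpha> e' \<le> \<eta>) \<longrightarrow>
        kernel_sum \<delta> \<alpha> e \<le> \<eta> * K + sup_seq \<alpha> * (\<Sum>e' \<in> F. exp (- \<delta> * edist e e')))"
      by (elim exE conjE)
    then show ?thesis by (intro exI[of _ K]) simp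
  qed
next
  show "indicator {e} \<in> bounded_seq \<and> 0 < sup_seq (indicator {e})" if e: "e \<in> arcs G" for e
    using sup_unit[OF e] by (auto intro!: bounded_seqI[of _ 1] simp: indicator_def)
  show "\<exists>K>0. \<forall>e \<in> arcs G. \<forall>e' \<in> arcs G.
      sup_seq (indicator {e'}) \<le> K * exp (\<epsilon> * edist e e') * sup_seq (indicator {e})" if \<epsilon>: "0 < \<epsilon>" for \<epsilon>
    using \<epsilon> by (intro exI[of _ 1]) (auto simp: sup_unit edist_nonneg)
qed

text \<open>The large entries of \<alpha> form a finite set \<open>F\<close>, whose contribution
  decays with the distance from \<open>F\<close>; the remaining entries contribute little
  everywhere. Hence large values of the sum occur only in finitely many balls, which are
  finite.\<close>

lemma null_kernel:
  assumes \<delta>: "0 < \<delta>" and \<alpha>: "\<alpha> \<in> null_seq"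
  shows "kernel_sum \<delta> \<alpha> \<in> null_seq"
proof -
  have \<alpha>b: "\<alpha> \<in> bounded_seq" and fin: "\<And>\<epsilon>. 0 < \<epsilon> \<Longrightarrow> finite {e \<in> arcs G. \<epsilon> \<le> \<alpha> e}"
    using \<alpha> by (auto simp: null_seq_def)
  obtain K where K: "0 < K" "kernel_sum \<delta> \<alpha> \<in> bounded_seq"
    "\<And>e \<eta> F. e \<in> arcs G \<Longrightarrow> 0 \<le> \<eta> \<Longrightarrow> finite F \<Longrightarrow> F \<subseteq> arcs G \<Longrightarrow> (\<forall>e' \<in> arcs G - F. \<alpha> e' \<le> \<eta>) \<Longrightarrow>
        kernel_sum \<delta> \<alpha> e \<le> \<eta> * K + sup_seq \<alpha> * (\<Sum>e' \<in> F. exp (- \<delta> * edist e e'))"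
    using sup_kernel[OF \<delta>] \<alpha>b by auto
  have "finite {e \<in> arcs G. \<epsilon> \<le> kernel_sum \<delta> \<alpha> e}" if \<epsilon>: "0 < \<epsilon>" for \<epsilon>
  proof -
    define \<eta> where "\<eta> = \<epsilon> / (2 * K)"
    have \<eta>: "0 < \<eta>" "\<eta> * K = \<epsilon> / 2" using \<epsilon> K(1) by (auto simp: \<eta>_def)
    define F where "F = {e \<in> arcs G. \<eta> \<le> \<alpha> e}"
    have F: "finite F" "F \<subseteq> arcs G" "\<forall>e' \<in> arcs G - F. \<alpha> e' \<le> \<eta>" using fin[OF \<eta>(1)] by (auto simp: F_def)
    \<comment> \<open>Beyond distance \<open>r\<close> every term over \<open>F\<close> is at most
      \<open>\<epsilon> / (4 * M)\<close>, so \<open>F\<close> contributes at most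
      \<open>\<epsilon> / 4\<close>. The summands \<open>1\<close> keep \<open>M\<close> positive
      when \<open>F\<close> is empty or \<alpha> vanishes.\<close>
    define M where "M = (1 + sup_seq \<alpha>) * (1 + real (card F))"
    have M: "0 < M" using sup_seq_nonneg[OF \<alpha>b] by (simp add: M_def add_pos_nonneg)
    define r where "r = ln (4 * M / \<epsilon>) / \<delta>"
    have "{e \<in> arcs G. \<epsilon> \<le> kernel_sum \<delta> \<alpha> e} \<subseteq> (\<Union>f \<in> F. {e \<in> arcs G. edist f e \<le> r})"
    proof (rule ccontr)
      assume "\<not> ?thesis"
      then obtain e where e: "e \<in> arcs G" "\<epsilon> \<le> kernel_sum \<delta> \<alpha> e" "\<And>f. f \<in> F \<Longrightarrow> r < edist f e" by force
      have "exp (- \<delta> * edist e f) \<le> \<epsilon> / (4 * M)" if "f \<in> F" for f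
      proof -
        have "ln (4 * M / \<epsilon>) \<le> \<delta> * edist e f"
          using e(3)[OF that] \<delta> by (simp add: r_def divide_less_eq edist_commute mult.commute)
        then have "exp (- \<delta> * edist e f) \<le> exp (- ln (4 * M / \<epsilon>))" by simp
        also have "\<dots> = \<epsilon> / (4 * M)" using M \<epsilon> by (simp add: exp_minus)
        finally show ?thesis .
      qed
      then have "(\<Sum>f \<in> F. exp (- \<delta> * edist e f)) \<le> (\<Sum>f \<in> F. \<epsilon> / (4 * M))" by (rule sum_mono)
      also have "\<dots> \<le> (1 + real (card F)) * (\<epsilon> / (4 * M))"
        unfolding sum_constant by (rule mult_right_mono) (use \<epsilon> M in auto)
      finally have "sup_seq \<alpha> * (\<Sum>f \<in> F. exp (- \<delta> * edist e f)) \<le> (1 + sup_seq \<alpha>) * ((1 + real (card F)) * (\<epsilon> / (4 * M)))"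
        using sup_seq_nonneg[OF \<alpha>b] by (intro mult_mono) (auto intro: sum_nonneg)
      also have "\<dots> = M * (\<epsilon> / (4 * M))" by (simp only: M_def mult.assoc)
      also have "\<dots> = \<epsilon> / 4" using M by simp
      finally have "kernel_sum \<delta> \<alpha> e \<le> \<epsilon> / 2 + \<epsilon> / 4"
        using K(3)[OF e(1) less_imp_le[OF \<eta>(1)] F] \<eta>(2) by linarith
      then show False using e(2) \<epsilon> by linarith
    qed
    moreover have "finite (\<Union>f \<in> F. {e \<in> arcs G. edist f e \<le> r})"
      using F finite_edge_ball by blast
    ultimately show ?thesis by (rule finite_subset)
  qed
  then show ?thesis using K(2) by (simp add: null_seq_def)
qed

text \<open>The norm inequalities are inherited from \<open>bounded_seq\<close>; what is to be shown
  is that the operations stay within \<open>null_seq\<close>.\<close>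

lemma null_edge_sequence_space: "edge_sequence_space G c null_seq sup_seq"
proof -
  interpret b: edge_sequence_space G c bounded_seq sup_seq by (rule sup_edge_sequence_space)
  show ?thesis
  proof (intro_locales, unfold_locales)
    fix \<alpha> assume "\<alpha> \<in> null_seq"
    then have \<alpha>: "\<alpha> \<in> bounded_seq" and fin: "\<And>\<epsilon>. 0 < \<epsilon> \<Longrightarrow> finite {e \<in> arcs G. \<epsilon> \<le> \<alpha> e}"
      by (auto simp: null_seq_def)
    show "0 \<le> \<alpha> e" if "e \<in> arcs G" for e by (rule b.Z_nonneg[OF \<alpha> that])
    show "\<beta> \<in> null_seq \<and> sup_seq \<beta> \<le> sup_seq \<alpha>" if \<beta>: "\<And>e. e \<in> arcs G \<Longrightarrow> 0 \<le> \<beta> e \<and> \<beta> e \<le> \<alpha> e" for \<beta>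
    proof -
      have "finite {e \<in> arcs G. \<epsilon> \<le> \<beta> e}" if "0 < \<epsilon>" for \<epsilon>
        by (rule finite_subset[OF _ fin[OF that]]) (use \<beta> in fastforce)
      then show ?thesis using b.solid[OF \<alpha> \<beta>] by (simp add: null_seq_def)
    qed
    show "(\<lambda>e. t * \<alpha> e) \<in> null_seq \<and> sup_seq (\<lambda>e. t * \<alpha> e) = t * sup_seq \<alpha>" if t: "0 \<le> t" for t
    proof -
      have "finite {e \<in> arcs G. \<epsilon> \<le> t * \<alpha> e}" if \<epsilon>: "0 < \<epsilon>" for \<epsilon>
      proof (cases "t = 0")
        case False
        then show ?thesis using fin[of "\<epsilon> / t"] \<epsilon> t by (simp add: pos_divide_le_eq mult.commute)
      qed (use \<epsilon> in simp)
      then show ?thesis using b.scale[OF \<alpha> t] by (simp add: null_seq_def)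
    qed
    show "(\<lambda>e. \<alpha> e + \<beta> e) \<in> null_seq \<and> sup_seq (\<lambda>e. \<alpha> e + \<beta> e) \<le> 4 * (sup_seq \<alpha> + sup_seq \<beta>)"
      if "\<beta> \<in> null_seq" for \<beta>
    proof -
      have \<beta>: "\<beta> \<in> bounded_seq" and fin': "\<And>\<epsilon>. 0 < \<epsilon> \<Longrightarrow> finite {e \<in> arcs G. \<epsilon> \<le> \<beta> e}"
        using that by (auto simp: null_seq_def)
      have "finite {e \<in> arcs G. \<epsilon> \<le> \<alpha> e + \<beta> e}" if "0 < \<epsilon>" for \<epsilon>
      proof (rule finite_subset)
        show "{e \<in> arcs G. \<epsilon> \<le> \<alpha> e + \<beta> e} \<subseteq> {e \<in> arcs G. \<epsilon> / 2 \<le> \<alpha> e} \<union> {e \<in> arcs G. \<epsilon> / 2 \<le> \<beta> e}" by auto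
        show "finite ({e \<in> arcs G. \<epsilon> / 2 \<le> \<alpha> e} \<union> {e \<in> arcs G. \<epsilon> / 2 \<le> \<beta> e})" using fin[OF half_gt_zero[OF that]] fin'[OF half_gt_zero[OF that]] by (rule finite_UnI)
      qed
      then show ?thesis using b.add[OF \<alpha> \<beta>] by (simp add: null_seq_def)
    qed
  next
    show "\<exists>K>0. \<forall>\<alpha> \<in> null_seq.
        (\<forall>e \<in> arcs G. (\<lambda>e'. exp (- \<delta> * edist e e') * \<alpha> e') summable_on arcs G) \<and>
        kernel_sum \<delta> \<alpha> \<in> null_seq \<and> sup_seq (kernel_sum \<delta> \<alpha>) \<le> K * sup_seq \<alpha>" if \<delta>: "0 < \<delta>" for \<delta>
    proof -
      from b.kernel[OF \<delta>] obtain K where "0 < K" "\<forall>\<alpha> \<in> bounded_seq.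
        (\<forall>e \<in> arcs G. (\<lambda>e'. exp (- \<delta> * edist e e') * \<alpha> e') summable_on arcs G) \<and>
        kernel_sum \<delta> \<alpha> \<in> bounded_seq \<and> sup_seq (kernel_sum \<delta> \<alpha>) \<le> K * sup_seq \<alpha>"
        by (elim exE conjE)
      moreover have "\<alpha> \<in> bounded_seq" if "\<alpha> \<in> null_seq" for \<alpha> using that by (simp add: null_seq_def)
      ultimately show ?thesis using null_kernel[OF \<delta>] by (intro exI[of _ K]) simp
    qed
  next
    show "indicator {e} \<in> null_seq \<and> 0 < sup_seq (indicator {e})" if e: "e \<in> arcs G" for e
    proof -
      have "finite {e' \<in> arcs G. \<epsilon> \<le> indicator {e} e'}" if "0 < \<epsilon>" for \<epsilon> :: real
        by (rule finite_subset[of _ "{e}"]) (use that in \<open>auto simp: indicator_def split: if_splits\<close>)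
      then show ?thesis using b.unit[OF e] by (simp add: null_seq_def)
    qed
  qed (rule b.unit_ratio)
qed

end

section \<open>Spaces of continuous functions\<close>

definition sup_on_edge :: "(real \<Rightarrow> complex) \<Rightarrow> real" where
  "sup_on_edge f = (SUP s \<in> {0..1}. norm (f s))"

lemma norm_le_sup_on_edge:
  assumes "continuous_on {0..1} f" "s \<in> {0..1}"
  shows "norm (f s) \<le> sup_on_edge f"
proof -
  have "bounded (f ` {0..1})" by (intro compact_imp_bounded compact_continuous_image assms compact_Icc)
  then obtain B where "\<forall>s \<in> {0..1}. norm (f s) \<le> B" unfolding bounded_iff by auto
  then have "bdd_above ((\<lambda>s. norm (f s)) ` {0..1})" by (intro bdd_aboveI[of _ B]) auto
  then show ?thesis unfolding sup_on_edge_def using assms(2) by (intro cSUP_upper)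
qed

lemma sup_on_edge_least: "(\<And>s. s \<in> {0..1} \<Longrightarrow> norm (f s) \<le> B) \<Longrightarrow> sup_on_edge f \<le> B"
  unfolding sup_on_edge_def by (intro cSUP_least) auto

lemma sup_on_edge_integrable:
  assumes f: "continuous_on {0..1} f"
  shows "set_integrable lborel {0..1} f \<and> integral {0..1} (\<lambda>s. norm (f s)) \<le> 2 * sup_on_edge f"
proof
  show "set_integrable lborel {0..1} f" by (rule set_integrable_lborel_continuous[OF f])
  have "integral {0..1} (\<lambda>s. norm (f s)) \<le> integral {0..1::real} (\<lambda>_. sup_on_edge f)"
    by (intro integral_le integrable_continuous_real continuous_intros f norm_le_sup_on_edge)
  also have "\<dots> \<le> 2 * sup_on_edge f"
    using norm_le_sup_on_edge[OF f, of 0] order_trans[OF norm_ge_zero[of "f 0"]] by simp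
  finally show "integral {0..1} (\<lambda>s. norm (f s)) \<le> 2 * sup_on_edge f" .
qed

context growth_graph
begin

lemma sup_norm_edges:
  assumes u: "continuous_on_graph G u" and b: "(\<lambda>e. sup_on_edge (edge_function G u e)) \<in> bounded_seq"
  shows "sup_norm G u = sup_seq (\<lambda>e. sup_on_edge (edge_function G u e))"
proof -
  let ?n = "\<lambda>e. sup_on_edge (edge_function G u e)"
  have up: "norm (u x) \<le> sup_seq ?n" if x: "x \<in> points G" for x
  proof -
    obtain e a where e: "e \<in> arcs G" "a \<in> {0..1}" "x = edge_point G e a" using point_edge_cases[OF x] .
    have "norm (u x) \<le> ?n e"
      using norm_le_sup_on_edge[OF continuous_edge_function[OF u e(1)] e(2)] e(3) by (simp add: edge_function_def)
    also have "\<dots> \<le> sup_seq ?n" by (rule sup_seq_upper[OF b e(1)])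
    finally show ?thesis .
  qed
  have ne: "points G \<noteq> {}" using nonempty_arcs edge_point_in[of _ 0] by fastforce
  have bdd: "bdd_above ((\<lambda>x. norm (u x)) ` points G)" using up by (auto intro!: bdd_aboveI[of _ "sup_seq ?n"])
  show ?thesis
  proof (rule antisym)
    show "sup_norm G u \<le> sup_seq ?n" unfolding sup_norm_def by (rule cSUP_least[OF ne up])
    show "sup_seq ?n \<le> sup_norm G u"
    proof (intro sup_seq_least sup_on_edge_least)
      fix e s assume e: "e \<in> arcs G" "s \<in> {0..1::real}"
      show "norm (edge_function G u e s) \<le> sup_norm G u"
        unfolding edge_function_def sup_norm_def by (rule cSUP_upper[OF edge_point_in[OF e] bdd])
    qed
  qed
qed

lemma sup_on_edge_nonneg:
  assumes "continuous_on_graph G u" "e \<in> arcs G"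
  shows "0 \<le> sup_on_edge (edge_function G u e)"
  using norm_le_sup_on_edge[OF continuous_edge_function[OF assms], of 0]
    order_trans[OF norm_ge_zero] by fastforce

lemma continuous_on_graph_diff:
  assumes "continuous_on_graph G f" "continuous_on_graph G u"
  shows "continuous_on_graph G (\<lambda>x. f x - a * u x)"
proof -
  have "continuous_map euclidean euclidean (\<lambda>w. a * w)"
    by (simp add: continuous_on_mult_left)
  from continuous_map_compose[OF assms(2)[unfolded continuous_on_graph_def] this] assms(1) show ?thesis
    unfolding continuous_on_graph_def o_def by (rule continuous_map_diff[rotated])
qed

section \<open>Bounded uniformly continuous functions\<close>

lemma BUC_continuous: "u \<in> vectors (BUC_space G) \<Longrightarrow> continuous_on_graph G u"
  using uniformly_continuous_imp_continuous_map[of "graph_metric G" euclidean_metric u]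
  by (simp add: BUC_space_def continuous_on_graph_def mtopology_of_euclidean)

lemma uniformly_continuous_graph_iff:
  "uniformly_continuous_map (graph_metric G) euclidean_metric u \<longleftrightarrow>
    (\<forall>\<epsilon>>0. \<exists>\<delta>>0. \<forall>x \<in> points G. \<forall>y \<in> points G. path_dist G y x < \<delta> \<longrightarrow> dist (u y) (u x) < \<epsilon>)"
  by (simp add: uniformly_continuous_map_def)

text \<open>Uniformly bounded Lipschitz constants on the edges add up along paths to a global
  Lipschitz constant, hence to uniform continuity.\<close>

lemma BUC_laplacian_space: "laplacian_space G c bounded_seq sup_seq (BUC_space G) sup_on_edge"
proof -
  interpret edge_sequence_space G c bounded_seq sup_seq by (rule sup_edge_sequence_space)
  show ?thesis
  proof (intro_locales, unfold_locales)
    fix u assume u: "u \<in> vectors (BUC_space G)"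
    note cu = BUC_continuous[OF u]
    obtain B where B: "\<And>x. x \<in> points G \<Longrightarrow> norm (u x) \<le> B"
      using u unfolding BUC_space_def bounded_iff by auto
    have b: "(\<lambda>e. sup_on_edge (edge_function G u e)) \<in> bounded_seq"
    proof (intro bounded_seqI[of _ B] conjI sup_on_edge_nonneg cu sup_on_edge_least)
      fix e s assume "e \<in> arcs G" "s \<in> {0..1::real}"
      then show "norm (edge_function G u e s) \<le> B" using B edge_point_in by (simp add: edge_function_def)
    qed
    then show "(\<lambda>e. sup_on_edge (edge_function G u e)) \<in> bounded_seq \<and>
        snorm (BUC_space G) u = sup_seq (\<lambda>e. sup_on_edge (edge_function G u e))"
      using sup_norm_edges[OF cu b] by (simp add: BUC_space_def)
    fix e assume e: "e \<in> arcs G"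
    show "set_integrable lborel {0..1} (edge_function G u e) \<and>
      integral {0..1} (\<lambda>s. norm (edge_function G u e s)) \<le> 2 * sup_on_edge (edge_function G u e)"
      by (rule sup_on_edge_integrable[OF continuous_edge_function[OF cu e]])
  next
    show "sup_on_edge (edge_function G u e) \<le> B"
      if "\<And>s. s \<in> {0..1} \<Longrightarrow> norm (edge_function G u e s) \<le> B" for u e B
      by (rule sup_on_edge_least[OF that])
  next
    fix \<beta> u assume \<beta>: "\<beta> \<in> bounded_seq"
      and b1: "\<And>e s. e \<in> arcs G \<Longrightarrow> s \<in> {0..1} \<Longrightarrow> norm (edge_function G u e s) \<le> \<beta> e"
      and b2: "\<And>e s t. e \<in> arcs G \<Longrightarrow> s \<in> {0..1} \<Longrightarrow> t \<in> {0..1} \<Longrightarrow>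
        norm (edge_function G u e t - edge_function G u e s) \<le> \<beta> e * \<bar>t - s\<bar>"
    define B where "B = 1 + sup_seq \<beta>"
    have B: "\<beta> e \<le> B" if "e \<in> arcs G" for e using sup_seq_upper[OF \<beta> that] by (simp add: B_def)
    have B1: "0 < B" using sup_seq_nonneg[OF \<beta>] by (simp add: B_def)
    have bd: "norm (u x) \<le> B" if x: "x \<in> points G" for x
    proof -
      obtain e a where e: "e \<in> arcs G" "a \<in> {0..1}" "x = edge_point G e a" using point_edge_cases[OF x] .
      show ?thesis using b1[OF e(1,2)] B[OF e(1)] e(3) by (simp add: edge_function_def)
    qed
    have lip: "norm (u y - u x) \<le> B * path_dist G x y" if x: "x \<in> points G" and y: "y \<in> points G" for x y
    proof -
      have "norm (u y - u x) / B \<le> path_dist G x y"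
      proof (rule path_dist_ge[OF x y])
        fix L assume L: "edge_path G x L y"
        \<comment> \<open>The distance of the values from \<open>u x\<close>, divided by
          \<open>B\<close>, is 1-Lipschitz along edges, so \<open>lipschitz_edge_path\<close>
          applies to it.\<close>
        have "norm (u y - u x) / B - norm (u x - u x) / B \<le> L"
        proof (rule lipschitz_edge_path[OF _ L])
          fix e and a b :: real assume e: "e \<in> arcs G" "a \<in> {0..1}" "b \<in> {0..1}"
          have "norm (u (edge_point G e b) - u x) - norm (u (edge_point G e a) - u x) \<le> norm (u (edge_point G e b) - u (edge_point G e a))"
            using norm_triangle_ineq2[of "u (edge_point G e b) - u x" "u (edge_point G e a) - u x"] by simp
          also have "\<dots> \<le> \<beta> e * \<bar>b - a\<bar>" using b2[OF e] by (simp add: edge_function_def)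
          also have "\<dots> \<le> B * \<bar>b - a\<bar>" by (intro mult_right_mono B e) simp
          finally show "norm (u (edge_point G e b) - u x) / B - norm (u (edge_point G e a) - u x) / B \<le> \<bar>b - a\<bar>"
            using B1 by (simp add: pos_divide_le_eq mult.commute flip: diff_divide_distrib)
        qed
        then show "norm (u y - u x) / B \<le> L" by simp
      qed
      then show ?thesis using B1 by (simp add: pos_divide_le_eq mult.commute)
    qed
    have "\<exists>\<delta>>0. \<forall>x \<in> points G. \<forall>y \<in> points G. path_dist G y x < \<delta> \<longrightarrow> dist (u y) (u x) < \<epsilon>" if \<epsilon>: "0 < \<epsilon>" for \<epsilon>
    proof (intro exI[of _ "\<epsilon> / B"] conjI ballI impI)
      fix x y assume xy: "x \<in> points G" "y \<in> points G" "path_dist G y x < \<epsilon> / B"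
      have "norm (u y - u x) \<le> B * path_dist G x y" by (rule lip[OF xy(1,2)])
      also have "\<dots> < \<epsilon>" using xy(3) B1 by (simp add: pos_less_divide_eq mult.commute path_dist_commute)
      finally show "dist (u y) (u x) < \<epsilon>" by (simp add: dist_norm)
    qed (use \<epsilon> B1 in simp)
    moreover have "bounded (u ` points G)" using bd by (intro boundedI[of _ B]) auto
    ultimately show "u \<in> vectors (BUC_space G)"
      by (simp add: BUC_space_def uniformly_continuous_graph_iff)
  next
    fix f u a assume "f \<in> vectors (BUC_space G)" "u \<in> vectors (BUC_space G)"
    then have f: "bounded (f ` points G)" "uniformly_continuous_map (graph_metric G) euclidean_metric f"
      and u: "bounded (u ` points G)" "uniformly_continuous_map (graph_metric G) euclidean_metric u"
      by (auto simp: BUC_space_def)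
    obtain B1 B2 where B: "\<And>x. x \<in> points G \<Longrightarrow> norm (f x) \<le> B1" "\<And>x. x \<in> points G \<Longrightarrow> norm (u x) \<le> B2"
      using f(1) u(1) unfolding bounded_iff by auto
    have bd: "norm (f x - a * u x) \<le> B1 + norm a * B2" if x: "x \<in> points G" for x
      using norm_triangle_ineq4[of "f x" "a * u x"] B(1)[OF x] mult_left_mono[OF B(2)[OF x], of "norm a"]
      by (simp add: norm_mult)
    have "\<exists>\<delta>>0. \<forall>x \<in> points G. \<forall>y \<in> points G. path_dist G y x < \<delta> \<longrightarrow> dist (f y - a * u y) (f x - a * u x) < \<epsilon>"
      if \<epsilon>: "0 < \<epsilon>" for \<epsilon>
    proof -
      obtain \<delta>1 where \<delta>1: "0 < \<delta>1" "\<And>x y. x \<in> points G \<Longrightarrow> y \<in> points G \<Longrightarrow> path_dist G y x < \<delta>1 \<Longrightarrow> dist (f y) (f x) < \<epsilon> / 2"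
        using f(2) \<epsilon> unfolding uniformly_continuous_graph_iff by (meson half_gt_zero)
      have "0 < \<epsilon> / (2 * (1 + norm a))" using \<epsilon> by (simp add: add_pos_nonneg)
      then obtain \<delta>2 where \<delta>2: "0 < \<delta>2" "\<And>x y. x \<in> points G \<Longrightarrow> y \<in> points G \<Longrightarrow> path_dist G y x < \<delta>2 \<Longrightarrow> dist (u y) (u x) < \<epsilon> / (2 * (1 + norm a))"
        using u(2) unfolding uniformly_continuous_graph_iff by meson
      show ?thesis
      proof (intro exI[of _ "min \<delta>1 \<delta>2"] conjI ballI impI)
        fix x y assume xy: "x \<in> points G" "y \<in> points G" "path_dist G y x < min \<delta>1 \<delta>2"
        have 1: "norm (f y - f x) < \<epsilon> / 2" using \<delta>1(2)[OF xy(1,2)] xy(3) by (simp add: dist_norm)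
        have 2: "norm (u y - u x) < \<epsilon> / (2 * (1 + norm a))" using \<delta>2(2)[OF xy(1,2)] xy(3) by (simp add: dist_norm)
        have "norm a * norm (u y - u x) \<le> (1 + norm a) * (\<epsilon> / (2 * (1 + norm a)))"
          using 2 by (intro mult_mono) auto
        also have "\<dots> = \<epsilon> / 2"
          using add_pos_nonneg[OF zero_less_one norm_ge_zero[of a]] by (simp add: field_simps)
        finally have 3: "norm a * norm (u y - u x) \<le> \<epsilon> / 2" .
        have "norm ((f y - a * u y) - (f x - a * u x)) = norm ((f y - f x) - a * (u y - u x))" by (simp add: algebra_simps)
        also have "\<dots> \<le> norm (f y - f x) + norm a * norm (u y - u x)"
          using norm_triangle_ineq4[of "f y - f x" "a * (u y - u x)"] by (simp add: norm_mult)
        finally show "dist (f y - a * u y) (f x - a * u x) < \<epsilon>" using 1 3 by (simp add: dist_norm)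
      qed (use \<delta>1 \<delta>2 in simp)
    qed
    moreover have "bounded ((\<lambda>x. f x - a * u x) ` points G)"
      using bd by (intro boundedI[of _ "B1 + norm a * B2"]) auto
    ultimately show "(\<lambda>x. f x - a * u x) \<in> vectors (BUC_space G)"
      by (simp add: BUC_space_def uniformly_continuous_graph_iff)
  qed
qed

text \<open>Compact sets are bounded, and the edges meeting a bounded set have their initial
  vertices in a ball; balls in \<open>edist\<close> are finite.\<close>

lemma compactin_edges_finite:
  assumes K: "compactin (mtopology_of (graph_metric G)) K"
  shows "finite {e \<in> arcs G. \<exists>s \<in> {0..1}. edge_point G e s \<in> K}"
proof -
  interpret M: Metric_space "points G" "path_dist G" by (rule Metric_space_points)
  have "M.mbounded K"
    using M.compactin_imp_mbounded K by (simp add: mtopology_of_def)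
  then obtain x B where xB: "K \<subseteq> M.mcball x B" unfolding M.mbounded_def by blast
  obtain e0 where e0: "e0 \<in> arcs G" using nonempty_arcs by auto
  let ?v = "Vertex (tail G e0)"
  have v: "?v \<in> points G" using e0 by (auto simp: points_def)
  have "{e \<in> arcs G. \<exists>s \<in> {0..1}. edge_point G e s \<in> K} \<subseteq> {e \<in> arcs G. edist e0 e \<le> path_dist G ?v x + B + 1}"
  proof safe
    fix e s assume e: "e \<in> arcs G" and s: "s \<in> {0..1::real}" and K: "edge_point G e s \<in> K"
    have x: "x \<in> points G" "path_dist G x (edge_point G e s) \<le> B" and p: "edge_point G e s \<in> points G"
      using xB K by auto
    have t: "Vertex (tail G e) \<in> points G" using e by (auto simp: points_def)
    have "path_dist G (edge_point G e s) (Vertex (tail G e)) \<le> 1"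
      using path_dist_edge_points[OF e s, of 0] s by (simp add: edge_point_def[of G e 0])
    then show "edist e0 e \<le> path_dist G ?v x + B + 1"
      using path_dist_triangle[OF v x(1) t] path_dist_triangle[OF x(1) p t] x(2)
      by (simp add: edist_def vdist_def)
  qed
  then show ?thesis using finite_edge_ball[OF e0] by (rule finite_subset)
qed

lemma closedin_superlevel:
  assumes "continuous_on_graph G u"
  shows "closedin (mtopology_of (graph_metric G)) {x \<in> points G. \<epsilon> \<le> norm (u x)}"
proof -
  have "closedin euclidean {w :: complex. \<epsilon> \<le> norm w}"
    by (simp add: closed_Collect_le continuous_on_norm_id)
  from closedin_continuous_map_preimage[OF assms[unfolded continuous_on_graph_def] this]
  show ?thesis by simp
qed

text \<open>Vanishing at infinity corresponds to null sequences of edge suprema: a compact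
  superlevel set meets only finitely many edges, and conversely a superlevel set is closed and
  covered by the finitely many compact edges on which \<beta> is large.\<close>

lemma C0_laplacian_space: "laplacian_space G c null_seq sup_seq (C0_space G) sup_on_edge"
proof -
  interpret edge_sequence_space G c null_seq sup_seq by (rule null_edge_sequence_space)
  let ?T = "mtopology_of (graph_metric G)"
  show ?thesis
  proof (intro_locales, unfold_locales)
    fix u assume u: "u \<in> vectors (C0_space G)"
    have cu: "continuous_on_graph G u" and K: "\<And>\<epsilon>. 0 < \<epsilon> \<Longrightarrow> compactin ?T {x \<in> points G. \<epsilon> \<le> norm (u x)}"
      using u by (auto simp: C0_space_def)
    let ?n = "\<lambda>e. sup_on_edge (edge_function G u e)"
    \<comment> \<open>A supremum of at least \<epsilon> yields a point with norm above
      \<open>\<epsilon> / 2\<close>, hence an edge that meets a compact superlevel set.\<close>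
    have fin: "finite {e \<in> arcs G. \<epsilon> \<le> ?n e}" if \<epsilon>: "0 < \<epsilon>" for \<epsilon>
    proof (rule finite_subset[OF _ compactin_edges_finite[OF K[OF half_gt_zero[OF \<epsilon>]]]], safe)
      fix e assume e: "e \<in> arcs G" "\<epsilon> \<le> ?n e"
      have "\<not> (\<forall>s \<in> {0..1}. norm (edge_function G u e s) \<le> \<epsilon> / 2)"
      proof
        assume "\<forall>s \<in> {0..1}. norm (edge_function G u e s) \<le> \<epsilon> / 2"
        then have "?n e \<le> \<epsilon> / 2" by (intro sup_on_edge_least) auto
        then show False using e(2) \<epsilon> by linarith
      qed
      then obtain s where s: "s \<in> {0..1}" "\<epsilon> / 2 < norm (edge_function G u e s)" by auto
      then show "\<exists>s \<in> {0..1}. edge_point G e s \<in> {x \<in> points G. \<epsilon> / 2 \<le> norm (u x)}"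
        using edge_point_in[OF e(1) s(1)] by (intro bexI[of _ s]) (auto simp: edge_function_def)
    qed
    \<comment> \<open>Only finitely many suprema reach \<open>1\<close>, so their maximum together
      with \<open>1\<close> bounds all of them.\<close>
    define B where "B = Max (insert 1 (?n ` {e \<in> arcs G. 1 \<le> ?n e}))"
    have "?n e \<le> B" if "e \<in> arcs G" for e
    proof (cases "1 \<le> ?n e")
      case True
      then show ?thesis unfolding B_def using fin[of 1] that by (intro Max_ge) auto
    next
      case False
      have "1 \<le> B" unfolding B_def using fin[of 1] by (intro Max_ge) auto
      with False show ?thesis by linarith
    qed
    then have "?n \<in> bounded_seq" using sup_on_edge_nonneg[OF cu] by (intro bounded_seqI[of _ B]) auto
    then show "?n \<in> null_seq \<and> snorm (C0_space G) u = sup_seq ?n"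
      using fin sup_norm_edges[OF cu] by (simp add: null_seq_def C0_space_def)
    fix e assume e: "e \<in> arcs G"
    show "set_integrable lborel {0..1} (edge_function G u e) \<and>
      integral {0..1} (\<lambda>s. norm (edge_function G u e s)) \<le> 2 * sup_on_edge (edge_function G u e)"
      by (rule sup_on_edge_integrable[OF continuous_edge_function[OF cu e]])
  next
    show "sup_on_edge (edge_function G u e) \<le> B"
      if "\<And>s. s \<in> {0..1} \<Longrightarrow> norm (edge_function G u e s) \<le> B" for u e B
      by (rule sup_on_edge_least[OF that])
  next
    fix \<beta> u assume \<beta>: "\<beta> \<in> null_seq"
      and b1: "\<And>e s. e \<in> arcs G \<Longrightarrow> s \<in> {0..1} \<Longrightarrow> norm (edge_function G u e s) \<le> \<beta> e"
      and b2: "\<And>e s t. e \<in> arcs G \<Longrightarrow> s \<in> {0..1} \<Longrightarrow> t \<in> {0..1} \<Longrightarrow>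
        norm (edge_function G u e t - edge_function G u e s) \<le> \<beta> e * \<bar>t - s\<bar>"
    have cu: "continuous_on_graph G u" by (rule continuous_on_graph_edgewise_lipschitz[of u \<beta>, OF b2])
    have "compactin ?T {x \<in> points G. \<epsilon> \<le> norm (u x)}" if \<epsilon>: "0 < \<epsilon>" for \<epsilon>
    proof (rule closed_compactin[OF _ _ closedin_superlevel[OF cu]])
      let ?F = "{e \<in> arcs G. \<epsilon> \<le> \<beta> e}"
      have "compactin ?T (\<Union> ((\<lambda>e. edge_point G e ` {0..1}) ` ?F))"
      proof (rule compactin_Union)
        show "finite ((\<lambda>e. edge_point G e ` {0..1}) ` ?F)" using \<beta> \<epsilon> by (simp add: null_seq_def)
        fix S assume "S \<in> (\<lambda>e. edge_point G e ` {0..1}) ` ?F"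
        then obtain e where e: "e \<in> arcs G" "S = edge_point G e ` {0..1}" by auto
        have "compactin (top_of_set {0..1::real}) {0..1}" by (simp add: compactin_subtopology)
        from image_compactin[OF this continuous_edge_point[OF e(1)]] show "compactin ?T S" using e(2) by simp
      qed
      then show "compactin ?T (\<Union>e \<in> ?F. edge_point G e ` {0..1})" .
      show "{x \<in> points G. \<epsilon> \<le> norm (u x)} \<subseteq> (\<Union>e \<in> ?F. edge_point G e ` {0..1})"
      proof safe
        fix x assume x: "x \<in> points G" "\<epsilon> \<le> norm (u x)"
        obtain e a where e: "e \<in> arcs G" "a \<in> {0..1}" "x = edge_point G e a" using point_edge_cases[OF x(1)] .
        have "\<epsilon> \<le> \<beta> e" using b1[OF e(1,2)] x(2) e(3) by (simp add: edge_function_def)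
        then show "x \<in> (\<Union>e \<in> ?F. edge_point G e ` {0..1})" using e by auto
      qed
    qed
    then show "u \<in> vectors (C0_space G)" using cu by (simp add: C0_space_def)
  next
    fix f u a assume "f \<in> vectors (C0_space G)" "u \<in> vectors (C0_space G)"
    then have f: "continuous_on_graph G f" "\<And>\<epsilon>. 0 < \<epsilon> \<Longrightarrow> compactin ?T {x \<in> points G. \<epsilon> \<le> norm (f x)}"
      and u: "continuous_on_graph G u" "\<And>\<epsilon>. 0 < \<epsilon> \<Longrightarrow> compactin ?T {x \<in> points G. \<epsilon> \<le> norm (u x)}"
      by (auto simp: C0_space_def)
    note cd = continuous_on_graph_diff[OF f(1) u(1), of a]
    have "compactin ?T {x \<in> points G. \<epsilon> \<le> norm (f x - a * u x)}" if \<epsilon>: "0 < \<epsilon>" for \<epsilon>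
    proof (rule closed_compactin[OF _ _ closedin_superlevel[OF cd]])
      define \<eta> where "\<eta> = \<epsilon> / (2 * (1 + norm a))"
      have a1: "0 < 1 + norm a" by (simp add: add_pos_nonneg)
      have \<eta>: "0 < \<eta>" "(1 + norm a) * \<eta> = \<epsilon> / 2" using \<epsilon> a1 by (auto simp: \<eta>_def field_simps)
      show "compactin ?T ({x \<in> points G. \<epsilon> / 2 \<le> norm (f x)} \<union> {x \<in> points G. \<eta> \<le> norm (u x)})"
        by (rule compactin_Un[OF f(2)[OF half_gt_zero[OF \<epsilon>]] u(2)[OF \<eta>(1)]])
      show "{x \<in> points G. \<epsilon> \<le> norm (f x - a * u x)} \<subseteq> {x \<in> points G. \<epsilon> / 2 \<le> norm (f x)} \<union> {x \<in> points G. \<eta> \<le> norm (u x)}"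
      proof safe
        fix x assume x: "\<epsilon> \<le> norm (f x - a * u x)" "\<not> \<eta> \<le> norm (u x)"
        have "norm a * norm (u x) \<le> (1 + norm a) * \<eta>" using x(2) by (intro mult_mono) auto
        then show "\<epsilon> / 2 \<le> norm (f x)"
          using x(1) norm_triangle_ineq4[of "f x" "a * u x"] \<eta>(2) by (simp add: norm_mult)
      qed
    qed
    then show "(\<lambda>x. f x - a * u x) \<in> vectors (C0_space G)" using cd by (simp add: C0_space_def)
  qed
qed

end

section \<open>Lebesgue spaces\<close>

text \<open>The open interval, since \<open>graph_measure\<close> is carried by the interiors of the
  edges; its mass is \<open>1\<close>.\<close>

abbreviation unit_interval :: "real measure" where
  "unit_interval \<equiv> restrict_space lborel {0<..<1}"

definition lp_on_edge :: "real \<Rightarrow> (real \<Rightarrow> complex) \<Rightarrow> real" where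
  "lp_on_edge p f = (\<integral>s. norm (f s) powr p \<partial>unit_interval) powr (1 / p)"

lemma space_unit_interval: "space unit_interval = {0<..<1}"
  by (simp add: space_restrict_space)

lemma measure_unit_interval [simp]: "measure unit_interval {0<..<1} = 1"
  by (simp add: measure_restrict_space)

lemma unit_interval_const: "integrable unit_interval (\<lambda>_. a :: real)" "(\<integral>s. a \<partial>unit_interval) = (a :: real)"
proof -
  show "integrable unit_interval (\<lambda>_. a)" by (simp add: integrable_restrict_space)
  show "(\<integral>s. a \<partial>unit_interval) = a" by (simp add: space_unit_interval)
qed

lemma lp_on_edge_powr:
  assumes "1 \<le> p"
  shows "lp_on_edge p f powr p = (\<integral>s. norm (f s) powr p \<partial>unit_interval)"
  using assms by (simp add: lp_on_edge_def powr_powr)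

lemma set_integrable_unit_interval:
  fixes f :: "real \<Rightarrow> 'b::euclidean_space"
  assumes "integrable unit_interval f"
  shows "set_integrable lborel {0..1} f" "integral {0..1} f = (\<integral>s. f s \<partial>unit_interval)"
proof -
  have 0: "set_integrable lborel {0<..<1} f"
    using assms by (simp add: integrable_restrict_space set_integrable_def)
  have sd: "sym_diff {0<..<1} {0..1::real} \<subseteq> {0, 1}" by auto
  show 1: "set_integrable lborel {0..1} f"
    using set_integrable_discrete_difference[OF _ sd, of lborel f] 0 by simp
  have "integral {0..1} f = (LBINT s:{0..1}. f s)" using set_borel_integral_eq_integral(2)[OF 1] by simp
  also have "\<dots> = (LBINT s:{0<..<1}. f s)"
    using set_integral_discrete_difference[OF _ sd, of lborel f] by simp
  also have "\<dots> = (\<integral>s. f s \<partial>unit_interval)" by (simp add: integral_restrict_space set_lebesgue_integral_def)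
  finally show "integral {0..1} f = (\<integral>s. f s \<partial>unit_interval)" .
qed

text \<open>On a space of mass \<open>1\<close> Jensen's inequality bounds the integral by the
  p-norm. It is obtained from \<open>powr_le_of_parametric_bound\<close> with \<open>A = 1\<close>,
  which is the origin of the factor \<open>2\<close> in \<open>laplacian_space\<close>.\<close>

lemma lp_on_edge_integrable:
  assumes p: "1 \<le> p" and m: "f \<in> borel_measurable unit_interval"
    and f: "integrable unit_interval (\<lambda>s. norm (f s) powr p)"
  shows "set_integrable lborel {0..1} f \<and> integral {0..1} (\<lambda>s. norm (f s)) \<le> 2 * lp_on_edge p f"
proof -
  let ?J = "\<integral>s. norm (f s) powr p \<partial>unit_interval"
  have r: "integrable unit_interval (\<lambda>s. r + r powr (1 - p) * norm (f s) powr p)" for r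
    by (intro Bochner_Integration.integrable_add unit_interval_const integrable_mult_right f)
  have fi: "integrable unit_interval f"
    by (rule Bochner_Integration.integrable_bound[OF r[of 1] m])
      (use le_plus_powr[of _ 1 p] p in \<open>auto intro!: AE_I2 simp: abs_of_nonneg\<close>)
  have "(\<integral>s. norm (f s) \<partial>unit_interval) \<le> 2 * 1 * (?J / 1) powr (1 / p)"
  proof (rule powr_le_of_parametric_bound[OF p])
    fix r :: real assume r0: "0 < r"
    have "(\<integral>s. norm (f s) \<partial>unit_interval) \<le> (\<integral>s. r + r powr (1 - p) * norm (f s) powr p \<partial>unit_interval)"
      by (rule integral_mono[OF integrable_norm[OF fi] r le_plus_powr[OF norm_ge_zero r0 p]])
    also have "\<dots> = r * 1 + r powr (1 - p) * ?J"
      using f by (subst Bochner_Integration.integral_add) (auto simp: unit_interval_const)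
    finally show "(\<integral>s. norm (f s) \<partial>unit_interval) \<le> r * 1 + r powr (1 - p) * ?J" .
  qed auto
  then have "integral {0..1} (\<lambda>s. norm (f s)) \<le> 2 * lp_on_edge p f"
    using set_integrable_unit_interval(2)[OF integrable_norm[OF fi]] by (simp add: lp_on_edge_def)
  then show ?thesis using set_integrable_unit_interval(1)[OF fi] by simp
qed

lemma lp_on_edge_le:
  assumes p: "1 \<le> p" and f: "integrable unit_interval (\<lambda>s. norm (f s) powr p)"
    and B: "\<And>s. s \<in> {0..1} \<Longrightarrow> norm (f s) \<le> B"
  shows "lp_on_edge p f \<le> B"
proof -
  have B0: "0 \<le> B" using order_trans[OF norm_ge_zero B[of 0]] by simp
  have "(\<integral>s. norm (f s) powr p \<partial>unit_interval) \<le> (\<integral>s. B powr p \<partial>unit_interval)"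
    by (rule integral_mono[OF f unit_interval_const(1)]) (use B p in \<open>auto simp: space_unit_interval intro!: powr_mono2\<close>)
  then have "(\<integral>s. norm (f s) powr p \<partial>unit_interval) \<le> B powr p" by (simp add: unit_interval_const)
  then have "lp_on_edge p f \<le> (B powr p) powr (1 / p)"
    unfolding lp_on_edge_def using p by (intro powr_mono2) auto
  then show ?thesis using p B0 by (simp add: powr_powr)
qed

section \<open>Integration over the graph, edge by edge\<close>

context growth_graph
begin

lemma pair_sigma_finite_edges: "pair_sigma_finite (count_space (arcs G)) unit_interval"
proof -
  have "sigma_finite_measure unit_interval"
    by (rule sigma_finite_measure_restrict_space[OF sigma_finite_lborel]) simp
  then show ?thesis
    using sigma_finite_measure_count_space_countable[OF countable_arcs] by (rule pair_sigma_finite.intro[rotated])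
qed

lemma measurable_on_edges:
  assumes u: "u \<in> measurable (graph_measure G c) borel"
  shows "(\<lambda>(e, s). u (Inner e s)) \<in> measurable (count_space (arcs G) \<Otimes>\<^sub>M unit_interval) borel"
    and "e \<in> arcs G \<Longrightarrow> (\<lambda>s. u (Inner e s)) \<in> measurable unit_interval borel"
proof -
  have "u \<in> measurable (sigma (points G) {U. openin (mtopology_of (graph_metric G)) U}) borel"
    using u by (simp add: graph_measure_def)
  from measurable_compose[OF measurable_Inner this]
  show m: "(\<lambda>(e, s). u (Inner e s)) \<in> measurable (count_space (arcs G) \<Otimes>\<^sub>M unit_interval) borel"
    by (simp add: case_prod_beta')
  show "(\<lambda>s. u (Inner e s)) \<in> measurable unit_interval borel" if "e \<in> arcs G"
    using measurable_compose[OF measurable_Pair1'[of e "count_space (arcs G)" unit_interval] m] that by simp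
qed

text \<open>\<open>graph_measure\<close> is the image of a product measure with density
  \<open>c\<close>, and Fubini's theorem applies because countably many edges give a sigma-finite
  counting measure. Nonnegativity turns integrability over the edges into plain summability.\<close>

lemma graph_integral:
  fixes F :: "('v, 'e) point \<Rightarrow> real"
  assumes F: "F \<in> borel_measurable (graph_measure G c)" and F0: "\<And>x. 0 \<le> F x"
  shows "integrable (graph_measure G c) F \<longleftrightarrow>
      (\<forall>e \<in> arcs G. integrable unit_interval (\<lambda>s. F (Inner e s))) \<and>
      (\<lambda>e. c e * (\<integral>s. F (Inner e s) \<partial>unit_interval)) summable_on arcs G" (is "?L \<longleftrightarrow> ?R")
    and "integrable (graph_measure G c) F \<Longrightarrow>
      (\<integral>x. F x \<partial>graph_measure G c) = (\<Sum>\<^sub>\<infinity>e \<in> arcs G. c e * (\<integral>s. F (Inner e s) \<partial>unit_interval))"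
proof -
  interpret pair_sigma_finite "count_space (arcs G)" unit_interval by (rule pair_sigma_finite_edges)
  let ?P = "count_space (arcs G) \<Otimes>\<^sub>M unit_interval"
  let ?D = "density ?P (\<lambda>(e, s). ennreal (c e))"
  let ?S = "sigma (points G) {U. openin (mtopology_of (graph_metric G)) U}"
  define \<Phi> where "\<Phi> = (\<lambda>(e, s). c e * F (Inner e s))"
  have FS: "F \<in> borel_measurable ?S" using F by (simp add: graph_measure_def)
  have mF: "(\<lambda>x. F (case x of (e, s) \<Rightarrow> Inner e s)) \<in> borel_measurable ?P"
    using measurable_on_edges(1)[OF F] by (simp add: case_prod_beta')
  have mc: "(\<lambda>x. c (fst x)) \<in> borel_measurable ?P"
    by (rule measurable_compose[OF measurable_fst]) simp
  have c0: "AE x in ?P. 0 \<le> c (fst x)"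
    by (rule AE_I2) (auto simp: space_pair_measure intro: less_imp_le[OF conductivity_pos])
  have \<Phi>m: "\<Phi> \<in> borel_measurable ?P"
    using borel_measurable_times[OF mc mF] by (simp add: \<Phi>_def case_prod_beta')
  have dens: "?D = density ?P (\<lambda>x. ennreal (c (fst x)))" by (simp add: case_prod_beta')
  have iff: "?L \<longleftrightarrow> integrable ?P \<Phi>"
  proof -
    have "?L \<longleftrightarrow> integrable ?D (\<lambda>x. F (case x of (e, s) \<Rightarrow> Inner e s))"
      unfolding graph_measure_def by (rule integrable_distr_eq[OF measurable_Inner FS])
    also have "\<dots> \<longleftrightarrow> integrable ?P (\<lambda>x. c (fst x) *\<^sub>R F (case x of (e, s) \<Rightarrow> Inner e s))"
      unfolding dens by (rule integrable_density[OF mF mc c0])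
    finally show ?thesis by (simp add: \<Phi>_def case_prod_beta')
  qed
  have int: "(\<integral>x. F x \<partial>graph_measure G c) = (\<integral>x. \<Phi> x \<partial>?P)"
  proof -
    have "(\<integral>x. F x \<partial>graph_measure G c) = (\<integral>x. F (case x of (e, s) \<Rightarrow> Inner e s) \<partial>?D)"
      unfolding graph_measure_def by (rule integral_distr[OF measurable_Inner FS])
    also have "\<dots> = (\<integral>x. c (fst x) *\<^sub>R F (case x of (e, s) \<Rightarrow> Inner e s) \<partial>?P)"
      unfolding dens by (rule integral_density[OF mF mc c0])
    finally show ?thesis by (simp add: \<Phi>_def case_prod_beta')
  qed
  have inner: "(\<integral>s. \<Phi> (e, s) \<partial>unit_interval) = c e * (\<integral>s. F (Inner e s) \<partial>unit_interval)" for e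
    by (simp add: \<Phi>_def)
  have inner_i: "integrable unit_interval (\<lambda>s. \<Phi> (e, s)) \<longleftrightarrow> integrable unit_interval (\<lambda>s. F (Inner e s))" if "e \<in> arcs G" for e
    using conductivity_pos[OF that] by (simp add: \<Phi>_def)
  let ?g = "\<lambda>e. c e * (\<integral>s. F (Inner e s) \<partial>unit_interval)"
  have g0: "0 \<le> ?g e" if "e \<in> arcs G" for e using conductivity_pos[OF that] F0 by simp
  have sum_iff: "integrable (count_space (arcs G)) ?g \<longleftrightarrow> ?g summable_on arcs G"
  proof -
    have "integrable (count_space (arcs G)) ?g \<longleftrightarrow> (\<lambda>e. norm (?g e)) summable_on arcs G"
      using abs_summable_equivalent[of ?g "arcs G"] by (simp add: Infinite_Set_Sum.abs_summable_on_def)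
    also have "\<dots> \<longleftrightarrow> ?g summable_on arcs G" by (rule summable_on_cong) (use g0 in simp)
    finally show ?thesis .
  qed
  show "?L \<longleftrightarrow> ?R"
  proof
    assume L: ?L
    then have i: "integrable ?P \<Phi>" using iff by simp
    have "AE e in count_space (arcs G). integrable unit_interval (\<lambda>s. \<Phi> (e, s))" by (rule AE_integrable_fst'[OF i])
    moreover have "integrable (count_space (arcs G)) ?g" using integrable_fst'[OF i] by (simp add: inner)
    ultimately show ?R using sum_iff inner_i by (auto simp: AE_count_space)
  next
    assume R: ?R
    have "integrable ?P \<Phi>"
    proof (rule Fubini_integrable[OF \<Phi>m])
      have "(\<integral>s. norm (\<Phi> (e, s)) \<partial>unit_interval) = ?g e" if "e \<in> arcs G" for e
        using conductivity_pos[OF that] F0 by (simp add: \<Phi>_def abs_mult)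
      then have "integrable (count_space (arcs G)) (\<lambda>e. \<integral>s. norm (\<Phi> (e, s)) \<partial>unit_interval) \<longleftrightarrow> integrable (count_space (arcs G)) ?g"
        by (intro Bochner_Integration.integrable_cong) auto
      then show "integrable (count_space (arcs G)) (\<lambda>e. \<integral>s. norm (\<Phi> (e, s)) \<partial>unit_interval)" using R sum_iff by simp
      show "AE e in count_space (arcs G). integrable unit_interval (\<lambda>s. \<Phi> (e, s))" using R inner_i by (simp add: AE_count_space)
    qed
    then show ?L using iff by simp
  qed
  assume L: ?L
  then have i: "integrable ?P \<Phi>" using iff by simp
  have "(\<integral>x. \<Phi> x \<partial>?P) = (\<integral>e. ?g e \<partial>count_space (arcs G))" using integral_fst'[OF i] by (simp add: inner)
  also have "\<dots> = infsetsum ?g (arcs G)" by (simp add: infsetsum_def)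
  also have "\<dots> = infsum ?g (arcs G)"
    using integrable_fst'[OF i] by (intro infsetsum_infsum) (simp add: inner Infinite_Set_Sum.abs_summable_on_def)
  finally show "(\<integral>x. F x \<partial>graph_measure G c) = (\<Sum>\<^sub>\<infinity>e \<in> arcs G. c e * (\<integral>s. F (Inner e s) \<partial>unit_interval))"
    using int by simp
qed

lemma continuous_on_graph_measurable:
  assumes "continuous_on_graph G u"
  shows "u \<in> borel_measurable (graph_measure G c)"
proof -
  let ?O = "{U. openin (mtopology_of (graph_metric G)) U}"
  have sub: "?O \<subseteq> Pow (points G)"
    using openin_subset[of "mtopology_of (graph_metric G)"] by auto
  have "u \<in> borel_measurable (sigma (points G) ?O)"
  proof (rule borel_measurableI)
    fix W :: "complex set" assume "open W"
    then have "openin (mtopology_of (graph_metric G)) {x \<in> points G. u x \<in> W}"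
      using openin_continuous_map_preimage[OF assms[unfolded continuous_on_graph_def], of W] by simp
    moreover have "u -` W \<inter> space (sigma (points G) ?O) = {x \<in> points G. u x \<in> W}"
      using sub by (auto simp: space_measure_of)
    ultimately show "u -` W \<inter> space (sigma (points G) ?O) \<in> sets (sigma (points G) ?O)"
      using sub by (simp add: sets_measure_of)
  qed
  then show ?thesis by (simp add: graph_measure_def)
qed

lemma edge_function_inner: "s \<in> {0<..<1} \<Longrightarrow> edge_function G u e s = u (Inner e s)"
  by (simp add: edge_function_def edge_point_def)

text \<open>The vertices carry no mass, so \<open>edge_function\<close> may replace \<open>u\<close>
  in the interiors, and the norm becomes an iterated one.\<close>

lemma Lp_edgewise:
  assumes p: "1 \<le> p" and m: "u \<in> borel_measurable (graph_measure G c)"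
  shows "u \<in> vectors (Lp (graph_measure G c) p) \<longleftrightarrow>
      (\<forall>e \<in> arcs G. integrable unit_interval (\<lambda>s. norm (edge_function G u e s) powr p)) \<and>
      (\<lambda>e. lp_on_edge p (edge_function G u e)) \<in> lp_seq p"
    and "u \<in> vectors (Lp (graph_measure G c) p) \<Longrightarrow>
      snorm (Lp (graph_measure G c) p) u = lp_norm p (\<lambda>e. lp_on_edge p (edge_function G u e))"
    and "e \<in> arcs G \<Longrightarrow> edge_function G u e \<in> borel_measurable unit_interval"
proof -
  let ?F = "\<lambda>x. norm (u x) powr p"
  have mF: "?F \<in> borel_measurable (graph_measure G c)" using m by measurable
  have i: "integrable unit_interval (\<lambda>s. ?F (Inner e s)) \<longleftrightarrow> integrable unit_interval (\<lambda>s. norm (edge_function G u e s) powr p)" for e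
    by (rule Bochner_Integration.integrable_cong) (auto simp: space_unit_interval edge_function_inner)
  have j: "(\<integral>s. ?F (Inner e s) \<partial>unit_interval) = lp_on_edge p (edge_function G u e) powr p" for e
    unfolding lp_on_edge_powr[OF p]
    by (rule Bochner_Integration.integral_cong) (auto simp: space_unit_interval edge_function_inner)
  have nn: "0 \<le> lp_on_edge p f" for f by (simp add: lp_on_edge_def)
  show "u \<in> vectors (Lp (graph_measure G c) p) \<longleftrightarrow>
      (\<forall>e \<in> arcs G. integrable unit_interval (\<lambda>s. norm (edge_function G u e s) powr p)) \<and>
      (\<lambda>e. lp_on_edge p (edge_function G u e)) \<in> lp_seq p"
    using graph_integral(1)[OF mF] m by (simp add: i j Lp_def lp_seq_def nn)
  show "snorm (Lp (graph_measure G c) p) u = lp_norm p (\<lambda>e. lp_on_edge p (edge_function G u e))"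
    if "u \<in> vectors (Lp (graph_measure G c) p)"
    using graph_integral(2)[OF mF] that by (simp add: Lp_def lp_norm_def j)
  show "edge_function G u e \<in> borel_measurable unit_interval" if "e \<in> arcs G"
    using measurable_on_edges(2)[OF m that]
    by (subst measurable_cong[of _ _ "\<lambda>s. u (Inner e s)"]) (auto simp: space_unit_interval edge_function_inner)
qed

text \<open>For edgewise Lipschitz functions, measurability comes from continuity on the graph and
  integrability from the pointwise bound on edges of mass \<open>1\<close>.\<close>

lemma Lp_laplacian_space:
  assumes p: "1 \<le> p"
  shows "laplacian_space G c (lp_seq p) (lp_norm p) (Lp (graph_measure G c) p) (lp_on_edge p)"
proof -
  interpret edge_sequence_space G c "lp_seq p" "lp_norm p" by (rule lp_edge_sequence_space[OF p])
  let ?X = "Lp (graph_measure G c) p"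
  have meas: "u \<in> borel_measurable (graph_measure G c)" if "u \<in> vectors ?X" for u
    using that by (simp add: Lp_def)
  have nn: "0 \<le> lp_on_edge p f" for f by (simp add: lp_on_edge_def)
  show ?thesis
  proof (intro_locales, unfold_locales)
    fix u assume u: "u \<in> vectors ?X"
    note e = Lp_edgewise[OF p meas[OF u]]
    show "(\<lambda>e. lp_on_edge p (edge_function G u e)) \<in> lp_seq p \<and>
        snorm ?X u = lp_norm p (\<lambda>e. lp_on_edge p (edge_function G u e))"
      using e(1,2) u by simp
    fix e' assume e': "e' \<in> arcs G"
    show "set_integrable lborel {0..1} (edge_function G u e') \<and>
      integral {0..1} (\<lambda>s. norm (edge_function G u e' s)) \<le> 2 * lp_on_edge p (edge_function G u e')"
      by (rule lp_on_edge_integrable[OF p e(3)[OF e']]) (use e(1) u e' in simp)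
    show "lp_on_edge p (edge_function G u e') \<le> B"
      if "\<And>s. s \<in> {0..1} \<Longrightarrow> norm (edge_function G u e' s) \<le> B" for B
      by (rule lp_on_edge_le[OF p _ that]) (use e(1) u e' in auto)
  next
    fix \<beta> u assume \<beta>: "\<beta> \<in> lp_seq p"
      and b1: "\<And>e s. e \<in> arcs G \<Longrightarrow> s \<in> {0..1} \<Longrightarrow> norm (edge_function G u e s) \<le> \<beta> e"
      and b2: "\<And>e s t. e \<in> arcs G \<Longrightarrow> s \<in> {0..1} \<Longrightarrow> t \<in> {0..1} \<Longrightarrow>
        norm (edge_function G u e t - edge_function G u e s) \<le> \<beta> e * \<bar>t - s\<bar>"
    have cu: "continuous_on_graph G u" by (rule continuous_on_graph_edgewise_lipschitz[of u \<beta>, OF b2])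
    note m = continuous_on_graph_measurable[OF cu] and e = Lp_edgewise[OF p continuous_on_graph_measurable[OF cu]]
    have i: "integrable unit_interval (\<lambda>s. norm (edge_function G u e' s) powr p)" if e': "e' \<in> arcs G" for e'
    proof (rule Bochner_Integration.integrable_bound[OF unit_interval_const(1)[of "\<beta> e' powr p"]])
      show "(\<lambda>s. norm (edge_function G u e' s) powr p) \<in> borel_measurable unit_interval"
        using e(3)[OF e'] by measurable
      show "AE s in unit_interval. norm (norm (edge_function G u e' s) powr p) \<le> norm (\<beta> e' powr p)"
        using b1[OF e'] p by (intro AE_I2) (auto simp: space_unit_interval intro!: powr_mono2)
    qed
    have "(\<lambda>e'. lp_on_edge p (edge_function G u e')) \<in> lp_seq p"
      using solid[OF \<beta>, of "\<lambda>e'. lp_on_edge p (edge_function G u e')"] lp_on_edge_le[OF p i b1] nn by blast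
    then show "u \<in> vectors ?X" using e(1) i by simp
  next
    fix f u a assume f: "f \<in> vectors ?X" and u: "u \<in> vectors ?X"
    have mf: "f \<in> borel_measurable (graph_measure G c)" "u \<in> borel_measurable (graph_measure G c)"
      using meas f u by auto
    then have m: "(\<lambda>x. f x - a * u x) \<in> borel_measurable (graph_measure G c)" by measurable
    have "integrable (graph_measure G c) (\<lambda>x. norm (f x - a * u x) powr p)"
    proof (rule Bochner_Integration.integrable_bound)
      show "integrable (graph_measure G c) (\<lambda>x. 2 powr p * (norm (f x) powr p + norm a powr p * norm (u x) powr p))"
        using f u by (intro integrable_mult_right Bochner_Integration.integrable_add) (auto simp: Lp_def)
      show "(\<lambda>x. norm (f x - a * u x) powr p) \<in> borel_measurable (graph_measure G c)" using m by measurable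
      show "AE x in graph_measure G c. norm (norm (f x - a * u x) powr p)
          \<le> norm (2 powr p * (norm (f x) powr p + norm a powr p * norm (u x) powr p))"
      proof (rule AE_I2)
        fix x
        have "norm (f x - a * u x) powr p \<le> (norm (f x) + norm a * norm (u x)) powr p"
          using norm_triangle_ineq4[of "f x" "a * u x"] p by (intro powr_mono2) (auto simp: norm_mult)
        also have "\<dots> \<le> 2 powr p * (norm (f x) powr p + (norm a * norm (u x)) powr p)"
          using p by (intro powr_add_le) auto
        also have "(norm a * norm (u x)) powr p = norm a powr p * norm (u x) powr p" by (simp add: powr_mult)
        finally show "norm (norm (f x - a * u x) powr p)
          \<le> norm (2 powr p * (norm (f x) powr p + norm a powr p * norm (u x) powr p))" by simp
      qed
    qed
    then show "(\<lambda>x. f x - a * u x) \<in> vectors ?X" using m by (simp add: Lp_def)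
  qed
qed

end

section \<open>Independence of the space\<close>

theorem corollary7p3:
  fixes G :: "('v, 'e) pre_digraph" and c :: "'e \<Rightarrow> real"
  assumes "metric_graph G c"
    and "growth_condition G c"
  shows "\<forall>X \<in> {Lp (graph_measure G c) p | p. 1 \<le> p} \<union> {C0_space G, BUC_space G}.
    spectrum X (neg_laplacian G c X) \<inter> resolvent_set L2_interval dirichlet_operator =
    spectrum (Lp (graph_measure G c) 2) (neg_laplacian G c (Lp (graph_measure G c) 2))
      \<inter> resolvent_set L2_interval dirichlet_operator"
proof -
  interpret growth_graph G c
    using assms by (simp add: growth_graph_def growth_graph_axioms_def)
  let ?XX = "{Lp (graph_measure G c) p | p. 1 \<le> p} \<union> {C0_space G, BUC_space G}"
  have spaces: "\<exists>Z N \<nu>. laplacian_space G c Z N X \<nu>" if "X \<in> ?XX" for X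
    using that Lp_laplacian_space C0_laplacian_space BUC_laplacian_space by blast
  have indep: "z \<in> resolvent_set X (neg_laplacian G c X) \<longleftrightarrow> z \<in> resolvent_set Y (neg_laplacian G c Y)"
    if X: "X \<in> ?XX" and Y: "Y \<in> ?XX" and z: "z \<in> resolvent_set L2_interval dirichlet_operator" for X Y z
  proof -
    \<comment> \<open>One pair \<open>S\<close>, \<open>C\<close> serves all spaces, so the
      criterion \<open>\<exists>g. green_kernel (C 1) g\<close> is the same for each of
      them.\<close>
    obtain S C where SC: "fundamental_solutions z S C" using ex_fundamental_solutions by blast
    have S1: "S 1 \<noteq> 0" by (rule fundamental_solutions.dirichlet_resolvent_imp[OF SC z])
    have "z \<in> resolvent_set W (neg_laplacian G c W) \<longleftrightarrow> (\<exists>g. green_kernel (C 1) g)" if W: "W \<in> ?XX" for W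
    proof -
      obtain Z N \<nu> where "laplacian_space G c Z N W \<nu>" using spaces[OF W] by blast
      then have "spectral_problem G c Z N W \<nu> z S C"
        using SC S1 by (simp add: spectral_problem_def spectral_problem_axioms_def)
      then show ?thesis by (rule spectral_problem.resolvent_iff_green_kernel)
    qed
    with X Y show ?thesis by simp
  qed
  have "Lp (graph_measure G c) 2 \<in> ?XX" by force
  then show ?thesis using indep unfolding spectrum_def by blast
qed
end
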